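(* Let $M$ be a free abelian group of finite rank, $N=\mathrm{Hom}(M,\mathbb{Z})$, and let $X\subset\mathbb{T}_N$ be a (closed algebraic) subvariety of the complex torus $\mathbb{T}_N=\mathrm{Hom}(M,\mathbb{C}^* )$. Let $\mathrm{co}\mathscr{A}(X)\subset\mathbb{U}_N$ be its coamoeba and $\mathscr{P}^\infty(X)\subset\mathbb{U}_N$ its phase limit set. Then the closure of $\mathrm{co}\mathscr{A}(X)$ in $\mathbb{U}_N$ is $\mathrm{co}\mathscr{A}(X)\cup\mathscr{P}^\infty(X)$, and $$\mathscr{P}^\infty(X)\ =\ \bigcup_{w\in\mathbb{R}_N,\ w\neq 0}\mathrm{co}\mathscr{A}(\mathrm{in}_w X).$$
   Context: Write $\mathbb{R}_N=N\otimes_{\mathbb{Z}}\mathbb{R}$, $\mathbb{U}=\{z\in\mathbb{C}:|z|=1\}$ (identified with $\mathbb{R}/2\pi\mathbb{Z}$) and $\mathbb{U}_N=N\otimes_{\mathbb Z}\mathbb{U}=\mathrm{Hom}(M,\mathbb{U})$; $\langle\cdot,\cdot\rangle$ is the pairing between $M$ and $\mathbb{R}_N$. The coordinate ring of $\mathbb{T}_N$ is the group ring $\mathbb{C}[M]$ (Laurent polynomials); $\xi^{\mathbf m}$ denotes the element corresponding to $\mathbf m\in M$. The maps $\mathrm{Log}:\mathbb{T}_N\to\mathbb{R}_N$ and $\arg:\mathbb{T}_N\to\mathbb{U}_N$ are induced by $z\mapsto\log|z|$ and $z\mapsto z/|z|$ on $\mathbb{C}^*$ (choosing a basis of $N$,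 they are the coordinatewise maps on $(\mathbb{C}^* )^n$). The coamoeba of a subvariety or subscheme $Z\subset\mathbb{T}_N$ is $\mathrm{co}\mathscr{A}(Z)=\arg(Z)$, the image of its set of complex points. The phase limit set $\mathscr{P}^\infty(X)$ is the set of all accumulation points in $\mathbb{U}_N$ of sequences $\{\arg(x_n)\}_{n\in\mathbb{N}}$ (limits of convergent subsequences), where $\{x_n\}\subset X$ is an unbounded sequence, meaning that $\|\mathrm{Log}(x_n)\|\to\infty$. For $w\in\mathbb{R}_N$ and nonzero $f=\sum_{\mathbf m\in\mathcal A}c_{\mathbf m}\xi^{\mathbf m}$ with $\mathcal A\subset M$ finite and all $c_{\mathbf m}\in\mathbb{C}^*$, let $w(f)=\min_{\mathbf m\in\mathcal A}\langle\mathbf m,w\rangle$ and let $\mathrm{in}_w f=\sum_{\langle\mathbf m,w\rangle=w(f)}c_{\mathbf m}\xi^{\mathbf m}$ be the initial form. If $I\subset\mathbb{C}[M]$ is the ideal of $X$, then $\mathrm{in}_wI$ is the ideal of $\mathbb{C}[M]$ generated by $\{\mathrm{in}_wf: f\in I\}$, and $\mathrm{in}_wX\subset\mathbb{T}_N$ is the (possibly empty) subscheme it defines. *)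

theory Defs
  imports "HOL-Analysis.Analysis" "HOL-Library.Poly_Mapping"
begin

text \<open>
  The lattice \<open>M\<close> is the additive group of a type \<open>'m\<close>.  For an abelian group \<open>A\<close>, the group
  \<open>N \<otimes> A\<close> with \<open>N = Hom(M, \<int>)\<close> is represented by \<open>Hom(M, A)\<close>, to which it is canonically
  isomorphic when \<open>M\<close> is free of finite rank.  A homomorphism is an honest function on \<open>'m\<close>, and
  the pairing of \<open>m\<close> with \<open>w\<close> is \<open>w m\<close>.
\<close>

definition free_of_finite_rank :: "'m::ab_group_add itself \<Rightarrow> bool" where
  "free_of_finite_rank _ \<longleftrightarrow>
     (\<exists>(n::nat) (\<phi> :: 'm \<Rightarrow> (nat \<Rightarrow>\<^sub>0 int)).
        Modules.additive \<phi> \<and> bij_betw \<phi> UNIV {c. Poly_Mapping.keys c \<subseteq> {..<n}})"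

definition R_N :: "('m::ab_group_add \<Rightarrow> real) set" where
  "R_N = {w. Modules.additive w}"

definition T_N :: "('m::ab_group_add \<Rightarrow> complex) set" where
  "T_N = {x. (\<forall>a. x a \<noteq> 0) \<and> x 0 = 1 \<and> (\<forall>a b. x (a + b) = x a * x b)}"

text \<open>
  \<open>U_N\<close> carries the subspace topology of the product topology on functions (pointwise convergence).
  A homomorphism is determined by its values on a basis of \<open>M\<close>, so this is the usual topology of
  the compact torus.
\<close>

definition U_N :: "('m::ab_group_add \<Rightarrow> complex) set" where
  "U_N = {u \<in> T_N. \<forall>a. cmod (u a) = 1}"

definition Log_map :: "('m \<Rightarrow> complex) \<Rightarrow> 'm \<Rightarrow> real" where
  "Log_map x = (\<lambda>m. ln (cmod (x m)))"

definition arg_map :: "('m \<Rightarrow> complex) \<Rightarrow> 'm \<Rightarrow> complex" where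
  "arg_map x = (\<lambda>m. x m / complex_of_real (cmod (x m)))"

definition norm_on_R_N :: "(('m::ab_group_add \<Rightarrow> real) \<Rightarrow> real) \<Rightarrow> bool" where
  "norm_on_R_N \<nu> \<longleftrightarrow>
     (\<forall>w\<in>R_N. 0 \<le> \<nu> w \<and> (\<nu> w = 0 \<longleftrightarrow> w = (\<lambda>_. 0))) \<and>
     (\<forall>c. \<forall>w\<in>R_N. \<nu> (\<lambda>m. c * w m) = \<bar>c\<bar> * \<nu> w) \<and>
     (\<forall>v\<in>R_N. \<forall>w\<in>R_N. \<nu> (\<lambda>m. v m + w m) \<le> \<nu> v + \<nu> w)"

text \<open>
  The group ring \<open>\<complex>[M]\<close> is the ring \<open>'m \<Rightarrow>\<^sub>0 complex\<close> of finitely supported functions under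
  convolution; the monomial of \<open>m\<close> is \<open>Poly_Mapping.single m 1\<close>, with value \<open>x m\<close> at \<open>x\<close>.
\<close>

definition laurent_eval :: "('m::ab_group_add \<Rightarrow>\<^sub>0 complex) \<Rightarrow> ('m \<Rightarrow> complex) \<Rightarrow> complex" where
  "laurent_eval f x = (\<Sum>m\<in>Poly_Mapping.keys f. Poly_Mapping.lookup f m * x m)"

definition zero_locus :: "('m::ab_group_add \<Rightarrow>\<^sub>0 complex) set \<Rightarrow> ('m \<Rightarrow> complex) set" where
  "zero_locus S = {x \<in> T_N. \<forall>f\<in>S. laurent_eval f x = 0}"

definition closed_subvariety :: "('m::ab_group_add \<Rightarrow> complex) set \<Rightarrow> bool" where
  "closed_subvariety X \<longleftrightarrow> (\<exists>S. X = zero_locus S)"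

definition vanishing_ideal :: "('m::ab_group_add \<Rightarrow> complex) set \<Rightarrow> ('m \<Rightarrow>\<^sub>0 complex) set" where
  "vanishing_ideal X = {f. \<forall>x\<in>X. laurent_eval f x = 0}"

definition is_ideal :: "'a::comm_ring_1 set \<Rightarrow> bool" where
  "is_ideal J \<longleftrightarrow> 0 \<in> J \<and> (\<forall>f\<in>J. \<forall>g\<in>J. f + g \<in> J) \<and> (\<forall>h. \<forall>f\<in>J. h * f \<in> J)"

definition weight :: "('m \<Rightarrow> real) \<Rightarrow> ('m \<Rightarrow>\<^sub>0 complex) \<Rightarrow> real" where
  "weight w f = Min (w ` Poly_Mapping.keys f)"

definition initial_form :: "('m \<Rightarrow> real) \<Rightarrow> ('m \<Rightarrow>\<^sub>0 complex) \<Rightarrow> ('m \<Rightarrow>\<^sub>0 complex)" where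
  "initial_form w f =
     (\<Sum>m\<in>{m \<in> Poly_Mapping.keys f. w m = weight w f}.
        Poly_Mapping.single m (Poly_Mapping.lookup f m))"

definition initial_ideal ::
    "('m::ab_group_add \<Rightarrow> real) \<Rightarrow> ('m \<Rightarrow>\<^sub>0 complex) set \<Rightarrow> ('m \<Rightarrow>\<^sub>0 complex) set" where
  "initial_ideal w I = is_ideal hull {initial_form w f | f. f \<in> I \<and> f \<noteq> 0}"

text \<open>
  A coamoeba only sees complex points, so \<open>initial_locus w X\<close> is the set of complex points of the
  scheme defined by the initial ideal.
\<close>

definition initial_locus ::
    "('m::ab_group_add \<Rightarrow> real) \<Rightarrow> ('m \<Rightarrow> complex) set \<Rightarrow> ('m \<Rightarrow> complex) set" where
  "initial_locus w X = zero_locus (initial_ideal w (vanishing_ideal X))"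

definition coamoeba :: "('m::ab_group_add \<Rightarrow> complex) set \<Rightarrow> ('m \<Rightarrow> complex) set" where
  "coamoeba Z = arg_map ` Z"

definition phase_limit_set ::
    "(('m::ab_group_add \<Rightarrow> real) \<Rightarrow> real) \<Rightarrow> ('m \<Rightarrow> complex) set \<Rightarrow> ('m \<Rightarrow> complex) set" where
  "phase_limit_set \<nu> X =
     {u \<in> U_N. \<exists>(x :: nat \<Rightarrow> 'm \<Rightarrow> complex) r.
        (\<forall>n. x n \<in> X) \<and>
        filterlim (\<lambda>n. \<nu> (Log_map (x n))) at_top sequentially \<and>
        strict_mono r \<and> (\<lambda>n. arg_map (x (r n))) \<longlonglongrightarrow> u}"

end

theory Submission
  imports Defs "HOL-Computational_Algebra.Computational_Algebra"
begin

text \<open>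
  Let \<open>I\<close> be the ideal of \<open>X\<close>.  Limits are taken along ultrafilters.  A sequence in \<open>X\<close> with convergent
  arguments and bounded logarithms converges to a point of \<open>X\<close>; this gives the closure.

  If the logarithms are unbounded, subtract from \<open>w\<^sub>k = - Log x\<^sub>k\<close> a convergent part, so that the
  remaining homomorphisms vanish or diverge at each lattice point.  They need not converge
  projectively, but they induce a group order, for which \<open>I\<close> has a finite Groebner basis.  For large
  \<open>k\<close> it is also a basis for an order refining the weight \<open>w\<close> given by the remaining part of \<open>w\<^sub>k\<close>.  The initial forms of the
  basis vanish at the limit \<open>y\<close> of the bounded factor of \<open>x\<^sub>k\<close>, hence by reduction all initial forms of \<open>I\<close>
  for \<open>w\<close> do, and \<open>arg y\<close> is the given phase limit.

  Conversely let \<open>y\<close> be a point of the initial scheme for \<open>w \<noteq> 0\<close>.  The homomorphism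
  \<open>t powr (- w m) * \<xi>\<^sup>m \<mapsto> y m\<close> is defined on a ring of functions on \<open>X\<close> times small \<open>t > 0\<close>, and by
  Chevalley's theorem it extends to a place of an ultrapower \<open>L\<close> of the complex numbers, which contains
  a generic point of \<open>X\<close>.  This place and the standard part agree on the field generated by the powers of
  \<open>t\<close>.  Specializing the transcendental coordinates one at a time and lifting through algebraic
  extensions yields a point of \<open>X\<close> over \<open>L\<close> whose coordinates are \<open>t powr (w m)\<close> times an element with
  standard part \<open>y m\<close>.  Its representatives are unbounded points of \<open>X\<close> with arguments tending to \<open>arg y\<close>.
\<close>

section \<open>Places and Chevalley's extension theorem\<close>

text \<open>The place given by Chevalley's theorem knows the residue \<open>y m\<close> but nothing
  about convergence: the rescaled coordinates of the generic point need not be anywhere near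
  \<open>y\<close>. The standard part measures convergence, but its values at the generic point are
  uncontrolled. The point therefore has to be moved within X, by a homomorphism that fixes the
  coefficients and the powers of t and so preserves the equations of X, to a position where the
  standard part takes the values that the first place prescribes. Real exponents of t are forced by
  real weights, and the ultrapower is one algebraically closed field that has all of them and whose
  elements are represented by families of complex numbers. In the other inclusion, coordinates may
  diverge at different speeds, and a limiting direction would remember only the fastest. A group
  order remembers all of them, and the finitely many comparisons made by a Groebner basis are
  reproduced by a single homomorphism far out in the sequence.\<close>

text \<open>
  A homomorphism defined on a subring \<open>Domain g\<close> of \<open>'k\<close> is represented by its graph \<open>g\<close>.
\<close>
definition hom_graph :: "('k::field \<times> 'r::field) set \<Rightarrow> bool" where
  "hom_graph g \<longleftrightarrow> (1, 1) \<in> g \<and>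
     (\<forall>a b c d. (a, b) \<in> g \<longrightarrow> (c, d) \<in> g \<longrightarrow> (a - c, b - d) \<in> g \<and> (a * c, b * d) \<in> g) \<and>
     (\<forall>b. (0, b) \<in> g \<longrightarrow> b = 0)"

text \<open>The domain is a valuation ring of \<open>'k\<close>, and the elements of residue 0 form
  its maximal ideal. In terms of absolute values, residue 0 means infinitesimal, and an element
  outside the domain is infinitely large.\<close>

definition place :: "('k::field \<times> 'r::field) set \<Rightarrow> bool" where
  "place g \<longleftrightarrow> hom_graph g \<and> (\<forall>x. (\<exists>a. (x, a) \<in> g) \<or> (inverse x, 0) \<in> g)"

text \<open>\<open>q\<close> is the reduction of \<open>p\<close>. In particular,
  \<open>poly_related g p 0\<close> says that all coefficients of \<open>p\<close> lie in the
  kernel.\<close>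

definition poly_related :: "('k::field \<times> 'r::field) set \<Rightarrow> 'k poly \<Rightarrow> 'r poly \<Rightarrow> bool" where
  "poly_related g p q \<longleftrightarrow> (\<forall>i. (coeff p i, coeff q i) \<in> g)"

lemma poly_altdef_le: "degree p \<le> n \<Longrightarrow> poly p x = (\<Sum>i\<le>n. coeff p i * x ^ i)"
  for x :: "'a::comm_semiring_1"
  unfolding poly_altdef by (rule sum.mono_neutral_left) (auto simp: coeff_eq_0)

lemma place_imp_hom_graph: "place g \<Longrightarrow> hom_graph g"
  by (simp add: place_def)

context
  fixes g :: "('k::field \<times> 'r::field) set"
  assumes g: "hom_graph g"
begin

lemma hom_graph_one: "(1, 1) \<in> g"
  using g by (simp add: hom_graph_def)

lemma hom_graph_diff: "(a, b) \<in> g \<Longrightarrow> (c, d) \<in> g \<Longrightarrow> (a - c, b - d) \<in> g"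
  using g by (simp add: hom_graph_def)

lemma hom_graph_mult: "(a, b) \<in> g \<Longrightarrow> (c, d) \<in> g \<Longrightarrow> (a * c, b * d) \<in> g"
  using g by (simp add: hom_graph_def)

lemma hom_graph_zero: "(0, 0) \<in> g"
  using hom_graph_diff[OF hom_graph_one hom_graph_one] by simp

lemma hom_graph_zeroD: "(0, b) \<in> g \<Longrightarrow> b = 0"
  using g by (simp add: hom_graph_def)

lemma hom_graph_uminus: "(a, b) \<in> g \<Longrightarrow> (- a, - b) \<in> g"
  using hom_graph_diff[OF hom_graph_zero, of a b] by simp

lemma hom_graph_add: "(a, b) \<in> g \<Longrightarrow> (c, d) \<in> g \<Longrightarrow> (a + c, b + d) \<in> g"
  using hom_graph_diff[of a b "- c" "- d"] hom_graph_uminus[of c d] by simp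

lemma hom_graph_unique: "(a, b) \<in> g \<Longrightarrow> (a, c) \<in> g \<Longrightarrow> b = c"
  using hom_graph_diff[of a b a c] hom_graph_zeroD[of "b - c"] by simp

lemma hom_graph_power: "(a, b) \<in> g \<Longrightarrow> (a ^ n, b ^ n) \<in> g"
  by (induction n) (auto simp: hom_graph_one hom_graph_mult)

lemma hom_graph_sum: "(\<And>i. i \<in> A \<Longrightarrow> (f i, h i) \<in> g) \<Longrightarrow> (sum f A, sum h A) \<in> g"
  by (induction A rule: infinite_finite_induct) (auto simp: hom_graph_zero hom_graph_add)

lemma hom_graph_nonzero: "(a, b) \<in> g \<Longrightarrow> b \<noteq> 0 \<Longrightarrow> a \<noteq> 0"
  using hom_graph_zeroD by blast

lemma poly_related_0: "poly_related g 0 0"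
  by (simp add: poly_related_def hom_graph_zero)

lemma poly_related_diff:
  "poly_related g p q \<Longrightarrow> poly_related g p' q' \<Longrightarrow> poly_related g (p - p') (q - q')"
  by (simp add: poly_related_def hom_graph_diff)

lemma poly_related_add:
  "poly_related g p q \<Longrightarrow> poly_related g p' q' \<Longrightarrow> poly_related g (p + p') (q + q')"
  by (simp add: poly_related_def hom_graph_add)

lemma poly_related_mult:
  "poly_related g p q \<Longrightarrow> poly_related g p' q' \<Longrightarrow> poly_related g (p * p') (q * q')"
  by (simp add: poly_related_def coeff_mult hom_graph_sum hom_graph_mult)

lemma poly_related_monom: "(a, b) \<in> g \<Longrightarrow> poly_related g (monom a n) (monom b n)"
  by (simp add: poly_related_def hom_graph_zero)

lemma poly_related_smult: "(a, b) \<in> g \<Longrightarrow> poly_related g p q \<Longrightarrow> poly_related g (smult a p) (smult b q)"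
  by (simp add: poly_related_def hom_graph_mult)

lemma poly_related_pCons: "(a, b) \<in> g \<Longrightarrow> poly_related g p q \<Longrightarrow> poly_related g (pCons a p) (pCons b q)"
  by (auto simp: poly_related_def coeff_pCons split: nat.splits)

lemma poly_related_1: "poly_related g 1 1"
  using poly_related_pCons[OF hom_graph_one poly_related_0] by (simp add: one_pCons)

lemma poly_related_degree_le: "poly_related g p q \<Longrightarrow> degree q \<le> degree p"
  using hom_graph_zeroD by (intro degree_le) (metis coeff_eq_0 poly_related_def)

lemma poly_related_poly:
  assumes "poly_related g p q" "(x, y) \<in> g"
  shows "(poly p x, poly q y) \<in> g"
proof -
  have "poly q y = (\<Sum>i\<le>degree p. coeff q i * y ^ i)"
    using poly_related_degree_le[OF assms(1)] by (intro poly_altdef_le)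
  then show ?thesis
    unfolding poly_altdef[of p]
    using assms by (auto simp: poly_related_def intro!: hom_graph_sum hom_graph_mult hom_graph_power)
qed

lemma hom_graph_inverse_if_place:
  assumes "place g" "(a, b) \<in> g" "b \<noteq> 0"
  shows "(inverse a, inverse b) \<in> g"
proof (cases "\<exists>c. (inverse a, c) \<in> g")
  case True
  then obtain c where c: "(inverse a, c) \<in> g" by blast
  have "a \<noteq> 0" using assms hom_graph_nonzero by blast
  then have "(1, b * c) \<in> g" using hom_graph_mult[OF assms(2) c] by simp
  then have "b * c = 1" using hom_graph_unique hom_graph_one by blast
  then have "c = inverse b" by (metis inverse_unique)
  with c show ?thesis by simp
next
  case False
  then have "(inverse (inverse a), 0) \<in> g" using assms(1) unfolding place_def by blast
  then show ?thesis using assms hom_graph_unique by fastforce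
qed

definition adjoin :: "'k \<Rightarrow> 'r \<Rightarrow> ('k \<times> 'r) set" where
  "adjoin x y = {(poly p x, poly q y) | p q. poly_related g p q}"

text \<open>Relations of \<open>x\<close> pass to \<open>y\<close>, so the value at a polynomial
  expression in \<open>x\<close> does not depend on the polynomial chosen.\<close>

lemma hom_graph_adjoin:
  assumes "\<And>p q. poly_related g p q \<Longrightarrow> poly p x = 0 \<Longrightarrow> poly q y = 0"
  shows "hom_graph (adjoin x y)"
  unfolding hom_graph_def
proof (intro conjI allI impI)
  show "(1, 1) \<in> adjoin x y"
    unfolding adjoin_def using poly_related_1 by force
next
  fix a b c d assume *: "(a, b) \<in> adjoin x y" "(c, d) \<in> adjoin x y"
  obtain p q where 1: "poly_related g p q" "a = poly p x" "b = poly q y" using * by (auto simp: adjoin_def)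
  obtain r s where 2: "poly_related g r s" "c = poly r x" "d = poly s y" using * by (auto simp: adjoin_def)
  show "(a - c, b - d) \<in> adjoin x y"
    unfolding adjoin_def using poly_related_diff[OF 1(1) 2(1)] 1 2 by force
  show "(a * c, b * d) \<in> adjoin x y"
    unfolding adjoin_def using poly_related_mult[OF 1(1) 2(1)] 1 2 by force
qed (use assms in \<open>auto simp: adjoin_def\<close>)

lemma subset_adjoin: "g \<subseteq> adjoin x y"
proof
  fix z assume "z \<in> g"
  then have "poly_related g [:fst z:] [:snd z:]"
    by (auto intro: poly_related_pCons poly_related_0)
  then show "z \<in> adjoin x y" unfolding adjoin_def by (cases z) force
qed

lemma mem_adjoin: "(x, y) \<in> adjoin x y"
proof -
  have "poly_related g [:0, 1:] [:0, 1:]"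
    by (auto intro!: poly_related_pCons poly_related_0 hom_graph_zero hom_graph_one)
  then show ?thesis unfolding adjoin_def by force
qed

end

text \<open>Infinite descent on \<open>n + m\<close>: the relation with the smaller degree bound
  rewrites the top power in the other one and lowers its bound, until one of the two would say that
  a constant of residue 0 equals 1. In Chevalley's theorem this excludes that neither
  \<open>x\<close> nor \<open>inverse x\<close> can be given a value.\<close>

lemma unit_relations_incompatible:
  fixes h :: "('k::field \<times> 'r::field) set"
  assumes h: "hom_graph h" and inv: "\<And>a b. (a, b) \<in> h \<Longrightarrow> b \<noteq> 0 \<Longrightarrow> (inverse a, inverse b) \<in> h"
    and "degree p \<le> n" "poly_related h p 0" "poly p x = 1"
    and "degree q \<le> m" "poly_related h q 0" "poly q (inverse x) = 1" and "x \<noteq> 0"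
  shows False
  using assms(3-)
proof (induction "n + m" arbitrary: n m p q x rule: less_induct)
  case less
  have main: False
    if mn: "m \<le> n" and x: "x \<noteq> 0"
      and p: "degree p \<le> n" "poly_related h p 0" "poly p x = 1"
      and q: "degree q \<le> m" "poly_related h q 0" "poly q (inverse x) = 1"
      and IH: "\<And>p'. n \<noteq> 0 \<Longrightarrow> degree p' \<le> n - 1 \<Longrightarrow> poly_related h p' 0 \<Longrightarrow> poly p' x = 1 \<Longrightarrow> False"
    for x :: 'k and p q n m
  proof -
    have qc: "(coeff q i, 0) \<in> h" for i using q(2) by (simp add: poly_related_def)
    have pc: "(coeff p i, 0) \<in> h" for i using p(2) by (simp add: poly_related_def)
    have "m \<noteq> 0"
    proof
      assume "m = 0"
      then have "q = [:coeff q 0:]" using q(1) by (metis degree_eq_zeroE coeff_pCons_0 le_zero_eq)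
      then have "coeff q 0 = 1" using q(3) by (metis poly_const_conv)
      then have "(1, 0) \<in> h" using qc by metis
      then show False using hom_graph_unique[OF h] hom_graph_one[OF h] by fastforce
    qed
    \<comment> \<open>Multiplying the relation for \<open>inverse x\<close> by \<open>x ^ m\<close>
      expresses \<open>u * x ^ m\<close> by lower powers of \<open>x\<close>. As \<open>u\<close>
      has residue 1, it can be divided out without leaving the kernel.\<close>
    define u where "u = 1 - coeff q 0"
    have u: "(u, 1) \<in> h" unfolding u_def using hom_graph_diff[OF h hom_graph_one[OF h] qc[of 0]] by simp
    then have u0: "u \<noteq> 0" using hom_graph_nonzero[OF h] by fastforce
    have ui: "(inverse u, 1) \<in> h" using inv[OF u] by simp
    define r where "r = (\<Sum>j\<in>{1..m}. monom (inverse u * coeff q j) (m - j))"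
    have r_rel: "poly_related h r 0"
      unfolding r_def poly_related_def coeff_sum
    proof
      fix i
      have "((\<Sum>j = 1..m. coeff (monom (inverse u * coeff q j) (m - j)) i), \<Sum>j = 1..m. 0) \<in> h"
        by (rule hom_graph_sum[OF h]) (use hom_graph_mult[OF h ui qc] hom_graph_zero[OF h] in auto)
      then show "((\<Sum>j = 1..m. coeff (monom (inverse u * coeff q j) (m - j)) i), coeff 0 i) \<in> h" by simp
    qed
    have r_deg: "degree r \<le> m - 1"
      unfolding r_def by (rule degree_sum_le) (auto intro!: order_trans[OF degree_monom_le])
    have "x ^ m = x ^ m * poly q (inverse x)" using q by simp
    also have "\<dots> = (\<Sum>j\<le>m. coeff q j * x ^ (m - j))"
      unfolding poly_altdef_le[OF q(1)] sum_distrib_left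
      using x by (intro sum.cong) (auto simp: power_diff field_simps)
    also have "{..m} = insert 0 {1..m}" by auto
    also have "(\<Sum>j\<in>insert 0 {1..m}. coeff q j * x ^ (m - j)) = coeff q 0 * x ^ m + (\<Sum>j\<in>{1..m}. coeff q j * x ^ (m - j))"
      by simp
    finally have "u * x ^ m = (\<Sum>j\<in>{1..m}. coeff q j * x ^ (m - j))"
      unfolding u_def by (simp add: algebra_simps)
    then have "x ^ m = inverse u * (\<Sum>j\<in>{1..m}. coeff q j * x ^ (m - j))"
      using u0 by (simp add: field_simps)
    also have "\<dots> = poly r x"
      unfolding r_def by (simp add: poly_sum poly_monom sum_distrib_left algebra_simps)
    finally have xr: "x ^ m = poly r x" .
    \<comment> \<open>The term in \<open>x ^ n\<close> is traded for \<open>x ^ (n - m)\<close>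
      times \<open>r\<close>, which has smaller degree and the same value at
      \<open>x\<close>.\<close>
    define p' where "p' = p - monom (coeff p n) n + smult (coeff p n) (monom 1 (n - m) * r)"
    have "poly_related h p' (0 - monom 0 n + smult 0 (monom 1 (n - m) * 0))"
      unfolding p'_def
      by (intro poly_related_add[OF h] poly_related_diff[OF h] poly_related_smult[OF h] poly_related_mult[OF h]
          poly_related_monom[OF h] pc p r_rel hom_graph_one[OF h])
    then have rel: "poly_related h p' 0" by simp
    have "degree (p - monom (coeff p n) n) \<le> n - 1"
      by (rule degree_le) (use p(1) coeff_eq_0 in \<open>auto simp: coeff_eq_0\<close>)
    moreover have "degree (smult (coeff p n) (monom 1 (n - m) * r)) \<le> n - 1"
    proof -
      have "degree (smult (coeff p n) (monom 1 (n - m) * r)) \<le> degree (monom (1::'k) (n - m) * r)" by (rule degree_smult_le)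
      also have "\<dots> \<le> degree (monom (1::'k) (n - m)) + degree r" by (rule degree_mult_le)
      also have "\<dots> \<le> (n - m) + (m - 1)" using r_deg degree_monom_le[of "1::'k" "n - m"] by linarith
      finally show ?thesis using mn \<open>m \<noteq> 0\<close> by linarith
    qed
    ultimately have deg: "degree p' \<le> n - 1" unfolding p'_def by (intro degree_add_le)
    have "poly p' x = 1 - coeff p n * x ^ n + coeff p n * (x ^ (n - m) * x ^ m)"
      unfolding p'_def using p xr by (simp add: poly_monom)
    also have "x ^ (n - m) * x ^ m = x ^ n" using mn by (simp flip: power_add)
    finally have "poly p' x = 1" by simp
    then show False using IH deg rel mn \<open>m \<noteq> 0\<close> by simp
  qed
  show False
  proof (cases "m \<le> n")
    case True
    show False
      by (rule main[OF True less.prems(7) less.prems(1-6)]) (rule less.hyps[of "n - 1" m], use less.prems in auto)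
  next
    case False
    \<comment> \<open>The situation is symmetric under exchanging \<open>x\<close> with its
      inverse.\<close>
    have "poly p (inverse (inverse x)) = 1" using less.prems by simp
    show False
      by (rule main[of n m "inverse x" q p]) 
        (use False less.prems in \<open>auto intro: less.hyps[of n "m - 1"]\<close>)
  qed
qed

text \<open>A maximal homomorphism defined on a subring is a place.\<close>
lemma hom_graph_extends_to_place:
  fixes g :: "('k::field \<times> 'r::alg_closed_field) set"
  assumes g: "hom_graph g"
  obtains h where "place h" "g \<subseteq> h"
proof -
  let ?A = "{h. hom_graph h \<and> g \<subseteq> h}"
  have "\<exists>M\<in>?A. \<forall>X\<in>?A. M \<subseteq> X \<longrightarrow> X = M"
  proof (rule subset_Zorn_nonempty)
    fix C assume C: "C \<noteq> {}" "subset.chain ?A C"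
    have dir: "\<exists>c\<in>C. z \<in> c \<and> z' \<in> c" if "z \<in> \<Union>C" "z' \<in> \<Union>C" for z z'
      using that C(2) unfolding subset_chain_def by blast
    have hom: "hom_graph c" "g \<subseteq> c" if "c \<in> C" for c using that C(2) unfolding subset_chain_def by auto
    have "hom_graph (\<Union>C)"
      unfolding hom_graph_def
    proof (intro conjI allI impI)
      show "(1, 1) \<in> \<Union>C" using C(1) hom hom_graph_one by blast
    next
      fix a b c d assume "(a, b) \<in> \<Union>C" "(c, d) \<in> \<Union>C"
      then obtain e where "e \<in> C" "(a, b) \<in> e" "(c, d) \<in> e" using dir by blast
      then show "(a - c, b - d) \<in> \<Union>C" "(a * c, b * d) \<in> \<Union>C"
        using hom hom_graph_diff hom_graph_mult by blast+
    next
      fix b assume "(0, b) \<in> \<Union>C"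
      then show "b = 0" using hom hom_graph_zeroD by blast
    qed
    then show "\<Union>C \<in> ?A" using C(1) hom by auto
  qed (use g in blast)
  then obtain h where h: "hom_graph h" "g \<subseteq> h" and max: "\<And>X. hom_graph X \<Longrightarrow> h \<subseteq> X \<Longrightarrow> X = h"
    by (smt (verit, ccfv_SIG) mem_Collect_eq subset_trans)
  \<comment> \<open>By maximality, adjoining \<open>x\<close> with an admissible value
    \<open>y\<close> adds nothing new.\<close>
  have extend: "(x, y) \<in> h" if "\<And>p q. poly_related h p q \<Longrightarrow> poly p x = 0 \<Longrightarrow> poly q y = 0" for x y
    using max[OF hom_graph_adjoin[OF h(1)] subset_adjoin[OF h(1)], of x y] mem_adjoin[OF h(1), of x y] that by blast
  \<comment> \<open>Multiplying by \<open>a ^ degree p\<close> turns a relation of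
    \<open>inverse a\<close> into one among elements of the domain.\<close>
  have inv: "(inverse a, inverse b) \<in> h" if ab: "(a, b) \<in> h" "b \<noteq> 0" for a b
  proof (rule extend)
    fix p q assume pq: "poly_related h p q" "poly p (inverse a) = 0"
    have a: "a \<noteq> 0" using ab hom_graph_nonzero[OF h(1)] by blast
    let ?n = "degree p"
    have eq: "c ^ ?n * (\<Sum>i\<le>?n. f i * inverse c ^ i) = (\<Sum>i\<le>?n. f i * c ^ (?n - i))" if "c \<noteq> 0"
      for c :: "'z::field" and f
      unfolding sum_distrib_left using that by (intro sum.cong) (auto simp: power_diff field_simps)
    have "((\<Sum>i\<le>?n. coeff p i * a ^ (?n - i)), (\<Sum>i\<le>?n. coeff q i * b ^ (?n - i))) \<in> h"
      using pq(1) ab(1) unfolding poly_related_def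
      by (intro hom_graph_sum[OF h(1)] hom_graph_mult[OF h(1)] hom_graph_power[OF h(1)]) auto
    moreover have "(\<Sum>i\<le>?n. coeff p i * a ^ (?n - i)) = a ^ ?n * poly p (inverse a)"
      unfolding poly_altdef using eq[OF a, of "coeff p"] by simp
    ultimately have "(\<Sum>i\<le>?n. coeff q i * b ^ (?n - i)) = 0"
      using pq(2) hom_graph_zeroD[OF h(1)] by simp
    moreover have "(\<Sum>i\<le>?n. coeff q i * b ^ (?n - i)) = b ^ ?n * poly q (inverse b)"
      unfolding poly_altdef_le[OF poly_related_degree_le[OF h(1) pq(1)]] using eq[OF ab(2), of "coeff q"] by simp
    ultimately show "poly q (inverse b) = 0" using ab(2) by simp
  qed
  have rel: "\<exists>p. poly_related h p 0 \<and> poly p x = 1" if x: "\<nexists>y. (x, y) \<in> h" for x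
  proof -
    \<comment> \<open>The ideal of reductions of all relations satisfied by \<open>x\<close>. A
      common zero of \<open>J\<close> would be an admissible value for \<open>x\<close>; over an
      algebraically closed field its generator \<open>q0\<close> is therefore a nonzero constant,
      and this is the relation sought.\<close>
    define J where "J = {q. \<exists>p. poly_related h p q \<and> poly p x = 0}"
    have "\<not> J \<subseteq> {0}"
    proof
      assume "J \<subseteq> {0}"
      then have "(x, 0) \<in> h" by (intro extend) (auto simp: J_def)
      then show False using x by blast
    qed
    then obtain q0 where q0: "q0 \<in> J" "q0 \<noteq> 0" and min: "\<And>q. q \<in> J \<Longrightarrow> q \<noteq> 0 \<Longrightarrow> degree q0 \<le> degree q"
      using arg_min_nat_lemma[of "\<lambda>q. q \<in> J \<and> q \<noteq> 0" _ degree] by blast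
    obtain p0 where p0: "poly_related h p0 q0" "poly p0 x = 0" using q0 by (auto simp: J_def)
    have lc: "(inverse (coeff p0 (degree q0)), inverse (lead_coeff q0)) \<in> h"
      using p0(1) q0(2) by (intro inv) (auto simp: poly_related_def)
    have dvd: "q0 dvd q" if "q \<in> J" for q
      using that
    proof (induction "degree q" arbitrary: q rule: less_induct)
      case less
      show ?case
      proof (cases "q = 0")
        case False
        obtain p where p: "poly_related h p q" "poly p x = 0" using less.prems by (auto simp: J_def)
        define c where "c = lead_coeff q * inverse (lead_coeff q0)"
        define c' where "c' = coeff p (degree q) * inverse (coeff p0 (degree q0))"
        have cc: "(c', c) \<in> h" unfolding c_def c'_def using p lc by (intro hom_graph_mult[OF h(1)]) (auto simp: poly_related_def)
        have deg: "degree q0 \<le> degree q" using min less.prems False by blast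
        define r where "r = q - monom c (degree q - degree q0) * q0"
        have "poly_related h (p - monom c' (degree q - degree q0) * p0) r"
          unfolding r_def by (intro poly_related_diff[OF h(1)] poly_related_mult[OF h(1)] poly_related_monom[OF h(1)] p p0 cc)
        then have rJ: "r \<in> J" unfolding J_def using p p0 by (force simp: poly_monom)
        have "coeff r (degree q) = 0"
          unfolding r_def c_def using deg q0 by (simp add: coeff_monom_mult)
        moreover have "degree r \<le> degree q"
          unfolding r_def using deg by (intro degree_diff_le order_trans[OF degree_mult_le]) (auto intro: order_trans[OF add_right_mono[OF degree_monom_le]])
        ultimately have "r = 0 \<or> degree r < degree q"
          by (metis eq_zero_or_degree_less)
        then have "q0 dvd r" using less.hyps rJ by auto
        then show ?thesis unfolding r_def
          by (metis add_diff_cancel_left' diff_add_cancel dvd_add dvd_triv_right)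
      qed simp
    qed
    have "degree q0 = 0"
    proof (rule ccontr)
      assume "degree q0 \<noteq> 0"
      then obtain y where y: "poly q0 y = 0" using alg_closed_imp_poly_has_root by auto
      have "(x, y) \<in> h"
      proof (rule extend)
        fix p q assume "poly_related h p q" "poly p x = 0"
        then have "q0 dvd q" using dvd by (auto simp: J_def)
        then show "poly q y = 0" using y by (auto elim!: dvdE)
      qed
      then show False using x by blast
    qed
    then obtain c where c: "q0 = [:c:]" by (elim degree_eq_zeroE)
    have c0: "c \<noteq> 0" using q0(2) c by auto
    let ?d = "inverse (coeff p0 0)"
    have "poly_related h (1 - smult ?d p0) (1 - smult (inverse c) q0)"
      using lc c by (intro poly_related_diff[OF h(1)] poly_related_1[OF h(1)] poly_related_smult[OF h(1)] p0) auto
    moreover have "1 - smult (inverse c) q0 = 0" using c c0 by (simp add: one_pCons)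
    ultimately show ?thesis using p0 by (intro exI[of _ "1 - smult ?d p0"]) auto
  qed
  have "place h"
    unfolding place_def
  proof (intro conjI allI h(1))
    fix x
    show "(\<exists>a. (x, a) \<in> h) \<or> (inverse x, 0) \<in> h"
    proof (rule ccontr)
      assume neg: "\<not> ?thesis"
      have x0: "x \<noteq> 0" using neg hom_graph_zero[OF h(1)] by auto
      have "\<nexists>y. (inverse x, y) \<in> h"
      proof
        assume "\<exists>y. (inverse x, y) \<in> h"
        then obtain y where y: "(inverse x, y) \<in> h" by blast
        show False
          using inv[OF y] y neg by (cases "y = 0") auto
      qed
      then obtain q where "poly_related h q 0" "poly q (inverse x) = 1" using rel by blast
      moreover obtain p where "poly_related h p 0" "poly p x = 1" using rel neg by blast
      ultimately show False
        using unit_relations_incompatible[OF h(1) inv order_refl _ _ order_refl, of p x q] x0 by blast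
    qed
  qed
  then show thesis using that h(2) by blast
qed

section \<open>Algebraic elements and places\<close>

definition subfield_on :: "'k::field set \<Rightarrow> bool" where
  "subfield_on F \<longleftrightarrow> 1 \<in> F \<and> (\<forall>a\<in>F. \<forall>b\<in>F. a - b \<in> F \<and> a * b \<in> F \<and> inverse a \<in> F)"

definition algebraic_over :: "'k::field set \<Rightarrow> 'k set" where
  "algebraic_over F = {x. \<exists>p. p \<noteq> 0 \<and> (\<forall>i. coeff p i \<in> F) \<and> poly p x = 0}"

text \<open>A quotient whose denominator vanishes at \<open>z\<close> has the default value 0, which
  belongs to the field.\<close>

definition simple_extension :: "'k::field set \<Rightarrow> 'k \<Rightarrow> 'k set" where
  "simple_extension F z = {poly p z / poly q z | p q. (\<forall>i. coeff p i \<in> F) \<and> (\<forall>i. coeff q i \<in> F)}"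

lemma poly_choice:
  fixes A :: "nat \<Rightarrow> 'a::zero \<Rightarrow> bool"
  assumes "\<And>i. \<exists>y. A i y" and "\<And>i. i > n \<Longrightarrow> A i 0"
  obtains q where "\<And>i. A i (coeff q i)"
proof -
  obtain f where f: "\<And>i. A i (f i)" using assms(1) by metis
  define q where "q = Poly (map f [0..<Suc n])"
  have "A i (coeff q i)" for i
    using f[of i] assms(2)[of i] by (cases "i \<le> n") (auto simp: q_def nth_default_def simp del: upt_Suc)
  then show thesis using that by blast
qed

lemma poly_related_exists:
  assumes "hom_graph g" "\<And>i. coeff p i \<in> Domain g"
  obtains q where "poly_related g p q"
  by (rule poly_choice[of "\<lambda>i y. (coeff p i, y) \<in> g" "degree p"])
    (use assms in \<open>auto simp: poly_related_def coeff_eq_0 hom_graph_zero\<close>)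

lemma poly_related_pcompose:
  assumes g: "hom_graph g" and "poly_related g p q" "poly_related g r s"
  shows "poly_related g (pcompose p r) (pcompose q s)"
  using assms(2)
proof (induction p arbitrary: q)
  case 0
  then have "q = 0"
    using hom_graph_zeroD[OF g] by (auto simp: poly_related_def poly_eq_iff)
  then show ?case by (simp add: poly_related_0[OF g])
next
  case (pCons a p)
  obtain b q' where q: "q = pCons b q'" by (cases q)
  have 1: "(a, b) \<in> g" using pCons.prems[unfolded q poly_related_def, rule_format, of 0] by simp
  have 2: "poly_related g p q'"
    unfolding poly_related_def using pCons.prems[unfolded q poly_related_def, rule_format, of "Suc i" for i] by simp
  show ?case
    unfolding q pcompose_pCons
    by (intro poly_related_add[OF g] poly_related_mult[OF g] assms(3) pCons.IH 2 poly_related_pCons[OF g] 1 poly_related_0[OF g])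
qed

text \<open>The leading coefficient of \<open>p\<close> has nonzero residue, so \<open>x\<close> is
  integral over the domain. If \<open>x\<close> were infinitely large, dividing the equation by
  \<open>x ^ degree p\<close> would leave that residue as the only contribution.\<close>

lemma place_integral:
  assumes h: "place h" and pq: "poly_related h p q" "poly p x = 0" "coeff q (degree p) \<noteq> 0"
  obtains y where "(x, y) \<in> h" "poly q y = 0"
proof -
  have hh: "hom_graph h" using h by (rule place_imp_hom_graph)
  have "\<exists>y. (x, y) \<in> h"
  proof (rule ccontr)
    assume neg: "\<not> ?thesis"
    then have ix: "(inverse x, 0) \<in> h" using h unfolding place_def by blast
    have x0: "x \<noteq> 0" using neg hom_graph_zero[OF hh] by auto
    let ?n = "degree p"
    have "((\<Sum>i\<le>?n. coeff p i * inverse x ^ (?n - i)), (\<Sum>i\<le>?n. coeff q i * 0 ^ (?n - i))) \<in> h"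
      using pq(1) ix unfolding poly_related_def
      by (intro hom_graph_sum[OF hh] hom_graph_mult[OF hh] hom_graph_power[OF hh]) auto
    moreover have "(\<Sum>i\<le>?n. coeff p i * inverse x ^ (?n - i)) = inverse x ^ ?n * poly p x"
      unfolding poly_altdef sum_distrib_left using x0 by (intro sum.cong) (auto simp: power_diff field_simps)
    moreover have "(\<Sum>i\<le>?n. coeff q i * 0 ^ (?n - i)) = (\<Sum>i\<in>{?n}. coeff q i * 0 ^ (?n - i))"
      by (rule sum.mono_neutral_right) auto
    ultimately have "(0, coeff q ?n) \<in> h" using pq(2) by simp
    then show False using hom_graph_zeroD[OF hh] pq(3) by blast
  qed
  then obtain y where y: "(x, y) \<in> h" by blast
  have "(0, poly q y) \<in> h" using poly_related_poly[OF hh pq(1) y] pq(2) by simp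
  then show thesis using that y hom_graph_zeroD[OF hh] by blast
qed

context
  fixes F :: "'k::field set"
  assumes F: "subfield_on F"
begin

lemma subfield_ops:
  shows "1 \<in> F" "0 \<in> F" "a \<in> F \<Longrightarrow> b \<in> F \<Longrightarrow> a - b \<in> F" "a \<in> F \<Longrightarrow> b \<in> F \<Longrightarrow> a * b \<in> F"
    "a \<in> F \<Longrightarrow> inverse a \<in> F" "a \<in> F \<Longrightarrow> - a \<in> F" "a \<in> F \<Longrightarrow> b \<in> F \<Longrightarrow> a + b \<in> F"
    "a \<in> F \<Longrightarrow> b \<in> F \<Longrightarrow> a / b \<in> F"
proof -
  have d: "\<And>a b. a \<in> F \<Longrightarrow> b \<in> F \<Longrightarrow> a - b \<in> F" and m: "\<And>a b. a \<in> F \<Longrightarrow> b \<in> F \<Longrightarrow> a * b \<in> F"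
    and i: "\<And>a. a \<in> F \<Longrightarrow> inverse a \<in> F" and o: "1 \<in> F"
    using F unfolding subfield_on_def by auto
  have z: "0 \<in> F" using d[OF o o] by simp
  have u: "\<And>a. a \<in> F \<Longrightarrow> - a \<in> F" using d[OF z] by simp
  show "1 \<in> F" "0 \<in> F" "a \<in> F \<Longrightarrow> b \<in> F \<Longrightarrow> a - b \<in> F" "a \<in> F \<Longrightarrow> b \<in> F \<Longrightarrow> a * b \<in> F"
    "a \<in> F \<Longrightarrow> inverse a \<in> F" "a \<in> F \<Longrightarrow> - a \<in> F"
    by (fact o z d m i u)+
  show "a \<in> F \<Longrightarrow> b \<in> F \<Longrightarrow> a + b \<in> F" using d[OF _ u, of a b] by simp
  show "a \<in> F \<Longrightarrow> b \<in> F \<Longrightarrow> a / b \<in> F" using m[OF _ i, of a b] by (simp add: divide_inverse)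
qed

text \<open>The inclusion of a subfield as a homomorphism: through it, the rules for
  \<open>poly_related\<close> also give closure properties of polynomials with coefficients in
  \<open>F\<close>.\<close>

lemma hom_graph_Id_on: "hom_graph (Id_on F)"
  unfolding hom_graph_def using subfield_ops by auto

lemma poly_related_Id_on: "poly_related (Id_on F) p q \<longleftrightarrow> p = q \<and> (\<forall>i. coeff p i \<in> F)"
  unfolding poly_related_def poly_eq_iff Id_on_iff by metis

lemma subfield_subset_algebraic: "F \<subseteq> algebraic_over F"
proof
  fix x assume "x \<in> F"
  then show "x \<in> algebraic_over F"
    unfolding algebraic_over_def using subfield_ops
    by (intro CollectI exI[of _ "[:-x, 1:]"]) (auto simp: coeff_pCons split: nat.splits)
qed

lemma subfield_poly: "(\<And>i. coeff p i \<in> F) \<Longrightarrow> x \<in> F \<Longrightarrow> poly p x \<in> F"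
  using poly_related_poly[OF hom_graph_Id_on, of p p x x] by (simp add: poly_related_Id_on Id_on_iff)

lemma subfield_simple_extension: "subfield_on (simple_extension F z)"
proof -
  have mult: "\<And>i. coeff (p * q) i \<in> F" and diff: "\<And>i. coeff (p - q) i \<in> F" 
    if "\<And>i. coeff p i \<in> F" "\<And>i. coeff q i \<in> F" for p q
    using poly_related_mult[OF hom_graph_Id_on, of p p q q] poly_related_diff[OF hom_graph_Id_on, of p p q q] that
    by (simp_all add: poly_related_Id_on)
  have one: "coeff 1 i \<in> F" for i using subfield_ops by (simp add: coeff_1)
  show ?thesis
    unfolding subfield_on_def
  proof (intro conjI ballI)
    show "1 \<in> simple_extension F z"
      unfolding simple_extension_def using one by (intro CollectI exI[of _ 1]) auto
  next
    fix a b assume "a \<in> simple_extension F z" "b \<in> simple_extension F z"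
    then obtain p q r s where a: "a = poly p z / poly q z" "\<And>i. coeff p i \<in> F" "\<And>i. coeff q i \<in> F"
      and b: "b = poly r z / poly s z" "\<And>i. coeff r i \<in> F" "\<And>i. coeff s i \<in> F"
      unfolding simple_extension_def by blast
    show "a * b \<in> simple_extension F z"
      unfolding simple_extension_def a(1) b(1) using mult a b
      by (intro CollectI exI[of _ "p * r"] exI[of _ "q * s"]) auto
    show "inverse a \<in> simple_extension F z"
      unfolding simple_extension_def a(1) using a
      by (intro CollectI exI[of _ q] exI[of _ p]) auto
    \<comment> \<open>Fractions with the default value 0 have to be separated, because a common
      denominator would spoil the other fraction.\<close>
    consider "poly q z \<noteq> 0" "poly s z \<noteq> 0" | "poly q z = 0" | "poly s z = 0" by blast
    then show "a - b \<in> simple_extension F z"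
    proof cases
      case 1
      then show ?thesis
        unfolding simple_extension_def a(1) b(1) using mult diff a b
        by (intro CollectI exI[of _ "p * s - r * q"] exI[of _ "q * s"]) (auto simp: field_simps)
    next
      case 2
      have "\<And>i. coeff (0 - r) i \<in> F" using diff[of 0 r] b subfield_ops by (simp add: )
      then show ?thesis
        unfolding simple_extension_def a(1) b(1) using 2 b
        by (intro CollectI exI[of _ "0 - r"] exI[of _ s]) auto
    next
      case 3
      then show ?thesis
        unfolding simple_extension_def a(1) b(1) using a
        by (intro CollectI exI[of _ p] exI[of _ q]) auto
    qed
  qed
qed

lemma subset_simple_extension: "F \<subseteq> simple_extension F z"
proof
  fix x assume "x \<in> F"
  then show "x \<in> simple_extension F z"
    unfolding simple_extension_def using subfield_ops
    by (intro CollectI exI[of _ "[:x:]"] exI[of _ 1]) (auto simp: coeff_pCons split: nat.splits)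
qed

lemma simple_extension_subset:
  assumes "F \<subseteq> K" "subfield_on K" "z \<in> K"
  shows "simple_extension F z \<subseteq> K"
proof -
  have "poly p z \<in> K" if "\<And>i. coeff p i \<in> F" for p
    unfolding poly_altdef
  proof -
    have "poly p z \<in> K"
      using poly_related_poly[of "Id_on K" p p z z] assms that
      by (auto simp: poly_related_def hom_graph_def subfield_on_def Id_on_iff)
    then show "(\<Sum>i\<le>degree p. coeff p i * z ^ i) \<in> K" by (simp add: poly_altdef)
  qed
  then show ?thesis using assms(2) unfolding simple_extension_def subfield_on_def by (auto simp: divide_inverse)
qed

end

lemma algebraic_over_inverse:
  assumes "x \<in> algebraic_over F" "0 \<in> F"
  shows "inverse x \<in> algebraic_over F"
proof (cases "x = 0")
  case False
  obtain p where p: "p \<noteq> 0" "\<And>i. coeff p i \<in> F" "poly p x = 0"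
    using assms by (auto simp: algebraic_over_def)
  have "poly (reflect_poly p) (inverse x) = 0"
    using False p by (subst poly_reflect_poly_nz) auto
  then show ?thesis
    unfolding algebraic_over_def using p assms by (intro CollectI exI[of _ "reflect_poly p"]) (auto simp: coeff_reflect_poly)
qed (use assms in auto)

text \<open>This description makes it evident that the algebraic elements form a subfield.\<close>
lemma algebraic_over_iff_places:
  fixes F :: "'k::alg_closed_field set"
  assumes F: "subfield_on F"
  shows "x \<in> algebraic_over F \<longleftrightarrow> (\<forall>h::('k \<times> 'k) set. place h \<longrightarrow> Id_on F \<subseteq> h \<longrightarrow> x \<in> Domain h)"
proof (intro iffI allI impI)
  fix h :: "('k \<times> 'k) set"
  assume "x \<in> algebraic_over F" and h: "place h" "Id_on F \<subseteq> h"
  then obtain p where p: "p \<noteq> 0" "\<And>i. coeff p i \<in> F" "poly p x = 0" by (auto simp: algebraic_over_def)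
  have "poly_related h p p" unfolding poly_related_def using p h(2) by (auto simp: Id_on_def)
  then show "x \<in> Domain h"
    using place_integral[OF h(1), of p p x] p by auto
next
  assume *: "\<forall>h::('k \<times> 'k) set. place h \<longrightarrow> Id_on F \<subseteq> h \<longrightarrow> x \<in> Domain h"
  show "x \<in> algebraic_over F"
  proof (rule ccontr)
    assume x: "x \<notin> algebraic_over F"
    have x0: "x \<noteq> 0" using x subfield_subset_algebraic[OF F] subfield_ops[OF F] by auto
    have g: "hom_graph (Id_on F)" by (rule hom_graph_Id_on[OF F])
    \<comment> \<open>If \<open>x\<close> is transcendental, so is its inverse, and any value may be
      prescribed for it. The value 0 makes \<open>x\<close> infinitely large at a place that fixes
      \<open>F\<close>.\<close>
    have "poly q 0 = 0" if pq: "poly_related (Id_on F) p q" "poly p (inverse x) = 0" for p q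
    proof -
      have "p = 0"
      proof (rule ccontr)
        assume "p \<noteq> 0"
        then have "inverse x \<in> algebraic_over F" 
          using pq by (auto simp: algebraic_over_def poly_related_Id_on[OF F])
        then show False using algebraic_over_inverse[of "inverse x" F] x subfield_ops[OF F] by simp
      qed
      then show ?thesis using pq by (auto simp: poly_related_Id_on[OF F])
    qed
    then have "hom_graph (adjoin (Id_on F) (inverse x) 0)" by (rule hom_graph_adjoin[OF g])
    then obtain h where h: "place h" "adjoin (Id_on F) (inverse x) 0 \<subseteq> h" by (rule hom_graph_extends_to_place)
    have ix: "(inverse x, 0) \<in> h" using h(2) mem_adjoin[OF g] by blast
    have "Id_on F \<subseteq> h" using h(2) subset_adjoin[OF g] by blast
    then obtain a where a: "(x, a) \<in> h" using * h(1) by blast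
    have hh: "hom_graph h" using h(1) by (rule place_imp_hom_graph)
    have "(1, 0) \<in> h" using hom_graph_mult[OF hh a ix] x0 by simp
    then show False using hom_graph_unique[OF hh _ hom_graph_one[OF hh]] by fastforce
  qed
qed

lemma subfield_algebraic_over:
  fixes F :: "'k::alg_closed_field set"
  assumes F: "subfield_on F"
  shows "subfield_on (algebraic_over F)"
proof -
  have "a - b \<in> algebraic_over F \<and> a * b \<in> algebraic_over F"
    if "a \<in> algebraic_over F" "b \<in> algebraic_over F" for a b
    using that unfolding algebraic_over_iff_places[OF F]
    by (meson Domain.cases DomainI hom_graph_diff hom_graph_mult place_imp_hom_graph)
  moreover have "1 \<in> algebraic_over F" "0 \<in> F"
    using subfield_ops(1,2)[OF F] subfield_subset_algebraic[OF F] by auto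
  ultimately show ?thesis
    unfolding subfield_on_def using algebraic_over_inverse[of _ F] by blast
qed

text \<open>A place fixing \<open>F\<close> is finite on all of \<open>algebraic_over F\<close>.
  Since this set is a field, the leading coefficient of an equation and its inverse are both finite,
  hence its residue is nonzero and integrality applies.\<close>

lemma algebraic_over_closed:
  fixes F :: "'k::alg_closed_field set"
  assumes F: "subfield_on F"
  shows "algebraic_over (algebraic_over F) = algebraic_over F"
proof
  let ?K = "algebraic_over F"
  have K: "subfield_on ?K" by (rule subfield_algebraic_over[OF F])
  show "?K \<subseteq> algebraic_over ?K" by (rule subfield_subset_algebraic[OF K])
  show "algebraic_over ?K \<subseteq> ?K"
  proof
    fix x assume "x \<in> algebraic_over ?K"
    then obtain p where p: "p \<noteq> 0" "\<And>i. coeff p i \<in> ?K" "poly p x = 0" by (auto simp: algebraic_over_def)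
    show "x \<in> ?K"
      unfolding algebraic_over_iff_places[OF F]
    proof (intro allI impI)
      fix h :: "('k \<times> 'k) set" assume h: "place h" "Id_on F \<subseteq> h"
      have hh: "hom_graph h" using h(1) by (rule place_imp_hom_graph)
      have dom: "y \<in> Domain h" if "y \<in> ?K" for y using that h unfolding algebraic_over_iff_places[OF F] by blast
      obtain q where q: "poly_related h p q" using poly_related_exists[OF hh] dom p(2) by blast
      have "coeff q (degree p) \<noteq> 0"
      proof
        assume "coeff q (degree p) = 0"
        then have c: "(lead_coeff p, 0) \<in> h" using q unfolding poly_related_def by metis
        obtain d where d: "(inverse (lead_coeff p), d) \<in> h" using dom subfield_ops(5)[OF K p(2)] by blast
        have "(1, 0) \<in> h" using hom_graph_mult[OF hh c d] p(1) by simp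
        then show False using hom_graph_unique[OF hh _ hom_graph_one[OF hh]] by fastforce
      qed
      then show "x \<in> Domain h" using place_integral[OF h(1) q p(3)] by blast
    qed
  qed
qed

text \<open>\<open>d / c \<in> Domain h\<close> reads as: the absolute value of \<open>d\<close> is
  at most that of \<open>c\<close>. Comparability of any two elements comes from the definition of a
  place.\<close>

lemma place_max_element:
  assumes h: "place h" and "finite C" "C \<noteq> {}" "0 \<notin> C"
  shows "\<exists>c\<in>C. \<forall>d\<in>C. d / c \<in> Domain h"
  using assms(2-)
proof (induction C rule: finite_ne_induct)
  case (singleton x)
  then show ?case using hom_graph_one[OF place_imp_hom_graph[OF h]] by auto
next
  case (insert x C)
  have hh: "hom_graph h" using h by (rule place_imp_hom_graph)
  obtain c where c: "c \<in> C" "\<And>d. d \<in> C \<Longrightarrow> d / c \<in> Domain h" using insert by auto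
  have nz: "x \<noteq> 0" "c \<noteq> 0" using insert c by auto
  have "x / c \<in> Domain h \<or> inverse (x / c) \<in> Domain h" using h unfolding place_def by blast
  then show ?case
  proof
    assume "x / c \<in> Domain h"
    then show ?thesis using c by auto
  next
    assume *: "inverse (x / c) \<in> Domain h"
    have "d / x \<in> Domain h" if d: "d \<in> C" for d
    proof -
      obtain u v where "(d / c, u) \<in> h" "(inverse (x / c), v) \<in> h" using c(2)[OF d] * by blast
      then have "(d / c * inverse (x / c), u * v) \<in> h" by (rule hom_graph_mult[OF hh])
      moreover have "d / c * inverse (x / c) = d / x" using nz by (simp add: field_simps)
      ultimately show ?thesis by auto
    qed
    moreover have "x / x \<in> Domain h" using nz hom_graph_one[OF hh] by auto
    ultimately show ?thesis by auto
  qed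
qed

lemma place_min_element:
  assumes h: "place h" and "finite C" "C \<noteq> {}" "0 \<notin> C"
  shows "\<exists>c\<in>C. \<forall>d\<in>C. c / d \<in> Domain h"
proof -
  have "\<exists>c\<in>inverse ` C. \<forall>d\<in>inverse ` C. d / c \<in> Domain h"
    using assms by (intro place_max_element) auto
  then show ?thesis by (auto simp: field_simps)
qed

text \<open>Division by the coefficient of largest absolute value, as in Gauss's lemma: all
  coefficients become finite and one of them becomes 1.\<close>

lemma primitive_scaling:
  assumes h: "place h" and L: "subfield_on L" and p: "p \<noteq> 0" "\<And>i. coeff p i \<in> L"
  obtains k r where "k \<in> L" "k \<noteq> 0" "poly_related h (smult k p) r" "r \<noteq> 0"
proof -
  have hh: "hom_graph h" using h by (rule place_imp_hom_graph)
  let ?C = "coeff p ` {..degree p} - {0}"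
  have "lead_coeff p \<in> ?C" using p by auto
  then have "\<exists>c\<in>?C. \<forall>d\<in>?C. d / c \<in> Domain h" by (intro place_max_element[OF h]) auto
  then obtain c where c: "c \<in> ?C" "\<And>d. d \<in> ?C \<Longrightarrow> d / c \<in> Domain h" by blast
  have "coeff (smult (inverse c) p) i \<in> Domain h" for i
  proof (cases "coeff p i = 0")
    case True
    then show ?thesis using hom_graph_zero[OF hh] by auto
  next
    case False
    then have "coeff p i \<in> ?C" using le_degree by auto
    then show ?thesis using c(2)[of "coeff p i"] by (simp add: field_simps)
  qed
  then obtain r where r: "poly_related h (smult (inverse c) p) r" using poly_related_exists[OF hh] by blast
  obtain i where i: "coeff p i = c" using c(1) by auto
  have "(1, coeff r i) \<in> h" using r[unfolded poly_related_def, rule_format, of i] i c(1) by simp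
  then have "coeff r i = 1" using hom_graph_unique[OF hh _ hom_graph_one[OF hh]] by blast
  then have "r \<noteq> 0" by auto
  moreover have "inverse c \<in> L" using subfield_ops(5)[OF L] p(2) i by blast
  ultimately show thesis using that[of "inverse c" r] r c(1) by auto
qed

text \<open>A substitute for Hensel's lemma when all roots of \<open>p\<close> are available. If no
  root reduced to \<open>\<rho>\<close>, every \<open>x - a\<close> would have a finite inverse, so
  \<open>p\<close> would be \<open>poly p x\<close> times a polynomial with finite coefficients. As
  \<open>poly p x\<close> has residue 0, \<open>p\<close> would reduce to 0.\<close>

lemma place_lift_root:
  fixes h :: "('k::alg_closed_field \<times> 'r::field) set"
  assumes h: "place h" and pr: "poly_related h p r" "r \<noteq> 0" "poly r \<rho> = 0" "(x, \<rho>) \<in> h"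
  obtains y where "poly p y = 0" "(y, \<rho>) \<in> h"
proof -
  have hh: "hom_graph h" using h by (rule place_imp_hom_graph)
  have p0: "p \<noteq> 0" 
    using pr hom_graph_zeroD[OF hh] by (metis coeff_0 poly_eqI poly_related_def)
  have "\<exists>y. poly p y = 0 \<and> (y, \<rho>) \<in> h"
  proof (rule ccontr)
    assume neg: "\<not> ?thesis"
    obtain A where A: "p = smult (lead_coeff p) (\<Prod>x\<in>#A. [:-x, 1:])"
      using alg_closed_imp_factorization[OF p0] by blast
    have root: "poly p a = 0" if "a \<in># A" for a
      by (subst A) (use that in \<open>auto simp: poly_prod_mset prod_mset_zero_iff\<close>)
    have inv: "x \<noteq> a \<and> (\<exists>s. (inverse (x - a), s) \<in> h)" if "a \<in># A" for a
    proof (cases "\<exists>b. (a, b) \<in> h")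
      case True
      then obtain b where b: "(a, b) \<in> h" by blast
      have "b \<noteq> \<rho>" using neg root[OF that] b by auto
      moreover have "(x - a, \<rho> - b) \<in> h" by (rule hom_graph_diff[OF hh pr(4) b])
      ultimately show ?thesis
        using hom_graph_inverse_if_place[OF hh h] hom_graph_nonzero[OF hh] by fastforce
    next
      case False
      then have ia: "(inverse a, 0) \<in> h" using h unfolding place_def by blast
      have a0: "a \<noteq> 0" using False hom_graph_zero[OF hh] by auto
      have "(x * inverse a - 1, \<rho> * 0 - 1) \<in> h"
        by (intro hom_graph_diff[OF hh] hom_graph_mult[OF hh] pr(4) ia hom_graph_one[OF hh])
      then have *: "(inverse (x * inverse a - 1), inverse (\<rho> * 0 - 1)) \<in> h"
        by (rule hom_graph_inverse_if_place[OF hh h]) auto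
      have xa: "x \<noteq> a" using False pr(4) by auto
      have "inverse a * inverse (x * inverse a - 1) = inverse (x - a)"
        using a0 xa by (simp add: field_simps)
      then show ?thesis using hom_graph_mult[OF hh ia *] xa by auto
    qed
    have W: "\<exists>W W'. poly_related h W W' \<and> (\<Prod>a\<in>#B. [:-a, 1:]) = smult (\<Prod>a\<in>#B. x - a) W" if "B \<subseteq># A" for B
      using that
    proof (induction B)
      case empty
      then show ?case by (auto intro!: exI[of _ 1] poly_related_1[OF hh])
    next
      case (add a B)
      have "B \<subseteq># A" using add.prems by (rule subset_mset.order_trans[rotated]) simp
      then obtain W W' where IH: "poly_related h W W'" "(\<Prod>a\<in>#B. [:-a, 1:]) = smult (\<Prod>a\<in>#B. x - a) W"
        using add.IH by blast
      have "a \<in># A" using add.prems by (rule mset_subset_eqD) simp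
      then obtain s where s: "x \<noteq> a" "(inverse (x - a), s) \<in> h" using inv by blast
      \<comment> \<open>The linear factor at \<open>a\<close> divided by its value at
        \<open>x\<close>, that is, 1 + (X - x) / (x - a).\<close>
      have "poly_related h [:1 - x * inverse (x - a), inverse (x - a):] [:1 - \<rho> * s, s:]"
        by (intro poly_related_pCons[OF hh] poly_related_0[OF hh] hom_graph_diff[OF hh] hom_graph_one[OF hh]
            hom_graph_mult[OF hh] pr(4) s(2))
      then have "poly_related h ([:1 - x * inverse (x - a), inverse (x - a):] * W) ([:1 - \<rho> * s, s:] * W')"
        using IH(1) by (rule poly_related_mult[OF hh])
      moreover have "[:- a, 1:] = smult (x - a) [:1 - x * inverse (x - a), inverse (x - a):]"
        using s(1) by (simp add: field_simps)
      then have "(\<Prod>a\<in>#add_mset a B. [:-a, 1:]) = smult (\<Prod>a\<in>#add_mset a B. x - a) ([:1 - x * inverse (x - a), inverse (x - a):] * W)"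
        using IH(2) by (simp only: image_mset_add_mset prod_mset.add_mset mult_smult_left mult_smult_right smult_smult mult.commute)
      ultimately show ?case by blast
    qed
    obtain W W' where W: "poly_related h W W'" "(\<Prod>a\<in>#A. [:-a, 1:]) = smult (\<Prod>a\<in>#A. x - a) W"
      using W[of A] by auto
    have "poly p x = lead_coeff p * (\<Prod>a\<in>#A. x - a)"
      by (subst A) (simp add: poly_prod_mset image_mset.compositionality comp_def)
    then have eq: "p = smult (poly p x) W" using A W(2) by simp
    have "(poly p x, 0) \<in> h" using poly_related_poly[OF hh pr(1,4)] pr(3) by simp
    then have "poly_related h (smult (poly p x) W) (smult 0 W')" using W(1) by (rule poly_related_smult[OF hh])
    then have "poly_related h p 0" using eq by simp
    then have "r = 0" using pr(1) hom_graph_unique[OF hh] unfolding poly_related_def by (metis poly_eqI)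
    then show False using pr(2) by blast
  qed
  then show thesis using that by blast
qed

text \<open>Each new coefficient of the linear form only has to avoid finitely many quotients, one
  for each tuple that might wrongly reach the value at \<open>\<beta>\<close>.\<close>

lemma separating_functional:
  fixes \<beta> :: "'c \<Rightarrow> complex"
  assumes "finite C" "\<And>c. c \<in> C \<Longrightarrow> finite (S c)"
  shows "\<exists>l. \<forall>\<sigma>. (\<forall>c\<in>C. \<sigma> c \<in> S c) \<longrightarrow> (\<Sum>c\<in>C. l c * \<sigma> c) = (\<Sum>c\<in>C. l c * \<beta> c) \<longrightarrow> (\<forall>c\<in>C. \<sigma> c = \<beta> c)"
  using assms
proof (induction C rule: finite_induct)
  case (insert a C)
  then obtain l where l: "\<And>\<sigma>. (\<forall>c\<in>C. \<sigma> c \<in> S c) \<Longrightarrow> (\<Sum>c\<in>C. l c * \<sigma> c) = (\<Sum>c\<in>C. l c * \<beta> c) \<Longrightarrow> (\<forall>c\<in>C. \<sigma> c = \<beta> c)"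
    by blast
  let ?bad = "(\<lambda>(\<sigma>, s). ((\<Sum>c\<in>C. l c * \<beta> c) - (\<Sum>c\<in>C. l c * \<sigma> c)) / (s - \<beta> a)) ` (PiE C S \<times> S a)"
  have "finite ?bad" using insert by (intro finite_imageI finite_cartesian_product finite_PiE) auto
  then have "\<exists>x. x \<notin> ?bad" by (rule ex_new_if_finite[OF infinite_UNIV_char_0])
  then obtain x where x: "x \<notin> ?bad" by blast
  show ?case
  proof (intro exI[of _ "l(a := x)"] allI impI)
    fix \<sigma> assume \<sigma>: "\<forall>c\<in>insert a C. \<sigma> c \<in> S c"
      and eq: "(\<Sum>c\<in>insert a C. (l(a := x)) c * \<sigma> c) = (\<Sum>c\<in>insert a C. (l(a := x)) c * \<beta> c)"
    have s: "(\<Sum>c\<in>insert a C. (l(a := x)) c * f c) = x * f a + (\<Sum>c\<in>C. l c * f c)" for f :: "'c \<Rightarrow> complex"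
    proof -
      have "(\<Sum>c\<in>C. (l(a := x)) c * f c) = (\<Sum>c\<in>C. l c * f c)"
        using insert by (intro sum.cong) auto
      then show ?thesis using insert by simp
    qed
    have eq: "x * (\<sigma> a - \<beta> a) = (\<Sum>c\<in>C. l c * \<beta> c) - (\<Sum>c\<in>C. l c * \<sigma> c)"
      using eq unfolding s by (simp add: algebra_simps)
    have a: "\<sigma> a = \<beta> a"
    proof (rule ccontr)
      assume neq: "\<sigma> a \<noteq> \<beta> a"
      have "(\<Sum>c\<in>C. l c * \<sigma> c) = (\<Sum>c\<in>C. l c * restrict \<sigma> C c)" by (intro sum.cong) auto
      then have "x = ((\<Sum>c\<in>C. l c * \<beta> c) - (\<Sum>c\<in>C. l c * restrict \<sigma> C c)) / (\<sigma> a - \<beta> a)"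
        using eq neq by (simp add: field_simps)
      moreover have "(restrict \<sigma> C, \<sigma> a) \<in> PiE C S \<times> S a" using \<sigma> by auto
      ultimately have "x \<in> ?bad" by (intro image_eqI[of _ _ "(restrict \<sigma> C, \<sigma> a)"]) simp_all
      then show False using x by blast
    qed
    have "\<forall>c\<in>C. \<sigma> c = \<beta> c" by (rule l) (use \<sigma> eq a in simp_all)
    with a show "\<forall>c\<in>insert a C. \<sigma> c = \<beta> c" by blast
  qed
qed auto

section \<open>Lifting homomorphisms to algebraic extensions\<close>

lemma place_inverse_zero:
  assumes h: "place h" and "x \<noteq> 0" "\<nexists>y. y \<noteq> 0 \<and> (x, y) \<in> h"
  shows "(x, 0) \<in> h \<or> (inverse x, 0) \<in> h"
  using assms unfolding place_def by metis

text \<open>Passing to \<open>b = 1 / (c - \<mu>)\<close> for a generic constant \<open>\<mu>\<close> makes all conjugates of \<open>b\<close> integral.\<close>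
lemma integral_reciprocal:
  fixes \<Phi> :: "('k::alg_closed_field \<times> complex) set" and \<iota> :: "complex \<Rightarrow> 'k"
  assumes \<Phi>: "place \<Phi>" and \<iota>: "\<And>a. (\<iota> a, a) \<in> \<Phi>"
    and L: "subfield_on L" "range \<iota> \<subseteq> L" and c: "c \<in> algebraic_over L" "(c, v) \<in> \<Phi>"
  obtains \<mu> M N where "\<And>i. coeff M i \<in> L" "poly_related \<Phi> M N" "coeff N (degree M) \<noteq> 0"
    "poly M (inverse (c - \<iota> \<mu>)) = 0" "c \<noteq> \<iota> \<mu>" "v \<noteq> \<mu>"
proof -
  have hh: "hom_graph \<Phi>" using \<Phi> by (rule place_imp_hom_graph)
  obtain p where p: "p \<noteq> 0" "\<And>i. coeff p i \<in> L" "poly p c = 0" using c(1) by (auto simp: algebraic_over_def)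
  obtain k r where k: "k \<in> L" "k \<noteq> 0" "poly_related \<Phi> (smult k p) r" "r \<noteq> 0"
    using primitive_scaling[OF \<Phi> L(1) p(1,2)] by blast
  have rv: "poly r v = 0"
    using poly_related_poly[OF hh k(3) c(2)] p(3) hom_graph_zeroD[OF hh] by simp
  have "finite {\<mu>. poly r \<mu> = 0}" using k(4) by (rule poly_roots_finite)
  then have "\<exists>\<mu>. \<mu> \<notin> {\<mu>. poly r \<mu> = 0}" by (rule ex_new_if_finite[OF infinite_UNIV_char_0])
  then obtain \<mu> where \<mu>: "poly r \<mu> \<noteq> 0" by blast
  \<comment> \<open>\<open>P\<close> has the root \<open>c - \<iota> \<mu>\<close>, and its constant
    coefficient has residue \<open>poly r \<mu>\<close>, which is nonzero by the choice of
    \<open>\<mu>\<close>. Reversing \<open>P\<close> makes this the leading coefficient of an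
    equation for the reciprocal.\<close>
  define P where "P = pcompose (smult k p) [:\<iota> \<mu>, 1:]"
  define R where "R = pcompose r [:\<mu>, 1:]"
  have lin: "poly_related \<Phi> [:\<iota> \<mu>, 1:] [:\<mu>, 1:]"
    by (intro poly_related_pCons[OF hh] \<iota> hom_graph_one[OF hh] poly_related_0[OF hh])
  have PR: "poly_related \<Phi> P R"
    unfolding P_def R_def by (rule poly_related_pcompose[OF hh k(3) lin])
  have PL: "coeff P i \<in> L" for i
  proof -
    have "poly_related (Id_on L) (smult k p) (smult k p)"
      using p k subfield_ops[OF L(1)] by (auto simp: poly_related_Id_on[OF L(1)])
    moreover have "poly_related (Id_on L) [:\<iota> \<mu>, 1:] [:\<iota> \<mu>, 1:]"
      using subfield_ops[OF L(1)] L(2) by (auto simp: poly_related_Id_on[OF L(1)] coeff_pCons split: nat.splits)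
    ultimately have "poly_related (Id_on L) P P"
      unfolding P_def by (rule poly_related_pcompose[OF hom_graph_Id_on[OF L(1)]])
    then show ?thesis by (simp add: poly_related_Id_on[OF L(1)])
  qed
  define M where "M = reflect_poly P"
  have "coeff M i \<in> Domain \<Phi>" for i
    unfolding M_def coeff_reflect_poly using PR hom_graph_zero[OF hh] by (auto simp: poly_related_def)
  then obtain N where N: "poly_related \<Phi> M N" using poly_related_exists[OF hh] by blast
  have MinL: "coeff M i \<in> L" for i
    unfolding M_def coeff_reflect_poly using PL subfield_ops[OF L(1)] by auto
  have P0: "coeff R 0 \<noteq> 0" unfolding R_def using \<mu> by (simp flip: poly_0_coeff_0 add: poly_pcompose)
  have "coeff P 0 \<noteq> 0" using PR P0 hom_graph_nonzero[OF hh] unfolding poly_related_def by blast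
  then have deg: "degree M = degree P" unfolding M_def by (rule degree_reflect_poly_eq)
  have "coeff M (degree M) = coeff P 0" unfolding deg by (simp add: M_def coeff_reflect_poly)
  then have "coeff N (degree M) = coeff R 0"
    using N PR hom_graph_unique[OF hh] unfolding poly_related_def by metis
  moreover have "v \<noteq> \<mu>" using rv \<mu> by auto
  moreover have c\<mu>: "c \<noteq> \<iota> \<mu>" using c(2) \<iota> hom_graph_unique[OF hh] \<open>v \<noteq> \<mu>\<close> by metis
  moreover have "poly M (inverse (c - \<iota> \<mu>)) = 0"
    unfolding M_def using c\<mu> p(3) by (subst poly_reflect_poly_nz) (auto simp: P_def poly_pcompose)
  ultimately show thesis using that[of M N \<mu>] MinL N P0 by simp
qed

text \<open>
  A linear combination \<open>x\<close> of the integral generators separates the possible residues, so it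
  suffices to send \<open>x\<close> to a root of its transported minimal polynomial that has the right residue.
\<close>
lemma place_lift_algebraic:
  fixes \<Phi> :: "('k::alg_closed_field \<times> complex) set" and \<iota> :: "complex \<Rightarrow> 'k"
  assumes \<Phi>: "place \<Phi>" and \<iota>: "\<And>a. (\<iota> a, a) \<in> \<Phi>"
    and L: "subfield_on L" "range \<iota> \<subseteq> L"
    and C: "finite C" "C \<subseteq> algebraic_over L" "C \<subseteq> Domain \<Phi>"
  obtains Q where "finite Q" "Q \<subseteq> L" "Q \<subseteq> Domain \<Phi>"
    "\<And>g \<Phi>'. hom_graph g \<Longrightarrow> Domain g \<subseteq> L \<Longrightarrow> place \<Phi>' \<Longrightarrow> (\<And>a. (\<iota> a, \<iota> a) \<in> g) \<Longrightarrow> (\<And>a. (\<iota> a, a) \<in> \<Phi>') \<Longrightarrow>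
       (\<And>x. x \<in> Q \<Longrightarrow> \<exists>x' y. (x, x') \<in> g \<and> (x, y) \<in> \<Phi> \<and> (x', y) \<in> \<Phi>' \<and> (x \<noteq> 0 \<longrightarrow> x' \<noteq> 0)) \<Longrightarrow>
       \<exists>\<Psi>. place \<Psi> \<and> g \<subseteq> \<Psi> \<and> (\<forall>c\<in>C. \<exists>c' y. (c, c') \<in> \<Psi> \<and> (c, y) \<in> \<Phi> \<and> (c', y) \<in> \<Phi>' \<and>
          (\<forall>F. subfield_on F \<longrightarrow> Range g \<subseteq> F \<longrightarrow> c' \<in> algebraic_over F))"
proof -
  have hh: "hom_graph \<Phi>" using \<Phi> by (rule place_imp_hom_graph)
  have "\<forall>c\<in>C. \<exists>v. (c, v) \<in> \<Phi>" using C(3) by blast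
  from bchoice[OF this] obtain v where v: "\<And>c. c \<in> C \<Longrightarrow> (c, v c) \<in> \<Phi>" by blast
  have "\<forall>c\<in>C. \<exists>\<mu> M N. (\<forall>i. coeff M i \<in> L) \<and> poly_related \<Phi> M N \<and> coeff N (degree M) \<noteq> 0 \<and>
    poly M (inverse (c - \<iota> \<mu>)) = 0 \<and> c \<noteq> \<iota> \<mu> \<and> v c \<noteq> \<mu>"
  proof
    fix c assume "c \<in> C"
    then have c: "c \<in> algebraic_over L" "(c, v c) \<in> \<Phi>" using C(2) v by auto
    show "\<exists>\<mu> M N. (\<forall>i. coeff M i \<in> L) \<and> poly_related \<Phi> M N \<and> coeff N (degree M) \<noteq> 0 \<and>
      poly M (inverse (c - \<iota> \<mu>)) = 0 \<and> c \<noteq> \<iota> \<mu> \<and> v c \<noteq> \<mu>"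
      by (rule integral_reciprocal[OF \<Phi> \<iota> L c]) blast
  qed
  from bchoice[OF this] obtain \<mu> where "\<forall>c\<in>C. \<exists>M N. (\<forall>i. coeff M i \<in> L) \<and> poly_related \<Phi> M N \<and> coeff N (degree M) \<noteq> 0 \<and>
    poly M (inverse (c - \<iota> (\<mu> c))) = 0 \<and> c \<noteq> \<iota> (\<mu> c) \<and> v c \<noteq> \<mu> c" ..
  from bchoice[OF this] obtain M where "\<forall>c\<in>C. \<exists>N. (\<forall>i. coeff (M c) i \<in> L) \<and> poly_related \<Phi> (M c) N \<and> coeff N (degree (M c)) \<noteq> 0 \<and>
    poly (M c) (inverse (c - \<iota> (\<mu> c))) = 0 \<and> c \<noteq> \<iota> (\<mu> c) \<and> v c \<noteq> \<mu> c" ..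
  from bchoice[OF this] obtain N where M: "\<And>c i. c \<in> C \<Longrightarrow> coeff (M c) i \<in> L" "\<And>c. c \<in> C \<Longrightarrow> poly_related \<Phi> (M c) (N c)"
    "\<And>c. c \<in> C \<Longrightarrow> coeff (N c) (degree (M c)) \<noteq> 0" "\<And>c. c \<in> C \<Longrightarrow> poly (M c) (inverse (c - \<iota> (\<mu> c))) = 0"
    "\<And>c. c \<in> C \<Longrightarrow> c \<noteq> \<iota> (\<mu> c)" "\<And>c. c \<in> C \<Longrightarrow> v c \<noteq> \<mu> c"
    by blast
  \<comment> \<open>The integral elements \<open>b c\<close> replace the generators; at the end
    \<open>c\<close> is recovered as \<open>\<iota> (\<mu> c) + inverse (b c)\<close>.\<close>
  define b where "b c = inverse (c - \<iota> (\<mu> c))" for c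
  define \<beta> where "\<beta> c = inverse (v c - \<mu> c)" for c
  have b\<beta>: "(b c, \<beta> c) \<in> \<Phi>" if "c \<in> C" for c
    unfolding b_def \<beta>_def using that M(6)
    by (intro hom_graph_inverse_if_place[OF hh \<Phi>] hom_graph_diff[OF hh] v \<iota>) auto
  have fin: "finite {\<sigma>. poly (N c) \<sigma> = 0}" if "c \<in> C" for c
    using M(3)[OF that] by (intro poly_roots_finite) auto
  \<comment> \<open>Any image of \<open>b c\<close> will have a root of \<open>N c\<close> as its
    residue, so only finitely many tuples of residues can occur.\<close>
  obtain l where l: "\<And>\<sigma>. \<forall>c\<in>C. poly (N c) (\<sigma> c) = 0 \<Longrightarrow>
      (\<Sum>c\<in>C. l c * \<sigma> c) = (\<Sum>c\<in>C. l c * \<beta> c) \<Longrightarrow> (\<forall>c\<in>C. \<sigma> c = \<beta> c)"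
    using separating_functional[OF C(1), of "\<lambda>c. {\<sigma>. poly (N c) \<sigma> = 0}" \<beta>] fin by auto
  define x where "x = (\<Sum>c\<in>C. \<iota> (l c) * b c)"
  define \<eta> where "\<eta> = (\<Sum>c\<in>C. l c * \<beta> c)"
  have x\<eta>: "(x, \<eta>) \<in> \<Phi>" unfolding x_def \<eta>_def by (intro hom_graph_sum[OF hh] hom_graph_mult[OF hh] \<iota> b\<beta>)
  have K: "subfield_on (algebraic_over L)" by (rule subfield_algebraic_over[OF L(1)])
  have LK: "L \<subseteq> algebraic_over L" by (rule subfield_subset_algebraic[OF L(1)])
  have "b c \<in> algebraic_over L" if "c \<in> C" for c
    unfolding b_def using that C(2) L(2) LK by (intro subfield_ops(3,5)[OF K]) auto
  then have bl: "\<iota> (l c) * b c \<in> algebraic_over L" if "c \<in> C" for c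
    using that L(2) LK by (intro subfield_ops(4)[OF K]) auto
  have "x \<in> algebraic_over L"
    unfolding x_def using C(1) bl subfield_ops(2,7)[OF K]
    by (induction C rule: infinite_finite_induct) auto
  then obtain p where "p \<noteq> 0 \<and> (\<forall>i. coeff p i \<in> L) \<and> poly p x = 0" unfolding algebraic_over_def by blast
  from ex_has_least_nat[of "\<lambda>p. p \<noteq> 0 \<and> (\<forall>i. coeff p i \<in> L) \<and> poly p x = 0", OF this, of degree]
  obtain G0 where G0: "G0 \<noteq> 0" "\<And>i. coeff G0 i \<in> L" "poly G0 x = 0"
    and G0min: "\<And>p. p \<noteq> 0 \<Longrightarrow> (\<And>i. coeff p i \<in> L) \<Longrightarrow> poly p x = 0 \<Longrightarrow> degree G0 \<le> degree p"
    by blast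
  obtain k R where k: "k \<in> L" "k \<noteq> 0" "poly_related \<Phi> (smult k G0) R" "R \<noteq> 0"
    using primitive_scaling[OF \<Phi> L(1) G0(1,2)] by blast
  define G where "G = smult k G0"
  have G: "G \<noteq> 0" "\<And>i. coeff G i \<in> L" "poly G x = 0" "poly_related \<Phi> G R"
    and Gmin: "\<And>p. p \<noteq> 0 \<Longrightarrow> (\<And>i. coeff p i \<in> L) \<Longrightarrow> poly p x = 0 \<Longrightarrow> degree G \<le> degree p"
    unfolding G_def using G0 k subfield_ops(4)[OF L(1)] G0min by auto
  have R\<eta>: "poly R \<eta> = 0"
    using poly_related_poly[OF hh G(4) x\<eta>] G(3) hom_graph_zeroD[OF hh] by simp
  \<comment> \<open>Only the coefficients of \<open>G\<close> and of the equations of the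
    \<open>b c\<close> have to be transported, so finitely many conditions on \<open>g\<close>
    suffice.\<close>
  define Q where "Q = coeff G ` {..degree G} \<union> (\<Union>c\<in>C. coeff (M c) ` {..degree (M c)})"
  show thesis
  proof (rule that[of Q])
    show "finite Q" unfolding Q_def using C(1) by auto
    show "Q \<subseteq> L" unfolding Q_def using G M by auto
    show "Q \<subseteq> Domain \<Phi>" unfolding Q_def using G M unfolding poly_related_def by blast
  next
    fix g :: "('k \<times> 'k) set" and \<Phi>' :: "('k \<times> complex) set"
    assume g: "hom_graph g" and gL: "Domain g \<subseteq> L" and \<Phi>': "place \<Phi>'" and \<iota>g: "\<And>a. (\<iota> a, \<iota> a) \<in> g"
      and \<iota>': "\<And>a. (\<iota> a, a) \<in> \<Phi>'"
      and Q: "\<And>x. x \<in> Q \<Longrightarrow> \<exists>x' y. (x, x') \<in> g \<and> (x, y) \<in> \<Phi> \<and> (x', y) \<in> \<Phi>' \<and> (x \<noteq> 0 \<longrightarrow> x' \<noteq> 0)"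
    have hh': "hom_graph \<Phi>'" using \<Phi>' by (rule place_imp_hom_graph)
    have transport: "\<exists>P'. poly_related g P P' \<and> poly_related \<Phi>' P' S \<and> (\<forall>i. coeff P i \<noteq> 0 \<longrightarrow> coeff P' i \<noteq> 0)"
      if PQ: "coeff P ` {..degree P} \<subseteq> Q" and PS: "poly_related \<Phi> P S" for P S
    proof -
      obtain P' where "\<And>i. (coeff P i, coeff P' i) \<in> g \<and> (coeff P' i, coeff S i) \<in> \<Phi>' \<and> (coeff P i \<noteq> 0 \<longrightarrow> coeff P' i \<noteq> 0)"
      proof (rule poly_choice[of "\<lambda>i y. (coeff P i, y) \<in> g \<and> (y, coeff S i) \<in> \<Phi>' \<and> (coeff P i \<noteq> 0 \<longrightarrow> y \<noteq> 0)" "degree P"])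
        have big: "coeff S i = 0" if "i > degree P" for i
          using that PS hom_graph_zeroD[OF hh] unfolding poly_related_def by (metis coeff_eq_0)
        then show "i > degree P \<Longrightarrow> (coeff P i, 0) \<in> g \<and> (0, coeff S i) \<in> \<Phi>' \<and> (coeff P i \<noteq> 0 \<longrightarrow> 0 \<noteq> (0::'k))" for i
          using hom_graph_zero[OF g] hom_graph_zero[OF hh'] by (simp add: coeff_eq_0)
        show "\<exists>y. (coeff P i, y) \<in> g \<and> (y, coeff S i) \<in> \<Phi>' \<and> (coeff P i \<noteq> 0 \<longrightarrow> y \<noteq> 0)" for i
        proof (cases "i \<le> degree P")
          case True
          then have "coeff P i \<in> Q" using PQ by auto
          then obtain y y' where "(coeff P i, y) \<in> g" "(coeff P i, y') \<in> \<Phi>" "(y, y') \<in> \<Phi>'" "coeff P i \<noteq> 0 \<longrightarrow> y \<noteq> 0"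
            using Q by blast
          moreover have "y' = coeff S i" using hom_graph_unique[OF hh] PS calculation unfolding poly_related_def by blast
          ultimately show ?thesis by blast
        next
          case False
          then show ?thesis using big[of i] hom_graph_zero[OF g] hom_graph_zero[OF hh'] by (auto simp: coeff_eq_0 intro!: exI[of _ 0])
        qed
      qed blast
      then show ?thesis unfolding poly_related_def by blast
    qed
    obtain G' where G': "poly_related g G G'" "poly_related \<Phi>' G' R" "\<And>i. coeff G i \<noteq> 0 \<Longrightarrow> coeff G' i \<noteq> 0"
      using transport[OF _ G(4)] unfolding Q_def by auto
    obtain \<tau> where \<tau>: "poly G' \<tau> = 0" "(\<tau>, \<eta>) \<in> \<Phi>'"
      by (rule place_lift_root[OF \<Phi>' G'(2) k(4) R\<eta> \<iota>'])
    \<comment> \<open>By minimality of the degree of \<open>G\<close>, every relation of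
      \<open>x\<close> is exhausted by pseudo-division by \<open>G\<close>. One multiplies by the
      leading coefficient because the domain of \<open>g\<close> is only a ring; its transported
      value is nonzero and can be cancelled.\<close>
    have "poly q \<tau> = 0" if "poly_related g p q" "poly p x = 0" for p q
      using that
    proof (induction "degree p" arbitrary: p q rule: less_induct)
      case less
      show ?case
      proof (cases "p = 0")
        case True
        then have "q = 0"
          using less.prems(1) hom_graph_zeroD[OF g] by (auto simp: poly_related_def poly_eq_iff)
        then show ?thesis by simp
      next
        case False
        have "coeff p i \<in> L" for i using less.prems(1) gL by (auto simp: poly_related_def)
        then have le: "degree G \<le> degree p" using Gmin False less.prems by blast
        let ?d = "degree p - degree G"
        define p1 where "p1 = smult (lead_coeff G) p - monom (lead_coeff p) ?d * G"
        define q1 where "q1 = smult (coeff G' (degree G)) q - monom (coeff q (degree p)) ?d * G'"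
        have rel: "poly_related g p1 q1"
          unfolding p1_def q1_def using less.prems(1) G'(1)
          by (intro poly_related_diff[OF g] poly_related_smult[OF g] poly_related_mult[OF g] poly_related_monom[OF g])
            (auto simp: poly_related_def)
        have root: "poly p1 x = 0" unfolding p1_def using less.prems G by simp
        have "coeff p1 (degree p) = 0" unfolding p1_def using le by (simp add: coeff_monom_mult)
        moreover have "degree p1 \<le> degree p"
          unfolding p1_def using le
          by (intro degree_diff_le order_trans[OF degree_mult_le] degree_smult_le) (auto intro: order_trans[OF add_right_mono[OF degree_monom_le]])
        ultimately have "p1 = 0 \<or> degree p1 < degree p" by (metis eq_zero_or_degree_less)
        then have "poly q1 \<tau> = 0"
        proof
          assume "p1 = 0"
          then have "q1 = 0" using rel hom_graph_zeroD[OF g] by (auto simp: poly_related_def poly_eq_iff)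
          then show ?thesis by simp
        qed (use less.hyps rel root in blast)
        then have "coeff G' (degree G) * poly q \<tau> = 0" unfolding q1_def using \<tau>(1) by simp
        then show ?thesis using G'(3)[of "degree G"] G(1) by auto
      qed
    qed
    then have "hom_graph (adjoin g x \<tau>)" by (rule hom_graph_adjoin[OF g])
    then obtain \<Psi> where \<Psi>: "place \<Psi>" "adjoin g x \<tau> \<subseteq> \<Psi>" by (rule hom_graph_extends_to_place)
    have hp: "hom_graph \<Psi>" using \<Psi>(1) by (rule place_imp_hom_graph)
    have g\<Psi>: "g \<subseteq> \<Psi>" and x\<tau>: "(x, \<tau>) \<in> \<Psi>" using \<Psi>(2) subset_adjoin[OF g] mem_adjoin[OF g] by blast+
    \<comment> \<open>The equation of \<open>b c\<close> serves twice: it makes \<open>b c\<close>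
      finite at \<open>\<Psi>\<close>, and its transported form, whose leading coefficient has
      nonzero residue, makes the image \<open>b'\<close> finite at \<open>\<Phi>'\<close>.\<close>
    have "\<forall>c\<in>C. \<exists>b' \<sigma>. (b c, b') \<in> \<Psi> \<and> (b', \<sigma>) \<in> \<Phi>' \<and> poly (N c) \<sigma> = 0 \<and>
      (\<forall>F. subfield_on F \<longrightarrow> Range g \<subseteq> F \<longrightarrow> b' \<in> algebraic_over F)"
    proof
      fix c assume c: "c \<in> C"
      have "coeff (M c) ` {..degree (M c)} \<subseteq> Q" unfolding Q_def using c by auto
      then obtain M' where M': "poly_related g (M c) M'" "poly_related \<Phi>' M' (N c)" "\<And>i. coeff (M c) i \<noteq> 0 \<Longrightarrow> coeff M' i \<noteq> 0"
        using transport[OF _ M(2)[OF c]] by blast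
      have Mc: "lead_coeff (M c) \<noteq> 0"
        using M(2,3)[OF c] hom_graph_nonzero[OF hh] unfolding poly_related_def by blast
      have lc: "coeff M' (degree (M c)) \<noteq> 0" by (rule M'(3)[OF Mc])
      have "poly_related \<Psi> (M c) M'" using M'(1) g\<Psi> unfolding poly_related_def by blast
      then obtain b' where b': "(b c, b') \<in> \<Psi>" "poly M' b' = 0"
        using place_integral[OF \<Psi>(1) _ _ lc, of "b c"] M(4)[OF c] unfolding b_def by blast
      have "degree M' = degree (M c)"
        using lc poly_related_degree_le[OF g M'(1)] by (simp add: le_antisym le_degree)
      then obtain \<sigma> where \<sigma>: "(b', \<sigma>) \<in> \<Phi>'" "poly (N c) \<sigma> = 0"
        using place_integral[OF \<Phi>' M'(2) b'(2)] M(3)[OF c] by metis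
      have "b' \<in> algebraic_over F" if "Range g \<subseteq> F" for F
      proof -
        have "coeff M' i \<in> F" for i using M'(1) that unfolding poly_related_def by blast
        moreover have "M' \<noteq> 0" using lc by auto
        ultimately show ?thesis unfolding algebraic_over_def using b' by blast
      qed
      then show "\<exists>b' \<sigma>. (b c, b') \<in> \<Psi> \<and> (b', \<sigma>) \<in> \<Phi>' \<and> poly (N c) \<sigma> = 0 \<and>
          (\<forall>F. subfield_on F \<longrightarrow> Range g \<subseteq> F \<longrightarrow> b' \<in> algebraic_over F)"
        using b' \<sigma> by blast
    qed
    then obtain b' \<sigma> where b': "\<And>c. c \<in> C \<Longrightarrow> (b c, b' c) \<in> \<Psi>" "\<And>c. c \<in> C \<Longrightarrow> (b' c, \<sigma> c) \<in> \<Phi>'"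
      "\<And>c. c \<in> C \<Longrightarrow> poly (N c) (\<sigma> c) = 0" "\<And>c F. c \<in> C \<Longrightarrow> subfield_on F \<Longrightarrow> Range g \<subseteq> F \<Longrightarrow> b' c \<in> algebraic_over F"
      by metis
    have "(x, \<Sum>c\<in>C. \<iota> (l c) * b' c) \<in> \<Psi>"
      unfolding x_def using \<iota>g g\<Psi> by (intro hom_graph_sum[OF hp] hom_graph_mult[OF hp] b'(1)) auto
    \<comment> \<open>Two residues of \<open>\<tau>\<close> are compared, the prescribed
      \<open>\<eta>\<close> and the one computed from the \<open>\<sigma> c\<close>. The separating
      linear form turns their equality into \<open>\<sigma> c = \<beta> c\<close> for each
      \<open>c\<close>.\<close>
    then have "\<tau> = (\<Sum>c\<in>C. \<iota> (l c) * b' c)" using hom_graph_unique[OF hp] x\<tau> by blast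
    moreover have "((\<Sum>c\<in>C. \<iota> (l c) * b' c), (\<Sum>c\<in>C. l c * \<sigma> c)) \<in> \<Phi>'"
      by (intro hom_graph_sum[OF hh'] hom_graph_mult[OF hh'] b'(2) \<iota>')
    ultimately have "(\<Sum>c\<in>C. l c * \<sigma> c) = \<eta>" using hom_graph_unique[OF hh'] \<tau>(2) by blast
    then have \<sigma>\<beta>: "\<sigma> c = \<beta> c" if "c \<in> C" for c using l[of \<sigma>] b'(3) that unfolding \<eta>_def by blast
    have "\<exists>c' y. (c, c') \<in> \<Psi> \<and> (c, y) \<in> \<Phi> \<and> (c', y) \<in> \<Phi>' \<and>
          (\<forall>F. subfield_on F \<longrightarrow> Range g \<subseteq> F \<longrightarrow> c' \<in> algebraic_over F)" if c: "c \<in> C" for c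
    proof -
      have \<beta>0: "\<beta> c \<noteq> 0" unfolding \<beta>_def using M(6)[OF c] by simp
      have b0: "b' c \<noteq> 0" using b'(2)[OF c] \<sigma>\<beta>[OF c] \<beta>0 hom_graph_nonzero[OF hh'] by metis
      define c' where "c' = \<iota> (\<mu> c) + inverse (b' c)"
      have "(\<iota> (\<mu> c) + inverse (b c), c') \<in> \<Psi>"
        unfolding c'_def using \<iota>g g\<Psi> b0 b'(1)[OF c]
        by (intro hom_graph_add[OF hp] hom_graph_inverse_if_place[OF hp \<Psi>(1)]) auto
      moreover have "\<iota> (\<mu> c) + inverse (b c) = c" unfolding b_def by simp
      moreover have "(c', \<mu> c + inverse (\<beta> c)) \<in> \<Phi>'"
        unfolding c'_def using \<iota>' b'(2)[OF c] \<sigma>\<beta>[OF c] \<beta>0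
        by (intro hom_graph_add[OF hh'] hom_graph_inverse_if_place[OF hh' \<Phi>']) auto
      moreover have "\<mu> c + inverse (\<beta> c) = v c" unfolding \<beta>_def by simp
      moreover have "c' \<in> algebraic_over F" if F: "subfield_on F" "Range g \<subseteq> F" for F
      proof -
        have "\<iota> (\<mu> c) \<in> algebraic_over F" using F \<iota>g subfield_subset_algebraic[OF F(1)] by blast
        then show ?thesis
          unfolding c'_def using b'(4)[OF c F] by (intro subfield_ops(5,7)[OF subfield_algebraic_over[OF F(1)]])
      qed
      ultimately show ?thesis using v[OF c] by auto
    qed
    then show "\<exists>\<Psi>. place \<Psi> \<and> g \<subseteq> \<Psi> \<and> (\<forall>c\<in>C. \<exists>c' y. (c, c') \<in> \<Psi> \<and> (c, y) \<in> \<Phi> \<and> (c', y) \<in> \<Phi>' \<and>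
          (\<forall>F. subfield_on F \<longrightarrow> Range g \<subseteq> F \<longrightarrow> c' \<in> algebraic_over F))"
      using \<Psi>(1) g\<Psi> by blast
  qed
qed

section \<open>Specializing a transcendental element\<close>

text \<open>Specialization of \<open>z\<close> to \<open>c\<close> on the local ring at
  \<open>c\<close> of the rational functions in \<open>z\<close>. For \<open>z\<close>
  transcendental over \<open>F\<close>, a denominator that is nonzero at \<open>c\<close> is nonzero
  at \<open>z\<close> as well.\<close>

definition evaluation_graph :: "'k::field set \<Rightarrow> 'k \<Rightarrow> 'k \<Rightarrow> ('k \<times> 'k) set" where
  "evaluation_graph F z c = {(poly p z / poly q z, poly p c / poly q c) | p q.
     (\<forall>i. coeff p i \<in> F) \<and> (\<forall>i. coeff q i \<in> F) \<and> poly q c \<noteq> 0}"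

lemma hom_graph_evaluation:
  assumes F: "subfield_on F" and z: "z \<notin> algebraic_over F"
  shows "hom_graph (evaluation_graph F z c)"
proof -
  have mult: "\<And>i. coeff (p * q) i \<in> F" and diff: "\<And>i. coeff (p - q) i \<in> F" 
    if "\<And>i. coeff p i \<in> F" "\<And>i. coeff q i \<in> F" for p q
    using poly_related_mult[OF hom_graph_Id_on[OF F], of p p q q] poly_related_diff[OF hom_graph_Id_on[OF F], of p p q q] that
    by (simp_all add: poly_related_Id_on[OF F])
  have nz: "poly q z \<noteq> 0" if "q \<noteq> 0" "\<And>i. coeff q i \<in> F" for q
    using z that unfolding algebraic_over_def by blast
  have one: "coeff 1 i \<in> F" for i using subfield_ops[OF F] by (simp add: coeff_1)
  show ?thesis
    unfolding hom_graph_def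
  proof (intro conjI allI impI)
    show "(1, 1) \<in> evaluation_graph F z c"
      unfolding evaluation_graph_def using one by (intro CollectI exI[of _ 1]) auto
  next
    fix x y x' y' assume "(x, y) \<in> evaluation_graph F z c" "(x', y') \<in> evaluation_graph F z c"
    then obtain p q r s where a: "x = poly p z / poly q z" "y = poly p c / poly q c"
        "\<And>i. coeff p i \<in> F" "\<And>i. coeff q i \<in> F" "poly q c \<noteq> 0"
      and b: "x' = poly r z / poly s z" "y' = poly r c / poly s c"
        "\<And>i. coeff r i \<in> F" "\<And>i. coeff s i \<in> F" "poly s c \<noteq> 0"
      unfolding evaluation_graph_def by blast
    have "q \<noteq> 0" "s \<noteq> 0" using a(5) b(5) by auto
    then have "poly q z \<noteq> 0" "poly s z \<noteq> 0" using nz a(4) b(4) by blast+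
    then have "x - x' = poly (p * s - r * q) z / poly (q * s) z"
        "y - y' = poly (p * s - r * q) c / poly (q * s) c"
      using a(1,2,5) b(1,2,5) by (simp_all add: diff_frac_eq)
    moreover have "coeff (p * s - r * q) i \<in> F" for i by (intro diff mult a(3,4) b(3,4))
    moreover have "coeff (q * s) i \<in> F" for i by (intro mult a(4) b(4))
    moreover have "poly (q * s) c \<noteq> 0" using a(5) b(5) by simp
    ultimately show "(x - x', y - y') \<in> evaluation_graph F z c"
      unfolding evaluation_graph_def by blast
    show "(x * x', y * y') \<in> evaluation_graph F z c"
      unfolding evaluation_graph_def using mult a b
      by (intro CollectI exI[of _ "p * r"] exI[of _ "q * s"]) auto
  next
    fix y assume "(0, y) \<in> evaluation_graph F z c"
    then obtain p q where a: "0 = poly p z / poly q z" "y = poly p c / poly q c"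
        "\<And>i. coeff p i \<in> F" "\<And>i. coeff q i \<in> F" "poly q c \<noteq> 0"
      unfolding evaluation_graph_def by blast
    have "q \<noteq> 0" using a(5) by auto
    then have "poly q z \<noteq> 0" using nz a(4) by blast
    then have "poly p z = 0" using a by simp
    then have "p = 0" using nz[of p] a by blast
    then show "y = 0" using a by simp
  qed
qed

lemma Id_on_subset_evaluation:
  assumes F: "subfield_on F"
  shows "Id_on F \<subseteq> evaluation_graph F z c"
proof
  fix y assume "y \<in> Id_on F"
  then obtain x where y: "y = (x, x)" "x \<in> F" by (auto simp: Id_on_def)
  then show "y \<in> evaluation_graph F z c"
    unfolding evaluation_graph_def using subfield_ops[OF F]
    by (intro CollectI exI[of _ "[:x:]"] exI[of _ 1]) (auto simp: coeff_pCons split: nat.splits)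
qed

lemma Domain_evaluation: "Domain (evaluation_graph F z c) \<subseteq> simple_extension F z"
  unfolding evaluation_graph_def simple_extension_def by blast

lemma Range_evaluation:
  assumes F: "subfield_on F" and c: "c \<in> F"
  shows "Range (evaluation_graph F z c) \<subseteq> F"
  unfolding evaluation_graph_def using subfield_poly[OF F _ c] subfield_ops(8)[OF F] by blast

section \<open>Asymptotic equality with respect to a place\<close>

context
  fixes \<Phi> :: "('k::alg_closed_field \<times> complex) set"
  assumes \<Phi>: "place \<Phi>"
begin

lemma \<Phi>h: "hom_graph \<Phi>" by (rule place_imp_hom_graph[OF \<Phi>])

text \<open>Below, \<open>(x / y, 1) \<in> \<Phi>\<close> expresses that x and y are asymptotically
  equal; the elements of residue 1 form a group.\<close>

lemma unit_mult: "(x, 1) \<in> \<Phi> \<Longrightarrow> (y, 1) \<in> \<Phi> \<Longrightarrow> (x * y, 1) \<in> \<Phi>"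
  using hom_graph_mult[OF \<Phi>h, of x 1 y 1] by simp

lemma unit_inverse: "(x, 1) \<in> \<Phi> \<Longrightarrow> (inverse x, 1) \<in> \<Phi>"
  using hom_graph_inverse_if_place[OF \<Phi>h \<Phi>, of x 1] by simp

lemma unit_divide: "(x, 1) \<in> \<Phi> \<Longrightarrow> (y, 1) \<in> \<Phi> \<Longrightarrow> (x / y, 1) \<in> \<Phi>"
  unfolding divide_inverse by (intro unit_mult unit_inverse)

lemma unit_nonzero: "(x, 1) \<in> \<Phi> \<Longrightarrow> x \<noteq> 0"
  using hom_graph_nonzero[OF \<Phi>h] by fastforce

lemma unit_add: "(x, 0) \<in> \<Phi> \<Longrightarrow> (1 + x, 1) \<in> \<Phi>"
  using hom_graph_add[OF \<Phi>h hom_graph_one[OF \<Phi>h], of x 0] by simp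

lemma zero_mult: "(x, 0) \<in> \<Phi> \<Longrightarrow> y \<in> Domain \<Phi> \<Longrightarrow> (x * y, 0) \<in> \<Phi>"
  using hom_graph_mult[OF \<Phi>h, of x 0 y] by auto

lemma zero_root: 
  assumes "(x ^ n, 0) \<in> \<Phi>" "n > 0"
  shows "(x, 0) \<in> \<Phi>"
proof (cases "\<exists>y. (x, y) \<in> \<Phi>")
  case True
  then obtain y where y: "(x, y) \<in> \<Phi>" by blast
  have "y ^ n = 0" using hom_graph_unique[OF \<Phi>h hom_graph_power[OF \<Phi>h y] assms(1)] .
  then show ?thesis using y by auto
next
  case False
  then have ix: "(inverse x, 0) \<in> \<Phi>" using \<Phi> unfolding place_def by blast
  have "x \<noteq> 0" using False hom_graph_zero[OF \<Phi>h] by auto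
  then have "(1, 0 * 0 ^ n) \<in> \<Phi>"
    using hom_graph_mult[OF \<Phi>h assms(1) hom_graph_power[OF \<Phi>h ix, of n]] by (simp add: power_inverse)
  then have "(1, 0) \<in> \<Phi>" by simp
  then show ?thesis using hom_graph_unique[OF \<Phi>h _ hom_graph_one[OF \<Phi>h], of 0] by simp
qed

text \<open>
  In terms of valuations: \<open>\<beta>\<close> lies on the same side of the values of \<open>E\<close> as \<open>\<zeta>\<close>.
\<close>
lemma interpolate_value:
  assumes F: "subfield_on F" "algebraic_over F \<subseteq> F" and t: "t \<in> F" "t \<noteq> 0" "(t, 0) \<in> \<Phi>"
    and E: "finite E" "E \<subseteq> F" "0 \<notin> E" and \<zeta>: "\<zeta> \<noteq> 0"
  obtains \<beta> where "\<beta> \<in> F" "\<beta> \<noteq> 0" "\<And>e. e \<in> E \<Longrightarrow> (\<zeta> / e, 0) \<in> \<Phi> \<Longrightarrow> (\<beta> / e, 0) \<in> \<Phi>"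
    "\<And>e. e \<in> E \<Longrightarrow> (e / \<zeta>, 0) \<in> \<Phi> \<Longrightarrow> (e / \<beta>, 0) \<in> \<Phi>"
proof -
  define A where "A = {e \<in> E. (\<zeta> / e, 0) \<in> \<Phi>}"
  define B where "B = {e \<in> E. (e / \<zeta>, 0) \<in> \<Phi>}"
  have A: "\<exists>a\<in>A. \<forall>e\<in>A. a / e \<in> Domain \<Phi>" if "A \<noteq> {}"
    by (rule place_min_element[OF \<Phi> _ that]) (use E in \<open>auto simp: A_def\<close>)
  have B: "\<exists>b\<in>B. \<forall>e\<in>B. e / b \<in> Domain \<Phi>" if "B \<noteq> {}"
    by (rule place_max_element[OF \<Phi> _ that]) (use E in \<open>auto simp: B_def\<close>)
  have low: "(\<beta> / e, 0) \<in> \<Phi>" if "(\<beta> / a, 0) \<in> \<Phi>" "a \<noteq> 0" "a / e \<in> Domain \<Phi>" for \<beta> a e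
    using zero_mult[OF that(1,3)] that(2) by simp
  have high: "(e / \<beta>, 0) \<in> \<Phi>" if "(b / \<beta>, 0) \<in> \<Phi>" "b \<noteq> 0" "e / b \<in> Domain \<Phi>" for \<beta> b e
    using zero_mult[OF that(1,3)] that(2) by simp
  have "\<exists>\<beta>\<in>F. \<beta> \<noteq> 0 \<and> (\<forall>e\<in>A. (\<beta> / e, 0) \<in> \<Phi>) \<and> (\<forall>e\<in>B. (e / \<beta>, 0) \<in> \<Phi>)"
  \<comment> \<open>\<open>A\<close> holds the elements of larger and \<open>B\<close> those of
    smaller absolute value than \<open>\<zeta>\<close>. If only one side is occupied, multiplying or
    dividing its extreme element by the infinitesimal \<open>t\<close> moves past it.\<close>
  proof (cases "A = {}"; cases "B = {}")
    assume "A = {}" "B = {}"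
    then show ?thesis using t by auto
  next
    assume "A \<noteq> {}" "B = {}"
    then obtain a where a: "a \<in> A" "\<And>e. e \<in> A \<Longrightarrow> a / e \<in> Domain \<Phi>" using A by blast
    have a': "a \<in> F" "a \<noteq> 0" using a(1) E by (auto simp: A_def)
    then show ?thesis using t \<open>B = {}\<close> a low[of "a * t" a]
      by (intro bexI[of _ "a * t"]) (auto intro: subfield_ops(4)[OF F(1)])
  next
    assume "A = {}" "B \<noteq> {}"
    then obtain b where b: "b \<in> B" "\<And>e. e \<in> B \<Longrightarrow> e / b \<in> Domain \<Phi>" using B by blast
    have b': "b \<in> F" "b \<noteq> 0" using b(1) E by (auto simp: B_def)
    then show ?thesis using t \<open>A = {}\<close> b high[of b "b / t"]
      by (intro bexI[of _ "b / t"]) (auto intro: subfield_ops(8)[OF F(1)])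
  next
    assume "A \<noteq> {}" "B \<noteq> {}"
    then obtain a b where a: "a \<in> A" "\<And>e. e \<in> A \<Longrightarrow> a / e \<in> Domain \<Phi>"
      and b: "b \<in> B" "\<And>e. e \<in> B \<Longrightarrow> e / b \<in> Domain \<Phi>" using A B by blast
    have a': "a \<in> F" "a \<noteq> 0" using a(1) E by (auto simp: A_def)
    have b': "b \<in> F" "b \<noteq> 0" using b(1) E by (auto simp: B_def)
    \<comment> \<open>The geometric mean lies strictly between \<open>a\<close> and
      \<open>b\<close>, because \<open>b / a\<close> is infinitesimal; it belongs to
      \<open>F\<close> because \<open>F\<close> is algebraically closed.\<close>
    obtain \<beta> where \<beta>: "\<beta> ^ 2 = a * b" using nth_root_exists[of 2 "a * b"] by auto
    have "\<beta> \<in> algebraic_over F"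
      unfolding algebraic_over_def using \<beta> subfield_ops[OF F(1)] a' b'
      by (intro CollectI exI[of _ "[:- (a * b), 0, 1:]"]) (auto simp: coeff_pCons power2_eq_square split: nat.splits)
    then have \<beta>F: "\<beta> \<in> F" using F(2) by blast
    have \<beta>0: "\<beta> \<noteq> 0" using \<beta> a' b' by auto
    have "(\<zeta> / a * (b / \<zeta>), 0) \<in> \<Phi>"
      using a(1) b(1) by (intro zero_mult) (auto simp: A_def B_def)
    then have ba: "(b / a, 0) \<in> \<Phi>" using \<zeta> by simp
    have "(\<beta> / a) ^ 2 = b / a" "(b / \<beta>) ^ 2 = b / a"
      using \<beta> a' b' by (simp_all add: power_divide) (simp_all add: power2_eq_square)
    then have \<beta>ab: "(\<beta> / a, 0) \<in> \<Phi>" "(b / \<beta>, 0) \<in> \<Phi>" using ba zero_root[of _ 2] by auto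
    have "(\<beta> / e, 0) \<in> \<Phi>" if "e \<in> A" for e by (rule low[OF \<beta>ab(1) a'(2) a(2)[OF that]])
    moreover have "(e / \<beta>, 0) \<in> \<Phi>" if "e \<in> B" for e by (rule high[OF \<beta>ab(2) b'(2) b(2)[OF that]])
    ultimately show ?thesis using \<beta>F \<beta>0 by blast
  qed
  then show thesis using that unfolding A_def B_def by blast
qed

lemma unit_ratio:
  assumes p: "p \<noteq> 0" and roots: "\<And>a. poly p a = 0 \<Longrightarrow> ((c - a) / (z - a), 1) \<in> \<Phi>"
  shows "(poly p c / poly p z, 1) \<in> \<Phi>"
proof -
  obtain A where A: "p = smult (lead_coeff p) (\<Prod>x\<in>#A. [:-x, 1:])"
    using alg_closed_imp_factorization[OF p] by blast
  have root: "poly p a = 0" if "a \<in># A" for a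
    by (subst A) (use that in \<open>auto simp: poly_prod_mset prod_mset_zero_iff\<close>)
  have "((\<Prod>a\<in>#B. c - a) / (\<Prod>a\<in>#B. z - a), 1) \<in> \<Phi>" if "B \<subseteq># A" for B
    using that
  proof (induction B)
    case empty
    then show ?case using hom_graph_one[OF \<Phi>h] by simp
  next
    case (add a B)
    have "B \<subseteq># A" using add.prems by (rule subset_mset.order_trans[rotated]) simp
    then have IH: "((\<Prod>a\<in>#B. c - a) / (\<Prod>a\<in>#B. z - a), 1) \<in> \<Phi>" by (rule add.IH)
    have "a \<in># A" using add.prems by (rule mset_subset_eqD) simp
    from unit_mult[OF roots[OF root[OF this]] IH] show ?case by simp
  qed
  then have "((\<Prod>a\<in>#A. c - a) / (\<Prod>a\<in>#A. z - a), 1) \<in> \<Phi>" by blast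
  moreover have "poly p y = lead_coeff p * (\<Prod>a\<in>#A. y - a)" for y
    by (subst A) (simp add: poly_prod_mset image_mset.compositionality comp_def)
  ultimately show ?thesis using p by simp
qed

text \<open>Each linear factor is asymptotic to a constant of \<open>F\<close> or to
  \<open>\<beta>\<close> itself, so \<open>p\<close> behaves like a monomial in
  \<open>\<beta>\<close>, with the same \<open>d\<close> and \<open>k\<close> for all
  \<open>\<beta> \<in> P\<close>.\<close>

lemma factor_asymptotics:
  assumes F: "subfield_on F" and p: "p \<noteq> 0" "\<And>i. coeff p i \<in> F"
    and roots: "\<And>a. poly p a = 0 \<Longrightarrow>
      (\<exists>e\<in>F. e \<noteq> 0 \<and> (\<forall>\<beta>\<in>P. ((a0 + \<beta> - a) / e, 1) \<in> \<Phi>)) \<or> (\<forall>\<beta>\<in>P. ((a0 + \<beta> - a) / \<beta>, 1) \<in> \<Phi>)"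
  obtains d k where "d \<in> F" "d \<noteq> 0" "\<And>\<beta>. \<beta> \<in> P \<Longrightarrow> (poly p (a0 + \<beta>) / (d * \<beta> ^ k), 1) \<in> \<Phi>"
proof -
  obtain A where A: "p = smult (lead_coeff p) (\<Prod>x\<in>#A. [:-x, 1:])"
    using alg_closed_imp_factorization[OF p(1)] by blast
  have root: "poly p a = 0" if "a \<in># A" for a
    by (subst A) (use that in \<open>auto simp: poly_prod_mset prod_mset_zero_iff\<close>)
  have "\<exists>d k. d \<in> F \<and> d \<noteq> 0 \<and> (\<forall>\<beta>\<in>P. ((\<Prod>a\<in>#B. a0 + \<beta> - a) / (d * \<beta> ^ k), 1) \<in> \<Phi>)"
    if "B \<subseteq># A" for B
    using that
  proof (induction B)
    case empty
    show ?case
      by (rule exI[of _ 1], rule exI[of _ 0]) (use subfield_ops(1)[OF F] hom_graph_one[OF \<Phi>h] in auto)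
  next
    case (add a B)
    have "B \<subseteq># A" using add.prems by (rule subset_mset.order_trans[rotated]) simp
    then obtain d k where IH: "d \<in> F" "d \<noteq> 0" "\<forall>\<beta>\<in>P. ((\<Prod>a\<in>#B. a0 + \<beta> - a) / (d * \<beta> ^ k), 1) \<in> \<Phi>"
      using add.IH by blast
    have "a \<in># A" using add.prems by (rule mset_subset_eqD) simp
    from roots[OF root[OF this]] show ?case
    proof
      assume "\<exists>e\<in>F. e \<noteq> 0 \<and> (\<forall>\<beta>\<in>P. ((a0 + \<beta> - a) / e, 1) \<in> \<Phi>)"
      then obtain e where e: "e \<in> F" "e \<noteq> 0" "\<forall>\<beta>\<in>P. ((a0 + \<beta> - a) / e, 1) \<in> \<Phi>" by blast
      have "((\<Prod>a\<in>#add_mset a B. a0 + \<beta> - a) / ((e * d) * \<beta> ^ k), 1) \<in> \<Phi>" if "\<beta> \<in> P" for \<beta>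
        using unit_mult[OF bspec[OF e(3) that] bspec[OF IH(3) that]] by (simp add: mult.assoc)
      then show ?thesis
        using e IH subfield_ops(4)[OF F] by (intro exI[of _ "e * d"] exI[of _ k]) simp
    next
      assume e: "\<forall>\<beta>\<in>P. ((a0 + \<beta> - a) / \<beta>, 1) \<in> \<Phi>"
      have "((\<Prod>a\<in>#add_mset a B. a0 + \<beta> - a) / (d * \<beta> ^ Suc k), 1) \<in> \<Phi>" if "\<beta> \<in> P" for \<beta>
        using unit_mult[OF bspec[OF e that] bspec[OF IH(3) that]] by (simp add: mult_ac)
      then show ?thesis
        using IH by (intro exI[of _ d] exI[of _ "Suc k"]) simp
    qed
  qed
  then obtain d k where d: "d \<in> F" "d \<noteq> 0" "\<forall>\<beta>\<in>P. ((\<Prod>a\<in>#A. a0 + \<beta> - a) / (d * \<beta> ^ k), 1) \<in> \<Phi>"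
    by blast
  have "poly p y = lead_coeff p * (\<Prod>a\<in>#A. y - a)" for y
    by (subst A) (simp add: poly_prod_mset image_mset.compositionality comp_def)
  then show thesis
    using that[of "lead_coeff p * d" k] d p subfield_ops(4)[OF F] by simp
qed

text \<open>Since \<open>x\<close> has a residue and is asymptotic to a nontrivial power of an
  infinitesimal or infinite element, that power must be infinitesimal. As \<open>w'\<close> is of
  the same kind as \<open>w\<close>, both residues are 0.\<close>

lemma power_quotient_residue:
  assumes x: "(x, y) \<in> \<Phi>" and u: "(x / w powi k, 1) \<in> \<Phi>" "(x' / w' powi k, 1) \<in> \<Phi>"
    and w: "((w, 0) \<in> \<Phi> \<and> (w', 0) \<in> \<Phi>) \<or> ((inverse w, 0) \<in> \<Phi> \<and> (inverse w', 0) \<in> \<Phi>)" and k: "k \<noteq> 0"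
  shows "(x', y) \<in> \<Phi>"
proof -
  have main: "(x', y) \<in> \<Phi>"
    if w: "(w, 0) \<in> \<Phi>" "(w', 0) \<in> \<Phi>" and u: "(x / w powi k, 1) \<in> \<Phi>" "(x' / w' powi k, 1) \<in> \<Phi>" and k: "k \<noteq> 0"
    for w w' and k :: int
  proof (cases "k > 0")
    case True
    then obtain n where n: "k = int n" "n > 0" by (metis pos_int_cases)
    have w0: "w ^ n \<noteq> 0" "w' ^ n \<noteq> 0" using unit_nonzero[OF u(1)] unit_nonzero[OF u(2)] n by auto
    have pw: "(w ^ n, 0) \<in> \<Phi>" "(w' ^ n, 0) \<in> \<Phi>"
      using hom_graph_power[OF \<Phi>h w(1), of n] hom_graph_power[OF \<Phi>h w(2), of n] n by (simp_all add: zero_power)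
    have "x / w ^ n \<in> Domain \<Phi>" "x' / w' ^ n \<in> Domain \<Phi>" using u n by auto
    then have "(w ^ n * (x / w ^ n), 0) \<in> \<Phi>" "(w' ^ n * (x' / w' ^ n), 0) \<in> \<Phi>"
      using zero_mult[OF pw(1)] zero_mult[OF pw(2)] by blast+
    moreover have "w ^ n * (x / w ^ n) = x" "w' ^ n * (x' / w' ^ n) = x'"
      using w0 by (metis nonzero_mult_div_cancel_left times_divide_eq_right)+
    ultimately have "(x, 0) \<in> \<Phi>" "(x', 0) \<in> \<Phi>" by simp_all
    then show ?thesis using hom_graph_unique[OF \<Phi>h x] by blast
  next
    case False
    then obtain n where n: "k = - int n" "n > 0" using k by (metis neg_int_cases linorder_neqE_linordered_idom)
    have "(w ^ n, 0) \<in> \<Phi>"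
      using hom_graph_power[OF \<Phi>h w(1), of n] n by (simp add: zero_power)
    then have "(w ^ n * x, 0) \<in> \<Phi>" using x by (intro zero_mult) auto
    moreover have "x / w powi k = w ^ n * x" using n by (simp add: power_int_minus field_simps)
    ultimately have "(0::complex) = 1" using u(1) hom_graph_unique[OF \<Phi>h] by metis
    then show ?thesis by simp
  qed
  show ?thesis
    using w
  proof
    assume "(w, 0) \<in> \<Phi> \<and> (w', 0) \<in> \<Phi>"
    then show ?thesis using main[of w w' k] u k by blast
  next
    assume "(inverse w, 0) \<in> \<Phi> \<and> (inverse w', 0) \<in> \<Phi>"
    then show ?thesis using main[of "inverse w" "inverse w'" "- k"] u k
      by (simp add: power_int_minus power_int_inverse)
  qed
qed

lemma subfield_powi_root:
  fixes F :: "'k set"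
  assumes F: "subfield_on F" "algebraic_over F \<subseteq> F" and d: "d \<in> F" "d \<noteq> 0" and k: "k \<noteq> 0"
  obtains e where "e \<in> F" "e \<noteq> 0" "e powi k = d"
proof -
  define m where "m = nat \<bar>k\<bar>"
  define d' where "d' = (if k > 0 then d else inverse d)"
  have m: "m > 0" using k unfolding m_def by auto
  then obtain e where e: "e ^ m = d'" using nth_root_exists[of m d'] by blast
  have d': "d' \<in> F" "d' \<noteq> 0" unfolding d'_def using d subfield_ops[OF F(1)] by auto
  have "coeff (monom 1 m - [:d':]) m = 1" using m by (cases m) auto
  then have "monom 1 m - [:d':] \<noteq> 0" by (metis coeff_0 zero_neq_one)
  moreover have "coeff (monom 1 m - [:d':]) i \<in> F" for i
    using d' subfield_ops[OF F(1)] by (auto simp: coeff_pCons split: nat.splits)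
  moreover have "poly (monom 1 m - [:d':]) e = 0" using e by (simp add: poly_monom)
  ultimately have "e \<in> algebraic_over F" unfolding algebraic_over_def by blast
  moreover have "e \<noteq> 0" using e d'(2) m by (auto simp: zero_power)
  moreover have "e powi k = d"
  proof (cases "k > 0")
    case True
    then have "k = int m" unfolding m_def by simp
    then show ?thesis using e True unfolding d'_def by simp
  next
    case False
    then have "k = - int m" unfolding m_def by simp
    then show ?thesis using e False unfolding d'_def by (simp add: power_int_minus)
  qed
  ultimately show thesis using that F(2) by blast
qed

text \<open>The zeros and poles of the functions in \<open>Q\<close> form a finite set
  \<open>A\<close>, contained in the algebraically closed \<open>F\<close>. If some
  \<open>z - a0\<close> has an absolute value not attained in \<open>F\<close>, every function is
  asymptotically a monomial in \<open>z - a0\<close>, and \<open>c - a0\<close> only has to lie on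
  the same side of finitely many thresholds. Otherwise \<open>F\<close> contains a \<open>c\<close>
  infinitely closer to \<open>z\<close> than all of \<open>A\<close>, and every function takes
  asymptotically equal values at \<open>c\<close> and at \<open>z\<close>.\<close>

lemma specialize_transcendental:
  fixes \<iota> :: "complex \<Rightarrow> 'k"
  assumes \<iota>: "\<And>a. (\<iota> a, a) \<in> \<Phi>"
    and F: "subfield_on F" "algebraic_over F \<subseteq> F" "range \<iota> \<subseteq> F" and t: "t \<in> F" "t \<noteq> 0" "(t, 0) \<in> \<Phi>"
    and z: "z \<notin> F" and Q: "finite Q" "Q \<subseteq> simple_extension F z" "Q \<subseteq> Domain \<Phi>"
  obtains c where "c \<in> F"
    "\<And>x. x \<in> Q \<Longrightarrow> \<exists>x' y. (x, x') \<in> evaluation_graph F z c \<and> (x, y) \<in> \<Phi> \<and> (x', y) \<in> \<Phi> \<and> (x \<noteq> 0 \<longrightarrow> x' \<noteq> 0)"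
proof -
  have z': "z \<notin> algebraic_over F" using z F(2) by blast
  have nz: "poly q z \<noteq> 0" if "q \<noteq> 0" "\<And>i. coeff q i \<in> F" for q
    using z' that unfolding algebraic_over_def by blast
  have ev0: "\<exists>x' y. (0, x') \<in> evaluation_graph F z c \<and> (0, y) \<in> \<Phi> \<and> (x', y) \<in> \<Phi> \<and> ((0::'k) \<noteq> 0 \<longrightarrow> x' \<noteq> 0)" for c
    using hom_graph_zero[OF \<Phi>h] hom_graph_zero[OF hom_graph_evaluation[OF F(1) z']] by blast
  have "\<forall>x\<in>Q - {0}. \<exists>p q. p \<noteq> 0 \<and> q \<noteq> 0 \<and> (\<forall>i. coeff p i \<in> F) \<and> (\<forall>i. coeff q i \<in> F) \<and> x = poly p z / poly q z"
  proof
    fix x assume x: "x \<in> Q - {0}"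
    then obtain p q where pq: "x = poly p z / poly q z" "\<forall>i. coeff p i \<in> F" "\<forall>i. coeff q i \<in> F"
      using Q(2) unfolding simple_extension_def by blast
    then have "p \<noteq> 0" "q \<noteq> 0" using x by auto
    then show "\<exists>p q. p \<noteq> 0 \<and> q \<noteq> 0 \<and> (\<forall>i. coeff p i \<in> F) \<and> (\<forall>i. coeff q i \<in> F) \<and> x = poly p z / poly q z"
      using pq by blast
  qed
  from bchoice[OF this] obtain p where "\<forall>x\<in>Q - {0}. \<exists>q. p x \<noteq> 0 \<and> q \<noteq> 0 \<and> (\<forall>i. coeff (p x) i \<in> F) \<and> (\<forall>i. coeff q i \<in> F) \<and> x = poly (p x) z / poly q z" ..
  from bchoice[OF this] obtain q where pq: "\<And>x. x \<in> Q - {0} \<Longrightarrow> p x \<noteq> 0" "\<And>x. x \<in> Q - {0} \<Longrightarrow> q x \<noteq> 0"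
    "\<And>x i. x \<in> Q - {0} \<Longrightarrow> coeff (p x) i \<in> F" "\<And>x i. x \<in> Q - {0} \<Longrightarrow> coeff (q x) i \<in> F"
    "\<And>x. x \<in> Q - {0} \<Longrightarrow> x = poly (p x) z / poly (q x) z"
    by blast
  define A where "A = (\<Union>x\<in>Q - {0}. {a. poly (p x) a = 0} \<union> {a. poly (q x) a = 0})"
  have Afin: "finite A" unfolding A_def
    by (intro finite_UN_I finite_UnI poly_roots_finite pq(1,2)) (use Q(1) in auto)
  have AF: "A \<subseteq> F"
  proof
    fix a assume "a \<in> A"
    then have "a \<in> algebraic_over F" unfolding A_def algebraic_over_def using pq by blast
    then show "a \<in> F" using F(2) by blast
  qed
  have zA: "z - a \<noteq> 0" if "a \<in> A" for a using that AF z by auto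
  show thesis
  proof (cases "\<exists>a0\<in>A. \<forall>b\<in>F. \<forall>y. y \<noteq> 0 \<longrightarrow> ((z - a0) / b, y) \<notin> \<Phi>")
    case True
    then obtain a0 where a0: "a0 \<in> A" "\<And>b y. b \<in> F \<Longrightarrow> y \<noteq> 0 \<Longrightarrow> ((z - a0) / b, y) \<notin> \<Phi>" by blast
    define \<zeta> where "\<zeta> = z - a0"
    have \<zeta>0: "\<zeta> \<noteq> 0" unfolding \<zeta>_def using zA a0(1) by blast
    have side: "(\<zeta> / e, 0) \<in> \<Phi> \<or> (e / \<zeta>, 0) \<in> \<Phi>" if "e \<in> F" "e \<noteq> 0" for e
      using place_inverse_zero[OF \<Phi>, of "\<zeta> / e"] that \<zeta>0 a0(2)[OF that(1)] unfolding \<zeta>_def by auto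
    define E0 where "E0 = (\<lambda>a. a0 - a) ` (A - {a0})"
    have E0: "finite E0" "E0 \<subseteq> F" "0 \<notin> E0"
      unfolding E0_def using Afin AF a0(1) subfield_ops(3)[OF F(1)] by auto
    \<comment> \<open>The admissible replacements for \<open>\<zeta>\<close>: those on the same side
      as \<open>\<zeta>\<close> of every difference \<open>a0 - a\<close>.\<close>
    define P where "P = {\<beta>. \<beta> \<noteq> 0 \<and> (\<forall>e\<in>E0. (\<zeta> / e, 0) \<in> \<Phi> \<longrightarrow> (\<beta> / e, 0) \<in> \<Phi>) \<and>
      (\<forall>e\<in>E0. (e / \<zeta>, 0) \<in> \<Phi> \<longrightarrow> (e / \<beta>, 0) \<in> \<Phi>)}"
    have \<zeta>P: "\<zeta> \<in> P" and zeq: "a0 + \<zeta> = z" unfolding P_def using \<zeta>0 by (simp_all add: \<zeta>_def)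
    have roots: "(\<exists>e\<in>F. e \<noteq> 0 \<and> (\<forall>\<beta>\<in>P. ((a0 + \<beta> - a) / e, 1) \<in> \<Phi>)) \<or> (\<forall>\<beta>\<in>P. ((a0 + \<beta> - a) / \<beta>, 1) \<in> \<Phi>)"
      if a: "a \<in> A" for a
    proof (cases "a = a0")
      case True
      then show ?thesis using hom_graph_one[OF \<Phi>h] by (simp add: P_def)
    next
      case False
      define e where "e = a0 - a"
      have e: "e \<in> E0" "e \<in> F" "e \<noteq> 0" unfolding e_def using False a E0 by (auto simp: E0_def)
      have eq: "a0 + \<beta> - a = \<beta> + e" for \<beta> by (simp add: e_def)
      show ?thesis
        using side[OF e(2,3)]
      proof
        assume 1: "(\<zeta> / e, 0) \<in> \<Phi>"
        have "((\<beta> + e) / e, 1) \<in> \<Phi>" if "\<beta> \<in> P" for \<beta>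
          using unit_add[of "\<beta> / e"] that 1 e by (simp add: field_simps P_def)
        then show ?thesis unfolding eq using e by blast
      next
        assume 1: "(e / \<zeta>, 0) \<in> \<Phi>"
        have "((\<beta> + e) / \<beta>, 1) \<in> \<Phi>" if "\<beta> \<in> P" for \<beta>
          using unit_add[of "e / \<beta>"] that 1 e by (simp add: field_simps P_def)
        then show ?thesis unfolding eq by blast
      qed
    qed
    define X where "X x \<beta> = poly (p x) (a0 + \<beta>) / poly (q x) (a0 + \<beta>)" for x \<beta>
    have "\<forall>x\<in>Q - {0}. \<exists>e. e \<in> F \<and> e \<noteq> 0 \<and> (\<forall>\<beta>\<in>P. poly (p x) (a0 + \<beta>) \<noteq> 0 \<and> poly (q x) (a0 + \<beta>) \<noteq> 0) \<and>
      ((\<forall>\<beta>\<in>P. (X x \<beta> / X x \<zeta>, 1) \<in> \<Phi>) \<or> (\<exists>k. k \<noteq> 0 \<and> (\<forall>\<beta>\<in>P. (X x \<beta> / (\<beta> / e) powi k, 1) \<in> \<Phi>)))"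
    proof
      fix x assume x: "x \<in> Q - {0}"
      have pA: "a \<in> A" if "poly (p x) a = 0" for a using that x unfolding A_def by blast
      have qA: "a \<in> A" if "poly (q x) a = 0" for a using that x unfolding A_def by blast
      obtain d k where d: "d \<in> F" "d \<noteq> 0" "\<And>\<beta>. \<beta> \<in> P \<Longrightarrow> (poly (p x) (a0 + \<beta>) / (d * \<beta> ^ k), 1) \<in> \<Phi>"
        using factor_asymptotics[OF F(1) pq(1)[OF x] pq(3)[OF x] roots[OF pA]] by blast
      obtain d' k' where d': "d' \<in> F" "d' \<noteq> 0" "\<And>\<beta>. \<beta> \<in> P \<Longrightarrow> (poly (q x) (a0 + \<beta>) / (d' * \<beta> ^ k'), 1) \<in> \<Phi>"
        using factor_asymptotics[OF F(1) pq(2)[OF x] pq(4)[OF x] roots[OF qA]] by blast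
      have nz: "poly (p x) (a0 + \<beta>) \<noteq> 0 \<and> poly (q x) (a0 + \<beta>) \<noteq> 0" if "\<beta> \<in> P" for \<beta>
        using unit_nonzero[OF d(3)[OF that]] unit_nonzero[OF d'(3)[OF that]] by auto
      have X: "(X x \<beta> / (d / d' * \<beta> powi (int k - int k')), 1) \<in> \<Phi>" if \<beta>: "\<beta> \<in> P" for \<beta>
      proof -
        have "\<beta> \<noteq> 0" using \<beta> by (simp add: P_def)
        then have "X x \<beta> / (d / d' * \<beta> powi (int k - int k')) =
          (poly (p x) (a0 + \<beta>) / (d * \<beta> ^ k)) / (poly (q x) (a0 + \<beta>) / (d' * \<beta> ^ k'))"
          using d(2) d'(2) by (simp add: X_def power_int_diff field_simps)
        then show ?thesis using unit_divide[OF d(3)[OF \<beta>] d'(3)[OF \<beta>]] by simp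
      qed
      show "\<exists>e. e \<in> F \<and> e \<noteq> 0 \<and> (\<forall>\<beta>\<in>P. poly (p x) (a0 + \<beta>) \<noteq> 0 \<and> poly (q x) (a0 + \<beta>) \<noteq> 0) \<and>
        ((\<forall>\<beta>\<in>P. (X x \<beta> / X x \<zeta>, 1) \<in> \<Phi>) \<or> (\<exists>k. k \<noteq> 0 \<and> (\<forall>\<beta>\<in>P. (X x \<beta> / (\<beta> / e) powi k, 1) \<in> \<Phi>)))"
      proof (cases "k = k'")
        case True
        \<comment> \<open>With equal exponents the function is asymptotically constant on
          \<open>P\<close>.\<close>
        have "(X x \<beta> / X x \<zeta>, 1) \<in> \<Phi>" if "\<beta> \<in> P" for \<beta>
          using unit_divide[OF X[OF that] X[OF \<zeta>P]] d(2) d'(2) True by simp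
        then show ?thesis using nz subfield_ops(1)[OF F(1)] by (intro exI[of _ 1]) auto
      next
        case False
        \<comment> \<open>Taking a root absorbs the constant \<open>d / d'\<close> into a threshold
          \<open>e\<close>: the function becomes a power of \<open>\<beta> / e\<close>,
          infinitesimal or infinite according to the side of \<open>e\<close> on which
          \<open>\<beta>\<close> lies.\<close>
        have "d' / d \<in> F" "d' / d \<noteq> 0" using d d' subfield_ops(8)[OF F(1)] by auto
        then obtain e where e: "e \<in> F" "e \<noteq> 0" "e powi (int k - int k') = d' / d"
          using subfield_powi_root[OF F(1,2), of "d' / d" "int k - int k'"] False by auto
        have eq: "d / d' * \<beta> powi (int k - int k') = (\<beta> / e) powi (int k - int k')" for \<beta>
          using e d(2) d'(2) by (simp add: power_int_divide_distrib field_simps)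
        have "\<forall>\<beta>\<in>P. (X x \<beta> / (\<beta> / e) powi (int k - int k'), 1) \<in> \<Phi>" using X unfolding eq by blast
        moreover have "int k - int k' \<noteq> 0" using False by simp
        ultimately show ?thesis using e(1,2) nz by blast
      qed
    qed
    from bchoice[OF this] obtain e where ee: "\<forall>x\<in>Q - {0}. e x \<in> F \<and> e x \<noteq> 0 \<and>
      (\<forall>\<beta>\<in>P. poly (p x) (a0 + \<beta>) \<noteq> 0 \<and> poly (q x) (a0 + \<beta>) \<noteq> 0) \<and>
      ((\<forall>\<beta>\<in>P. (X x \<beta> / X x \<zeta>, 1) \<in> \<Phi>) \<or> (\<exists>k. k \<noteq> 0 \<and> (\<forall>\<beta>\<in>P. (X x \<beta> / (\<beta> / e x) powi k, 1) \<in> \<Phi>)))" ..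
    have e: "e x \<in> F" "e x \<noteq> 0" "\<beta> \<in> P \<Longrightarrow> poly (p x) (a0 + \<beta>) \<noteq> 0" "\<beta> \<in> P \<Longrightarrow> poly (q x) (a0 + \<beta>) \<noteq> 0"
      "(\<forall>\<beta>\<in>P. (X x \<beta> / X x \<zeta>, 1) \<in> \<Phi>) \<or> (\<exists>k. k \<noteq> 0 \<and> (\<forall>\<beta>\<in>P. (X x \<beta> / (\<beta> / e x) powi k, 1) \<in> \<Phi>))"
      if "x \<in> Q - {0}" for x \<beta>
    proof -
      note c = bspec[OF ee that]
      show "e x \<in> F" by (rule conjunct1[OF c])
      show "e x \<noteq> 0" by (rule conjunct1[OF conjunct2[OF c]])
      show "(\<forall>\<beta>\<in>P. (X x \<beta> / X x \<zeta>, 1) \<in> \<Phi>) \<or> (\<exists>k. k \<noteq> 0 \<and> (\<forall>\<beta>\<in>P. (X x \<beta> / (\<beta> / e x) powi k, 1) \<in> \<Phi>))"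
        by (rule conjunct2[OF conjunct2[OF conjunct2[OF c]]])
      have "\<forall>\<beta>\<in>P. poly (p x) (a0 + \<beta>) \<noteq> 0 \<and> poly (q x) (a0 + \<beta>) \<noteq> 0"
        by (rule conjunct1[OF conjunct2[OF conjunct2[OF c]]])
      then show "\<beta> \<in> P \<Longrightarrow> poly (p x) (a0 + \<beta>) \<noteq> 0" "\<beta> \<in> P \<Longrightarrow> poly (q x) (a0 + \<beta>) \<noteq> 0" by simp_all
    qed
    define E where "E = E0 \<union> e ` (Q - {0})"
    have "0 \<notin> e ` (Q - {0})" using e(2) by (metis imageE)
    then have E: "finite E" "E \<subseteq> F" "0 \<notin> E" unfolding E_def using E0 e(1) Q(1) by auto
    obtain \<beta> where \<beta>: "\<beta> \<in> F" "\<beta> \<noteq> 0" "\<And>e. e \<in> E \<Longrightarrow> (\<zeta> / e, 0) \<in> \<Phi> \<Longrightarrow> (\<beta> / e, 0) \<in> \<Phi>"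
      "\<And>e. e \<in> E \<Longrightarrow> (e / \<zeta>, 0) \<in> \<Phi> \<Longrightarrow> (e / \<beta>, 0) \<in> \<Phi>"
      using interpolate_value[OF F(1,2) t E \<zeta>0] by blast
    have \<beta>P: "\<beta> \<in> P" unfolding P_def using \<beta> by (auto simp: E_def)
    show thesis
    proof (rule that[of "a0 + \<beta>"])
      show "a0 + \<beta> \<in> F" using a0(1) AF \<beta>(1) subfield_ops(7)[OF F(1)] by blast
      fix x assume "x \<in> Q"
      show "\<exists>x' y. (x, x') \<in> evaluation_graph F z (a0 + \<beta>) \<and> (x, y) \<in> \<Phi> \<and> (x', y) \<in> \<Phi> \<and> (x \<noteq> 0 \<longrightarrow> x' \<noteq> 0)"
      proof (cases "x = 0")
        case True
        then show ?thesis using ev0 by simp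
      next
        case False
        then have x: "x \<in> Q - {0}" using \<open>x \<in> Q\<close> by simp
        obtain y where y: "(x, y) \<in> \<Phi>" using Q(3) \<open>x \<in> Q\<close> by blast
        have xX: "x = X x \<zeta>" unfolding X_def zeq by (rule pq(5)[OF x])
        have "(X x \<beta>, y) \<in> \<Phi>"
          using e(5)[OF x]
        proof
          assume "\<forall>\<beta>\<in>P. (X x \<beta> / X x \<zeta>, 1) \<in> \<Phi>"
          then have "(X x \<beta> / x, 1) \<in> \<Phi>" using \<beta>P xX by simp
          from hom_graph_mult[OF \<Phi>h y this] show ?thesis using False by simp
        next
          assume "\<exists>k. k \<noteq> 0 \<and> (\<forall>\<beta>\<in>P. (X x \<beta> / (\<beta> / e x) powi k, 1) \<in> \<Phi>)"
          then obtain k where k: "k \<noteq> 0" "\<And>\<beta>. \<beta> \<in> P \<Longrightarrow> (X x \<beta> / (\<beta> / e x) powi k, 1) \<in> \<Phi>" by blast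
          have exE: "e x \<in> E" unfolding E_def using x by blast
          show ?thesis
          proof (rule power_quotient_residue[OF y _ k(2)[OF \<beta>P] _ k(1)])
            show "(x / (\<zeta> / e x) powi k, 1) \<in> \<Phi>" using k(2)[OF \<zeta>P] xX by simp
            show "((\<zeta> / e x, 0) \<in> \<Phi> \<and> (\<beta> / e x, 0) \<in> \<Phi>) \<or> ((inverse (\<zeta> / e x), 0) \<in> \<Phi> \<and> (inverse (\<beta> / e x), 0) \<in> \<Phi>)"
              using side[OF e(1,2)[OF x]] \<beta>(3,4)[OF exE] by auto
          qed
        qed
        moreover have "(x, X x \<beta>) \<in> evaluation_graph F z (a0 + \<beta>)"
          unfolding evaluation_graph_def X_def using pq(3-5)[OF x] e(4)[OF x \<beta>P] by blast
        moreover have "X x \<beta> \<noteq> 0" unfolding X_def using e(3,4)[OF x \<beta>P] by simp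
        ultimately show ?thesis using y by blast
      qed
    qed
  next
    case False
    have "\<exists>c\<in>F. \<forall>a\<in>A. ((c - a) / (z - a), 1) \<in> \<Phi>"
    proof (cases "A = {}")
      case True
      then show ?thesis using subfield_ops(1)[OF F(1)] by auto
    next
      case nonempty: False
      \<comment> \<open>\<open>a0\<close> is a point of \<open>A\<close> nearest to
        \<open>z\<close>; correcting it by the leading term \<open>b * \<iota> \<rho>\<close> of
        \<open>z - a0\<close> gives a point that is infinitely closer.\<close>
      have "\<exists>m\<in>(\<lambda>a. z - a) ` A. \<forall>d\<in>(\<lambda>a. z - a) ` A. m / d \<in> Domain \<Phi>"
        using Afin nonempty zA by (intro place_min_element[OF \<Phi>]) auto
      then obtain a0 where a0: "a0 \<in> A" "\<And>a. a \<in> A \<Longrightarrow> (z - a0) / (z - a) \<in> Domain \<Phi>" by blast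
      obtain b \<rho> where b: "b \<in> F" "\<rho> \<noteq> 0" "((z - a0) / b, \<rho>) \<in> \<Phi>" using False a0(1) by blast
      define c where "c = a0 + b * \<iota> \<rho>"
      have b0: "b \<noteq> 0" using hom_graph_nonzero[OF \<Phi>h b(3,2)] by auto
      have "((z - a0) / b - \<iota> \<rho>, 0) \<in> \<Phi>" using hom_graph_diff[OF \<Phi>h b(3) \<iota>[of \<rho>]] by simp
      moreover have "inverse ((z - a0) / b) \<in> Domain \<Phi>" using hom_graph_inverse_if_place[OF \<Phi>h \<Phi> b(3,2)] by blast
      ultimately have "(((z - a0) / b - \<iota> \<rho>) * inverse ((z - a0) / b), 0) \<in> \<Phi>" by (rule zero_mult)
      moreover have "((z - a0) / b - \<iota> \<rho>) * inverse ((z - a0) / b) = (z - c) / (z - a0)"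
        using b0 zA[OF a0(1)] by (simp add: c_def field_simps)
      ultimately have zc: "((z - c) / (z - a0), 0) \<in> \<Phi>" by (simp only:)
      have "((c - a) / (z - a), 1) \<in> \<Phi>" if a: "a \<in> A" for a
      proof -
        have "((z - c) / (z - a0) * ((z - a0) / (z - a)), 0) \<in> \<Phi>" by (rule zero_mult[OF zc a0(2)[OF a]])
        then have "((z - c) / (z - a), 0) \<in> \<Phi>" using zA[OF a0(1)] by simp
        from hom_graph_diff[OF \<Phi>h hom_graph_one[OF \<Phi>h] this] 
        have "(1 - (z - c) / (z - a), 1) \<in> \<Phi>" by simp
        moreover have "1 - (z - c) / (z - a) = (c - a) / (z - a)" using zA[OF a] by (simp add: field_simps)
        ultimately show ?thesis by simp
      qed
      moreover have "c \<in> F" unfolding c_def using a0(1) AF b(1) F(3) by (intro subfield_ops(4,7)[OF F(1)]) auto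
      ultimately show ?thesis by blast
    qed
    then obtain c where c: "c \<in> F" "\<And>a. a \<in> A \<Longrightarrow> ((c - a) / (z - a), 1) \<in> \<Phi>" by blast
    show thesis
    proof (rule that[OF c(1)])
      fix x assume "x \<in> Q"
      show "\<exists>x' y. (x, x') \<in> evaluation_graph F z c \<and> (x, y) \<in> \<Phi> \<and> (x', y) \<in> \<Phi> \<and> (x \<noteq> 0 \<longrightarrow> x' \<noteq> 0)"
      proof (cases "x = 0")
        case True
        then show ?thesis using ev0 by simp
      next
        case False
        then have x: "x \<in> Q - {0}" using \<open>x \<in> Q\<close> by simp
        obtain y where y: "(x, y) \<in> \<Phi>" using Q(3) \<open>x \<in> Q\<close> by blast
        have up: "(poly (p x) c / poly (p x) z, 1) \<in> \<Phi>"
          by (rule unit_ratio[OF pq(1)[OF x] c(2)]) (use x in \<open>auto simp: A_def\<close>)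
        have uq: "(poly (q x) c / poly (q x) z, 1) \<in> \<Phi>"
          by (rule unit_ratio[OF pq(2)[OF x] c(2)]) (use x in \<open>auto simp: A_def\<close>)
        have nz: "poly (p x) c \<noteq> 0" "poly (q x) c \<noteq> 0" "poly (p x) z \<noteq> 0" "poly (q x) z \<noteq> 0"
          using unit_nonzero[OF up] unit_nonzero[OF uq] by auto
        define x' where "x' = poly (p x) c / poly (q x) c"
        have "(x * (poly (p x) c / poly (p x) z / (poly (q x) c / poly (q x) z)), y * 1) \<in> \<Phi>"
          by (intro hom_graph_mult[OF \<Phi>h] y unit_divide up uq)
        moreover have "x * (poly (p x) c / poly (p x) z / (poly (q x) c / poly (q x) z)) = x'"
          by (subst pq(5)[OF x]) (use nz in \<open>simp add: x'_def field_simps\<close>)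
        ultimately have "(x', y) \<in> \<Phi>" by simp
        moreover have "(x, x') \<in> evaluation_graph F z c"
          unfolding evaluation_graph_def x'_def using pq(3-5)[OF x] nz by blast
        moreover have "x' \<noteq> 0" unfolding x'_def using nz by simp
        ultimately show ?thesis using y by blast
      qed
    qed
  qed
qed

end

section \<open>Changing places along a tower\<close>

lemma hom_graph_relcomp:
  assumes "hom_graph g" "hom_graph h"
  shows "hom_graph (g O h)"
  unfolding hom_graph_def
proof (intro conjI allI impI)
  show "(1, 1) \<in> g O h" using assms[THEN hom_graph_one] by blast
next
  fix a b c d assume "(a, b) \<in> g O h" "(c, d) \<in> g O h"
  then obtain x y where "(a, x) \<in> g" "(x, b) \<in> h" "(c, y) \<in> g" "(y, d) \<in> h" by blast
  then have "(a - c, x - y) \<in> g" "(x - y, b - d) \<in> h" "(a * c, x * y) \<in> g" "(x * y, b * d) \<in> h"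
    using assms by (simp_all add: hom_graph_diff hom_graph_mult)
  then show "(a - c, b - d) \<in> g O h" "(a * c, b * d) \<in> g O h" by blast+
next
  fix b assume "(0, b) \<in> g O h"
  then obtain x where "(0, x) \<in> g" "(x, b) \<in> h" by blast
  then show "b = 0" using hom_graph_zeroD[OF assms(1)] hom_graph_zeroD[OF assms(2)] by blast
qed

text \<open>The head of the list is adjoined last. Passing to the algebraic closure at every stage
  supplies the roots that specialization needs and keeps the images of algebraic elements inside the
  stage below.\<close>

primrec tower :: "'k::field set \<Rightarrow> 'k list \<Rightarrow> 'k set" where
  "tower L [] = algebraic_over L"
| "tower L (b # bs) = algebraic_over (simple_extension (tower L bs) b)"

lemma tower_properties:
  fixes L :: "'k::alg_closed_field set"
  assumes L: "subfield_on L"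
  shows "subfield_on (tower L bs) \<and> algebraic_over (tower L bs) \<subseteq> tower L bs \<and> L \<subseteq> tower L bs \<and> set bs \<subseteq> tower L bs"
proof (induction bs)
  case Nil
  then show ?case
    using subfield_algebraic_over[OF L] algebraic_over_closed[OF L] subfield_subset_algebraic[OF L] by simp
next
  case (Cons b bs)
  let ?K = "simple_extension (tower L bs) b"
  have T: "subfield_on (tower L bs)" using Cons by blast
  have K: "subfield_on ?K" by (rule subfield_simple_extension[OF T])
  have sub: "tower L bs \<subseteq> ?K" by (rule subset_simple_extension[OF T])
  have "poly [:0, 1:] b / poly 1 b \<in> ?K"
    unfolding simple_extension_def using subfield_ops[OF T]
    by (intro CollectI exI[of _ "[:0, 1:]"] exI[of _ 1]) (auto simp: coeff_pCons split: nat.splits)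
  then have "b \<in> ?K" by simp
  then show ?case
    using Cons sub subfield_algebraic_over[OF K] algebraic_over_closed[OF K] subfield_subset_algebraic[OF K] by auto
qed

text \<open>
  Descends along the tower, specializing one transcendental at a time with respect to \<open>\<Phi>\<close>; only
  the last, algebraic step changes from \<open>\<Phi>\<close> to \<open>\<Phi>'\<close>.
\<close>
lemma change_of_place:
  fixes \<Phi> \<Phi>' :: "('k::alg_closed_field \<times> complex) set" and \<iota> :: "complex \<Rightarrow> 'k"
  assumes \<Phi>: "place \<Phi>" "place \<Phi>'" and \<iota>: "\<And>a. (\<iota> a, a) \<in> \<Phi>" "\<And>a. (\<iota> a, a) \<in> \<Phi>'"
    and L: "subfield_on L" "range \<iota> \<subseteq> L" and t: "t \<in> L" "t \<noteq> 0" "(t, 0) \<in> \<Phi>"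
    and agree: "\<And>x y. x \<in> L \<Longrightarrow> (x, y) \<in> \<Phi> \<Longrightarrow> (x, y) \<in> \<Phi>'"
    and C: "finite C" "C \<subseteq> tower L bs" "C \<subseteq> Domain \<Phi>"
  shows "\<exists>S. hom_graph S \<and> Id_on L \<subseteq> S \<and> (\<forall>c\<in>C. \<exists>c' y. (c, c') \<in> S \<and> (c, y) \<in> \<Phi> \<and> (c', y) \<in> \<Phi>')"
  using C
proof (induction bs arbitrary: C)
  case Nil
  have C: "C \<subseteq> algebraic_over L" using Nil by simp
  show ?case
  proof (rule place_lift_algebraic[OF \<Phi>(1) \<iota>(1) L Nil(1) C Nil(3)])
    fix Q assume Q: "Q \<subseteq> L" "Q \<subseteq> Domain \<Phi>"
      and *: "\<And>g \<Phi>'. hom_graph g \<Longrightarrow> Domain g \<subseteq> L \<Longrightarrow> place \<Phi>' \<Longrightarrow> (\<And>a. (\<iota> a, \<iota> a) \<in> g) \<Longrightarrow> (\<And>a. (\<iota> a, a) \<in> \<Phi>') \<Longrightarrow>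
       (\<And>x. x \<in> Q \<Longrightarrow> \<exists>x' y. (x, x') \<in> g \<and> (x, y) \<in> \<Phi> \<and> (x', y) \<in> \<Phi>' \<and> (x \<noteq> 0 \<longrightarrow> x' \<noteq> 0)) \<Longrightarrow>
       \<exists>\<Psi>. place \<Psi> \<and> g \<subseteq> \<Psi> \<and> (\<forall>c\<in>C. \<exists>c' y. (c, c') \<in> \<Psi> \<and> (c, y) \<in> \<Phi> \<and> (c', y) \<in> \<Phi>' \<and>
          (\<forall>F. subfield_on F \<longrightarrow> Range g \<subseteq> F \<longrightarrow> c' \<in> algebraic_over F))"
    \<comment> \<open>Here \<open>g\<close> is the identity of \<open>L\<close>; the required
      compatibility of residues is the agreement of the two places on \<open>L\<close>.\<close>
    have "\<exists>\<Psi>. place \<Psi> \<and> Id_on L \<subseteq> \<Psi> \<and> (\<forall>c\<in>C. \<exists>c' y. (c, c') \<in> \<Psi> \<and> (c, y) \<in> \<Phi> \<and> (c', y) \<in> \<Phi>' \<and>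
          (\<forall>F. subfield_on F \<longrightarrow> Range (Id_on L) \<subseteq> F \<longrightarrow> c' \<in> algebraic_over F))"
    proof (rule *[OF hom_graph_Id_on[OF L(1)] _ \<Phi>(2) _ \<iota>(2)])
      show "\<exists>x' y. (x, x') \<in> Id_on L \<and> (x, y) \<in> \<Phi> \<and> (x', y) \<in> \<Phi>' \<and> (x \<noteq> 0 \<longrightarrow> x' \<noteq> 0)" if "x \<in> Q" for x
        using that Q agree[of x] by blast
    qed (use L(2) in auto)
    then show ?thesis using place_imp_hom_graph by meson
  qed
next
  case (Cons b bs)
  let ?T = "tower L bs"
  have T: "subfield_on ?T" "algebraic_over ?T \<subseteq> ?T" "L \<subseteq> ?T" using tower_properties[OF L(1), of bs] by auto
  show ?case
  proof (cases "b \<in> ?T")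
    case True
    have "simple_extension ?T b \<subseteq> ?T" by (rule simple_extension_subset[OF T(1) order_refl T(1) True])
    then have "algebraic_over (simple_extension ?T b) \<subseteq> algebraic_over ?T" unfolding algebraic_over_def by blast
    then show ?thesis using Cons.IH[OF Cons.prems(1)] Cons.prems T by (auto simp: subset_iff)
  next
    case False
    let ?K = "simple_extension ?T b"
    have K: "subfield_on ?K" "range \<iota> \<subseteq> ?K" "C \<subseteq> algebraic_over ?K"
      using subfield_simple_extension[OF T(1)] subset_simple_extension[OF T(1), of b] L(2) T(3) Cons.prems(2) by auto
    show ?thesis
    proof (rule place_lift_algebraic[OF \<Phi>(1) \<iota>(1) K(1,2) Cons.prems(1) K(3) Cons.prems(3)])
      fix Q assume Q: "finite Q" "Q \<subseteq> ?K" "Q \<subseteq> Domain \<Phi>"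
      and *: "\<And>g \<Phi>'. hom_graph g \<Longrightarrow> Domain g \<subseteq> ?K \<Longrightarrow> place \<Phi>' \<Longrightarrow> (\<And>a. (\<iota> a, \<iota> a) \<in> g) \<Longrightarrow> (\<And>a. (\<iota> a, a) \<in> \<Phi>') \<Longrightarrow>
       (\<And>x. x \<in> Q \<Longrightarrow> \<exists>x' y. (x, x') \<in> g \<and> (x, y) \<in> \<Phi> \<and> (x', y) \<in> \<Phi>' \<and> (x \<noteq> 0 \<longrightarrow> x' \<noteq> 0)) \<Longrightarrow>
       \<exists>\<Psi>. place \<Psi> \<and> g \<subseteq> \<Psi> \<and> (\<forall>c\<in>C. \<exists>c' y. (c, c') \<in> \<Psi> \<and> (c, y) \<in> \<Phi> \<and> (c', y) \<in> \<Phi>' \<and>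
          (\<forall>F. subfield_on F \<longrightarrow> Range g \<subseteq> F \<longrightarrow> c' \<in> algebraic_over F))"
      have \<iota>T: "range \<iota> \<subseteq> ?T" "t \<in> ?T" using L(2) t(1) T(3) by auto
      obtain c where c: "c \<in> ?T"
        "\<And>x. x \<in> Q \<Longrightarrow> \<exists>x' y. (x, x') \<in> evaluation_graph ?T b c \<and> (x, y) \<in> \<Phi> \<and> (x', y) \<in> \<Phi> \<and> (x \<noteq> 0 \<longrightarrow> x' \<noteq> 0)"
        by (rule specialize_transcendental[OF \<Phi>(1) \<iota>(1) T(1,2) \<iota>T(1) \<iota>T(2) t(2,3) False Q]) blast
      let ?g = "evaluation_graph ?T b c"
      have "b \<notin> algebraic_over ?T" using False T(2) by blast
      then have g: "hom_graph ?g" by (rule hom_graph_evaluation[OF T(1)])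
      have idg: "Id_on ?T \<subseteq> ?g" by (rule Id_on_subset_evaluation[OF T(1)])
      have "\<exists>\<Psi>. place \<Psi> \<and> ?g \<subseteq> \<Psi> \<and> (\<forall>c\<in>C. \<exists>c' y. (c, c') \<in> \<Psi> \<and> (c, y) \<in> \<Phi> \<and> (c', y) \<in> \<Phi> \<and>
          (\<forall>F. subfield_on F \<longrightarrow> Range ?g \<subseteq> F \<longrightarrow> c' \<in> algebraic_over F))"
        by (rule *[OF g Domain_evaluation \<Phi>(1) _ \<iota>(1) c(2)]) (use \<iota>T(1) idg in blast)
      then obtain \<Psi> where \<Psi>: "place \<Psi>" "?g \<subseteq> \<Psi>" "\<forall>c\<in>C. \<exists>c' y. (c, c') \<in> \<Psi> \<and> (c, y) \<in> \<Phi> \<and> (c', y) \<in> \<Phi> \<and>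
          (\<forall>F. subfield_on F \<longrightarrow> Range ?g \<subseteq> F \<longrightarrow> c' \<in> algebraic_over F)" by blast
      from bchoice[OF \<Psi>(3)] obtain d where d: "\<forall>c\<in>C. \<exists>y. (c, d c) \<in> \<Psi> \<and> (c, y) \<in> \<Phi> \<and> (d c, y) \<in> \<Phi> \<and>
          (\<forall>F. subfield_on F \<longrightarrow> Range ?g \<subseteq> F \<longrightarrow> d c \<in> algebraic_over F)" ..
      \<comment> \<open>The images are algebraic over the range of the specialization, which lies in
        \<open>?T\<close>. As \<open>?T\<close> is algebraically closed they lie in
        \<open>?T\<close>, where the induction hypothesis takes over.\<close>
      have dT: "d x \<in> ?T" if "x \<in> C" for x
        using bspec[OF d that] T(1,2) Range_evaluation[OF T(1) c(1)] by blast
      have "finite (d ` C)" "d ` C \<subseteq> ?T" "d ` C \<subseteq> Domain \<Phi>" using Cons.prems(1) dT d by auto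
      from Cons.IH[OF this] obtain S where S: "hom_graph S" "Id_on L \<subseteq> S"
        "\<forall>c\<in>d ` C. \<exists>c' y. (c, c') \<in> S \<and> (c, y) \<in> \<Phi> \<and> (c', y) \<in> \<Phi>'" by blast
      have "hom_graph (\<Psi> O S)" by (rule hom_graph_relcomp[OF place_imp_hom_graph[OF \<Psi>(1)] S(1)])
      moreover have "(x, x) \<in> \<Psi> O S" if "x \<in> L" for x
      proof
        show "(x, x) \<in> \<Psi>" using that T(3) idg \<Psi>(2) by blast
        show "(x, x) \<in> S" using that S(2) by blast
      qed
      then have "Id_on L \<subseteq> \<Psi> O S" by (auto simp: Id_on_def)
      moreover have "\<exists>c' y. (x, c') \<in> \<Psi> O S \<and> (x, y) \<in> \<Phi> \<and> (c', y) \<in> \<Phi>'" if x: "x \<in> C" for x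
      proof -
        obtain y where y: "(x, d x) \<in> \<Psi>" "(x, y) \<in> \<Phi>" "(d x, y) \<in> \<Phi>" using bspec[OF d x] by blast
        obtain c' y' where c': "(d x, c') \<in> S" "(d x, y') \<in> \<Phi>" "(c', y') \<in> \<Phi>'" using S(3) x by blast
        have "y' = y" by (rule hom_graph_unique[OF place_imp_hom_graph[OF \<Phi>(1)] c'(2) y(3)])
        then show ?thesis using y c' by blast
      qed
      ultimately show ?thesis by blast
    qed
  qed
qed

section \<open>Ultrapowers of the complex numbers\<close>

definition ultrafilter :: "'a filter \<Rightarrow> bool" where
  "ultrafilter U \<longleftrightarrow> U \<noteq> bot \<and> (\<forall>P. eventually P U \<or> eventually (\<lambda>x. \<not> P x) U)"

text \<open>Zorn's lemma yields a minimal proper filter below \<open>F\<close>. Restricting it to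
  the set where \<open>P\<close> holds gives either the improper filter or the filter itself, so it
  decides \<open>P\<close>.\<close>

lemma ultrafilter_exists:
  fixes F :: "'a filter"
  assumes "F \<noteq> bot"
  obtains U where "ultrafilter U" "U \<le> F"
proof -
  let ?A = "{G. G \<noteq> bot \<and> G \<le> F}"
  have "\<exists>m\<in>?A. \<forall>a\<in>?A. m \<ge> a \<longrightarrow> a = m"
  proof (rule predicate_Zorn)
    show "partial_order_on ?A (relation_of (\<ge>) ?A)"
      by (rule partial_order_on_relation_ofI) auto
    fix C assume "C \<in> Chains (relation_of (\<ge>) ?A)"
    then have C: "C \<subseteq> ?A" "\<And>G H. G \<in> C \<Longrightarrow> H \<in> C \<Longrightarrow> G \<le> H \<or> H \<le> G"
      unfolding Chains_def relation_of_def by auto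
    show "\<exists>u\<in>?A. \<forall>a\<in>C. u \<le> a"
    proof (cases "C = {}")
      case True
      then show ?thesis using assms by blast
    next
      case False
      have "eventually P (Inf C) \<longleftrightarrow> (\<exists>G\<in>C. eventually P G)" for P
      proof (rule eventually_Inf_base[OF False])
        fix G H assume "G \<in> C" "H \<in> C"
        then show "\<exists>x\<in>C. x \<le> inf G H" using C(2)[of G H] by (auto simp: inf_absorb1 inf_absorb2)
      qed
      then have "Inf C \<noteq> bot" using C(1) by (auto simp: trivial_limit_def)
      moreover have "Inf C \<le> F" using False C(1) by (auto intro: Inf_lower2)
      ultimately show ?thesis by (auto intro: Inf_lower)
    qed
  qed
  then obtain U where U': "U \<in> ?A" and min': "\<forall>G\<in>?A. U \<ge> G \<longrightarrow> G = U" by blast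
  then have U: "U \<noteq> bot" "U \<le> F" by auto
  have min: "G = U" if "G \<noteq> bot" "G \<le> U" for G
    using min' that order_trans[OF that(2) U(2)] by simp
  have "eventually P U \<or> eventually (\<lambda>x. \<not> P x) U" for P
  proof (cases "inf U (principal {x. P x}) = bot")
    case True
    then have "eventually (\<lambda>x. False) (inf U (principal {x. P x}))" by simp
    then show ?thesis unfolding eventually_inf_principal by simp
  next
    case False
    then have "inf U (principal {x. P x}) = U" by (intro min) auto
    then have "U \<le> principal {x. P x}" by (simp add: inf.orderI)
    then show ?thesis by (simp add: le_principal)
  qed
  then show thesis using that U unfolding ultrafilter_def by blast
qed

lemma ultrafilter_not_eventually: "ultrafilter U \<Longrightarrow> \<not> eventually P U \<longleftrightarrow> eventually (\<lambda>x. \<not> P x) U"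
proof
  assume U: "ultrafilter U" and P: "eventually (\<lambda>x. \<not> P x) U"
  show "\<not> eventually P U"
  proof
    assume "eventually P U"
    with P have "eventually (\<lambda>x. False) U" by (rule eventually_elim2) simp
    then show False using U by (simp add: ultrafilter_def trivial_limit_def)
  qed
qed (auto simp: ultrafilter_def)

lemma ultrafilter_bounded_convergent:
  fixes f :: "'a \<Rightarrow> 'b::heine_borel"
  assumes U: "ultrafilter U" and S: "bounded S" "eventually (\<lambda>x. f x \<in> S) U"
  obtains l where "(f \<longlongrightarrow> l) U"
proof -
  have "compact (closure S)" using S(1) by (simp add: compact_closure)
  moreover have "filtermap f U \<noteq> bot" using U by (simp add: ultrafilter_def filtermap_bot_iff)
  moreover have "eventually (\<lambda>x. x \<in> closure S) (filtermap f U)"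
    unfolding eventually_filtermap using S(2) by (rule eventually_mono) (use closure_subset in auto)
  ultimately obtain l where l: "inf (nhds l) (filtermap f U) \<noteq> bot"
    unfolding compact_filter by blast
  have "(f \<longlongrightarrow> l) U"
    unfolding tendsto_def
  proof (intro allI impI)
    fix V assume V: "open V" "l \<in> V"
    show "eventually (\<lambda>x. f x \<in> V) U"
    proof (rule ccontr)
      assume "\<not> ?thesis"
      then have "eventually (\<lambda>x. f x \<notin> V) U" using ultrafilter_not_eventually[OF U] by blast
      then have "eventually (\<lambda>y. y \<notin> V) (filtermap f U)" by (simp add: eventually_filtermap)
      moreover have "eventually (\<lambda>y. y \<in> V) (nhds l)" using V by (rule eventually_nhds_in_open)
      ultimately have "eventually (\<lambda>y. False) (inf (nhds l) (filtermap f U))"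
        unfolding eventually_inf by (metis (no_types, lifting))
      then show False using l by (simp add: trivial_limit_def)
    qed
  qed
  then show thesis using that by blast
qed

text \<open>The indices are subsets of \<open>'a\<close>; almost all of them are finite and contain
  any given element. A family that meets, at the index \<open>S\<close>, the finitely many
  conditions listed in \<open>S\<close> therefore meets every single condition almost
  everywhere.\<close>

definition index_ultrafilter :: "'a set filter" where
  "index_ultrafilter = (SOME U. ultrafilter U \<and> U \<le> finite_subsets_at_top UNIV)"

lemma index_ultrafilter:
  "ultrafilter (index_ultrafilter :: 'a set filter)"
  "(index_ultrafilter :: 'a set filter) \<le> finite_subsets_at_top UNIV"
proof -
  have "\<exists>U. ultrafilter U \<and> U \<le> (finite_subsets_at_top UNIV :: 'a set filter)"
    by (rule ultrafilter_exists[OF finite_subsets_at_top_neq_bot]) blast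
  from someI_ex[OF this] show "ultrafilter (index_ultrafilter :: 'a set filter)"
    "(index_ultrafilter :: 'a set filter) \<le> finite_subsets_at_top UNIV"
    unfolding index_ultrafilter_def by auto
qed

lemma eventually_mem_index_ultrafilter: "eventually (\<lambda>S. a \<in> S) index_ultrafilter"
  by (rule filter_leD[OF index_ultrafilter(2)])
    (auto simp: eventually_finite_subsets_at_top intro!: exI[of _ "{a}"])

lemma eventually_finite_index_ultrafilter: "eventually finite index_ultrafilter"
  by (rule filter_leD[OF index_ultrafilter(2)]) (auto simp: eventually_finite_subsets_at_top)

quotient_type 'a ultrapower = "'a set \<Rightarrow> complex" / "\<lambda>f g. eventually (\<lambda>S. f S = g S) index_ultrafilter"
  morphisms rep_ultrapower ultra_class
proof (rule equivpI)
  show "transp (\<lambda>f g. eventually (\<lambda>S. f S = g S) (index_ultrafilter :: 'a set filter))"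
    by (rule transpI) (erule (1) eventually_elim2, simp)
qed (auto intro!: reflpI sympI simp: eq_commute)

lemma ultra_class_eq_iff: "ultra_class f = ultra_class g \<longleftrightarrow> eventually (\<lambda>S. f S = g S) index_ultrafilter"
  by (simp add: ultrapower.abs_eq_iff)

lemma ultra_class_surj: obtains f where "x = ultra_class f"
  using Quotient3_abs_rep[OF Quotient3_ultrapower, of x] by metis

instantiation ultrapower :: (type) field
begin

lift_definition zero_ultrapower :: "'a ultrapower" is "\<lambda>_. 0" .
lift_definition one_ultrapower :: "'a ultrapower" is "\<lambda>_. 1" .
lift_definition plus_ultrapower :: "'a ultrapower \<Rightarrow> 'a ultrapower \<Rightarrow> 'a ultrapower" is "\<lambda>f g S. f S + g S"
  by (erule (1) eventually_elim2) simp
lift_definition times_ultrapower :: "'a ultrapower \<Rightarrow> 'a ultrapower \<Rightarrow> 'a ultrapower" is "\<lambda>f g S. f S * g S"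
  by (erule (1) eventually_elim2) simp
lift_definition minus_ultrapower :: "'a ultrapower \<Rightarrow> 'a ultrapower \<Rightarrow> 'a ultrapower" is "\<lambda>f g S. f S - g S"
  by (erule (1) eventually_elim2) simp
lift_definition uminus_ultrapower :: "'a ultrapower \<Rightarrow> 'a ultrapower" is "\<lambda>f S. - f S"
  by (erule eventually_mono) simp
lift_definition inverse_ultrapower :: "'a ultrapower \<Rightarrow> 'a ultrapower" is "\<lambda>f S. inverse (f S)"
  by (erule eventually_mono) simp
lift_definition divide_ultrapower :: "'a ultrapower \<Rightarrow> 'a ultrapower \<Rightarrow> 'a ultrapower" is "\<lambda>f g S. f S / g S"
  by (erule (1) eventually_elim2) simp

instance
proof
  note ops = zero_ultrapower.abs_eq one_ultrapower.abs_eq plus_ultrapower.abs_eq times_ultrapower.abs_eq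
    minus_ultrapower.abs_eq uminus_ultrapower.abs_eq inverse_ultrapower.abs_eq divide_ultrapower.abs_eq
  fix a b c :: "'a ultrapower"
  obtain f where f: "a = ultra_class f" by (rule ultra_class_surj)
  obtain g where g: "b = ultra_class g" by (rule ultra_class_surj)
  obtain h where h: "c = ultra_class h" by (rule ultra_class_surj)
  show "a + b + c = a + (b + c)" by (simp add: f g h ops algebra_simps divide_inverse)
  show "a + b = b + a" by (simp add: f g h ops algebra_simps divide_inverse)
  show "0 + a = a" by (simp add: f g h ops algebra_simps divide_inverse)
  show "- a + a = 0" by (simp add: f g h ops algebra_simps divide_inverse)
  show "a - b = a + - b" by (simp add: f g h ops algebra_simps divide_inverse)
  show "a * b * c = a * (b * c)" by (simp add: f g h ops algebra_simps divide_inverse)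
  show "a * b = b * a" by (simp add: f g h ops algebra_simps divide_inverse)
  show "1 * a = a" by (simp add: f g h ops algebra_simps divide_inverse)
  show "(a + b) * c = a * c + b * c" by (simp add: f g h ops algebra_simps divide_inverse)
  show "a div b = a * inverse b" by (simp add: f g h ops algebra_simps divide_inverse)
  show "inverse (0::'a ultrapower) = 0" by (simp add: f g h ops algebra_simps divide_inverse)
  show "(0::'a ultrapower) \<noteq> 1"
    using index_ultrafilter(1)[where 'a = 'a] by (simp add: ops ultra_class_eq_iff ultrafilter_def trivial_limit_def)
  assume "a \<noteq> 0"
  then have "eventually (\<lambda>S. f S \<noteq> 0) index_ultrafilter"
    using ultrafilter_not_eventually[OF index_ultrafilter(1)[where 'a = 'a]] by (simp add: f ops ultra_class_eq_iff)
  then have "eventually (\<lambda>S. inverse (f S) * f S = 1) index_ultrafilter"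
    by (rule eventually_mono) simp
  then show "inverse a * a = 1" by (simp add: f ops ultra_class_eq_iff)
qed

end

lemma ultra_class_eq_0_iff: "ultra_class f = 0 \<longleftrightarrow> eventually (\<lambda>S. f S = 0) index_ultrafilter"
  by (simp add: zero_ultrapower.abs_eq ultra_class_eq_iff)

lemma ultra_class_ops:
  "ultra_class f + ultra_class g = ultra_class (\<lambda>S. f S + g S)"
  "ultra_class f * ultra_class g = ultra_class (\<lambda>S. f S * g S)"
  "ultra_class f - ultra_class g = ultra_class (\<lambda>S. f S - g S)"
  "inverse (ultra_class f) = ultra_class (\<lambda>S. inverse (f S))"
  by (simp_all add: plus_ultrapower.abs_eq times_ultrapower.abs_eq minus_ultrapower.abs_eq inverse_ultrapower.abs_eq)

lemma ultra_class_0: "0 = ultra_class (\<lambda>_. 0)" and ultra_class_1: "1 = ultra_class (\<lambda>_. 1)"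
  by (simp_all add: zero_ultrapower.abs_eq one_ultrapower.abs_eq)

lemma ultra_class_sum: "(\<Sum>i\<in>A. ultra_class (f i)) = ultra_class (\<lambda>S. \<Sum>i\<in>A. f i S)"
  by (induction A rule: infinite_finite_induct) (simp_all add: ultra_class_0 ultra_class_ops)

lemma ultra_class_power: "ultra_class f ^ n = ultra_class (\<lambda>S. f S ^ n)"
  by (induction n) (simp_all add: ultra_class_1 ultra_class_ops)

instance ultrapower :: (type) alg_closed_field
proof (rule alg_closedI)
  fix p :: "'a ultrapower poly"
  assume p: "degree p > 0" "lead_coeff p = 1"
  let ?n = "degree p"
  have "\<forall>i. \<exists>f. coeff p i = ultra_class f" using ultra_class_surj by metis
  then obtain r where r: "\<And>i. coeff p i = ultra_class (r i)" by metis
  \<comment> \<open>The polynomial is made monic of degree \<open>?n\<close> at every index, so that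
    a root can be chosen everywhere and not only almost everywhere.\<close>
  define q where "q S = (\<Sum>i<?n. monom (r i S) i) + monom 1 ?n" for S
  have cq: "coeff (q S) i = (if i < ?n then r i S else if i = ?n then 1 else 0)" for S i
    by (auto simp: q_def coeff_sum)
  have "?n \<le> degree (q S)" for S by (rule le_degree) (simp add: cq)
  then have "\<exists>x. poly (q S) x = 0" for S using p(1) by (intro alg_closed_imp_poly_has_root) (metis less_le_trans)
  then obtain x where x: "\<And>S. poly (q S) (x S) = 0" by metis
  have "poly p (ultra_class x) = (\<Sum>i<?n. ultra_class (\<lambda>S. r i S * x S ^ i)) + ultra_class (\<lambda>S. x S ^ ?n)"
    unfolding poly_altdef lessThan_Suc_atMost[symmetric]
    using p(2) by (simp add: r[symmetric]) (simp add: r ultra_class_power ultra_class_ops)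
  also have "\<dots> = ultra_class (\<lambda>S. poly (q S) (x S))"
    by (simp add: ultra_class_sum ultra_class_ops q_def poly_sum poly_monom)
  also have "\<dots> = 0" by (simp add: x ultra_class_0)
  finally show "\<exists>x. poly p x = 0" by blast
qed

definition standard_part :: "('a ultrapower \<times> complex) set" where
  "standard_part = {(ultra_class f, l) | f l. (f \<longlongrightarrow> l) index_ultrafilter}"

lemma standard_partD: "(ultra_class f, l) \<in> standard_part \<Longrightarrow> (f \<longlongrightarrow> l) index_ultrafilter"
  unfolding standard_part_def
proof -
  assume "(ultra_class f, l) \<in> {(ultra_class f, l) | f l. (f \<longlongrightarrow> l) index_ultrafilter}"
  then obtain g where "eventually (\<lambda>S. g S = f S) index_ultrafilter" "(g \<longlongrightarrow> l) index_ultrafilter"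
    by (auto simp: ultra_class_eq_iff eq_commute)
  then show ?thesis by (simp add: tendsto_cong)
qed

text \<open>A bounded family converges along the ultrafilter by compactness; for any other family
  the ultrafilter makes the norms exceed every bound, and the inverses tend to 0.\<close>

lemma place_standard_part: "place (standard_part :: ('a ultrapower \<times> complex) set)"
proof -
  let ?U = "index_ultrafilter :: 'a set filter"
  have U: "ultrafilter ?U" by (rule index_ultrafilter)
  then have nb: "?U \<noteq> bot" by (simp add: ultrafilter_def)
  have "hom_graph (standard_part :: ('a ultrapower \<times> complex) set)"
    unfolding hom_graph_def
  proof (intro conjI allI impI)
    show "(1, 1) \<in> (standard_part :: ('a ultrapower \<times> complex) set)"
      unfolding standard_part_def using tendsto_const ultra_class_1 by blast
  next
    fix a c :: "'a ultrapower" and b d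
    assume "(a, b) \<in> standard_part" "(c, d) \<in> standard_part"
    then obtain f g where "a = ultra_class f" "(f \<longlongrightarrow> b) ?U" "c = ultra_class g" "(g \<longlongrightarrow> d) ?U"
      unfolding standard_part_def by blast
    then show "(a - c, b - d) \<in> standard_part" "(a * c, b * d) \<in> standard_part"
      unfolding standard_part_def by (auto simp: ultra_class_ops intro!: tendsto_intros exI)
  next
    fix b assume "(0::'a ultrapower, b) \<in> standard_part"
    then have "((\<lambda>_. 0) \<longlongrightarrow> b) ?U" using standard_partD unfolding ultra_class_0 by blast
    then show "b = 0" using nb by (metis tendsto_const tendsto_unique)
  qed
  moreover have "(\<exists>a. (x, a) \<in> standard_part) \<or> (inverse x, 0) \<in> standard_part" for x :: "'a ultrapower"
  proof -
    obtain f where f: "x = ultra_class f" by (rule ultra_class_surj)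
    show ?thesis
    proof (cases "\<exists>B. eventually (\<lambda>S. norm (f S) \<le> B) ?U")
      case True
      then obtain B where "eventually (\<lambda>S. f S \<in> cball 0 B) ?U" by auto
      then obtain l where "(f \<longlongrightarrow> l) ?U" by (rule ultrafilter_bounded_convergent[OF U bounded_cball])
      then show ?thesis unfolding standard_part_def f by blast
    next
      case False
      have "eventually (\<lambda>S. B \<le> norm (f S)) ?U" for B
      proof -
        have "eventually (\<lambda>S. \<not> norm (f S) \<le> B) ?U" using False ultrafilter_not_eventually[OF U] by blast
        then show ?thesis by (rule eventually_mono) simp
      qed
      then have "filterlim f at_infinity ?U"
        unfolding filterlim_at_infinity[OF order_refl] by blast
      then have "((\<lambda>S. inverse (f S)) \<longlongrightarrow> 0) ?U" by (rule filterlim_compose[OF tendsto_inverse_0])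
      then show ?thesis unfolding standard_part_def f ultra_class_ops by blast
    qed
  qed
  ultimately show ?thesis unfolding place_def by blast
qed

section \<open>Evaluation of Laurent polynomials and lattice coordinates\<close>

text \<open>\<open>\<iota>\<close> maps the coefficients and \<open>\<xi>\<close> is an arbitrary
  function on exponents. This covers evaluation at a point, evaluation of the part of a given
  weight, and sums of real powers of t.\<close>

definition poly_eval :: "('c::zero \<Rightarrow> 'k::comm_ring_1) \<Rightarrow> ('m \<Rightarrow> 'k) \<Rightarrow> ('m \<Rightarrow>\<^sub>0 'c) \<Rightarrow> 'k" where
  "poly_eval \<iota> \<xi> f = (\<Sum>m\<in>Poly_Mapping.keys f. \<iota> (Poly_Mapping.lookup f m) * \<xi> m)"

lemma poly_eval_superset:
  assumes "finite A" "Poly_Mapping.keys f \<subseteq> A" "\<iota> 0 = 0"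
  shows "poly_eval \<iota> \<xi> f = (\<Sum>m\<in>A. \<iota> (Poly_Mapping.lookup f m) * \<xi> m)"
  unfolding poly_eval_def using assms
  by (intro sum.mono_neutral_left) (auto simp: in_keys_iff)

lemma poly_eval_add:
  assumes \<iota>: "\<And>a b. \<iota> (a + b) = \<iota> a + \<iota> b"
  shows "poly_eval \<iota> \<xi> (f + g) = poly_eval \<iota> \<xi> f + poly_eval \<iota> \<xi> (g :: 'm \<Rightarrow>\<^sub>0 'c::ab_group_add)"
proof -
  have 0: "\<iota> 0 = 0" using \<iota>[of 0 0] by simp
  let ?A = "Poly_Mapping.keys f \<union> Poly_Mapping.keys g"
  have A: "finite ?A" "Poly_Mapping.keys (f + g) \<subseteq> ?A" by (auto simp: keys_add)
  show ?thesis
    by (simp add: poly_eval_superset[where \<iota> = \<iota>, OF A(1) A(2) 0] poly_eval_superset[where \<iota> = \<iota>, OF A(1) _ 0]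
        lookup_add \<iota> distrib_right sum.distrib)
qed

lemma poly_eval_diff:
  assumes \<iota>: "\<And>a b. \<iota> (a + b) = \<iota> a + \<iota> b"
  shows "poly_eval \<iota> \<xi> (f - g) = poly_eval \<iota> \<xi> f - poly_eval \<iota> \<xi> (g :: 'm \<Rightarrow>\<^sub>0 'c::ab_group_add)"
  using poly_eval_add[where \<iota> = \<iota> and f = "f - g" and g = g and \<xi> = \<xi>, OF \<iota>] by simp

lemma lookup_single_mult:
  fixes f :: "'m::ab_group_add \<Rightarrow>\<^sub>0 'c::comm_ring_1"
  shows "Poly_Mapping.lookup (Poly_Mapping.single m c * f) k = c * Poly_Mapping.lookup f (k - m)"
proof -
  have "Poly_Mapping.lookup (Poly_Mapping.single m c * f) k = (\<Sum>l. (c when m = l) * (\<Sum>q. Poly_Mapping.lookup f q when k = l + q))"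
    by (simp add: lookup_mult lookup_single)
  also have "\<dots> = (\<Sum>l. c * (\<Sum>q. Poly_Mapping.lookup f q when k = l + q) when m = l)"
    by (simp add: when_mult)
  also have "\<dots> = c * (\<Sum>q. Poly_Mapping.lookup f q when k = m + q)" by simp
  also have "(\<Sum>q. Poly_Mapping.lookup f q when k = m + q) = (\<Sum>q. Poly_Mapping.lookup f q when k - m = q)"
    by (intro arg_cong[where f = Sum_any] ext when_cong) (auto simp: algebra_simps)
  finally show ?thesis by simp
qed

lemma keys_single_mult:
  fixes f :: "'m::ab_group_add \<Rightarrow>\<^sub>0 'c::idom"
  assumes "c \<noteq> 0"
  shows "Poly_Mapping.keys (Poly_Mapping.single m c * f) = (+) m ` Poly_Mapping.keys f"
proof -
  have "x \<in> (+) m ` Poly_Mapping.keys f \<longleftrightarrow> x - m \<in> Poly_Mapping.keys f" for x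
    by (auto simp: image_iff intro!: bexI[of _ "x - m"])
  then show ?thesis using assms by (auto simp: in_keys_iff lookup_single_mult)
qed

lemma poly_mapping_eq_sum_single:
  "f = (\<Sum>m\<in>Poly_Mapping.keys f. Poly_Mapping.single m (Poly_Mapping.lookup f m))"
proof (rule poly_mapping_eqI)
  fix k
  have "(\<Sum>m\<in>Poly_Mapping.keys f. Poly_Mapping.lookup f m when m = k) = (\<Sum>m\<in>Poly_Mapping.keys f. if m = k then Poly_Mapping.lookup f m else 0)"
    by (intro sum.cong) (auto simp: when_def)
  then show "Poly_Mapping.lookup f k = Poly_Mapping.lookup (\<Sum>m\<in>Poly_Mapping.keys f. Poly_Mapping.single m (Poly_Mapping.lookup f m)) k"
    by (simp add: lookup_sum lookup_single in_keys_iff)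
qed

lemma poly_eval_single_mult_on:
  fixes f :: "'m::ab_group_add \<Rightarrow>\<^sub>0 'c::idom"
  assumes \<iota>: "\<And>a b. \<iota> (a * b) = \<iota> a * \<iota> b" "\<iota> 0 = 0"
    and \<xi>: "\<And>k. k \<in> Poly_Mapping.keys f \<Longrightarrow> \<xi> (m + k) = \<xi> m * \<xi> k"
  shows "poly_eval \<iota> \<xi> (Poly_Mapping.single m c * f) = \<iota> c * \<xi> m * poly_eval \<iota> \<xi> f"
proof (cases "c = 0")
  case True
  then show ?thesis using \<iota>(2) by (simp add: poly_eval_def)
next
  case False
  have "poly_eval \<iota> \<xi> (Poly_Mapping.single m c * f) = (\<Sum>k\<in>Poly_Mapping.keys f. \<iota> (c * Poly_Mapping.lookup f k) * \<xi> (m + k))"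
    unfolding poly_eval_def keys_single_mult[OF False]
    by (subst sum.reindex) (auto simp: lookup_single_mult)
  then show ?thesis by (simp add: \<iota> \<xi> poly_eval_def sum_distrib_left mult_ac)
qed

text \<open>Multiplicativity is asked only between the two supports, since the functions that
  compute residues are multiplicative only on monomials of nonnegative order.\<close>

lemma poly_eval_mult_on:
  fixes f g :: "'m::ab_group_add \<Rightarrow>\<^sub>0 'c::idom"
  assumes \<iota>: "\<And>a b. \<iota> (a + b) = \<iota> a + \<iota> b" "\<And>a b. \<iota> (a * b) = \<iota> a * \<iota> b"
    and \<xi>: "\<And>a b. a \<in> Poly_Mapping.keys f \<Longrightarrow> b \<in> Poly_Mapping.keys g \<Longrightarrow> \<xi> (a + b) = \<xi> a * \<xi> b"
  shows "poly_eval \<iota> \<xi> (f * g) = poly_eval \<iota> \<xi> f * poly_eval \<iota> \<xi> g"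
proof -
  have 0: "\<iota> 0 = 0" using \<iota>(1)[of 0 0] by simp
  have *: "poly_eval \<iota> \<xi> ((\<Sum>m\<in>A. Poly_Mapping.single m (Poly_Mapping.lookup f m)) * g) =
    (\<Sum>m\<in>A. \<iota> (Poly_Mapping.lookup f m) * \<xi> m) * poly_eval \<iota> \<xi> g" if "finite A" "A \<subseteq> Poly_Mapping.keys f" for A
    using that
  proof (induction A rule: finite_induct)
    case empty
    then show ?case by (simp add: poly_eval_def)
  next
    case (insert a A)
    then have "poly_eval \<iota> \<xi> (Poly_Mapping.single a (Poly_Mapping.lookup f a) * g) =
        \<iota> (Poly_Mapping.lookup f a) * \<xi> a * poly_eval \<iota> \<xi> g"
      by (intro poly_eval_single_mult_on \<iota>(2) 0 \<xi>) auto
    then show ?case using insert by (simp add: distrib_right poly_eval_add[where \<iota> = \<iota>, OF \<iota>(1)])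
  qed
  show ?thesis
    using *[OF finite_keys order_refl] unfolding poly_mapping_eq_sum_single[of f, symmetric] by (simp add: poly_eval_def)
qed

lemma poly_eval_single: "\<iota> 0 = 0 \<Longrightarrow> poly_eval \<iota> \<xi> (Poly_Mapping.single m c) = \<iota> c * \<xi> m"
  by (simp add: poly_eval_def)

section \<open>Laurent polynomials and their parts of a given weight\<close>

lemma laurent_eval_eq_poly_eval: "laurent_eval f x = poly_eval (\<lambda>a. a) x f"
  by (simp add: laurent_eval_def poly_eval_def)

lemma laurent_eval_0: "laurent_eval 0 x = 0"
  by (simp add: laurent_eval_def)

lemma laurent_eval_add: "laurent_eval (f + g) x = laurent_eval f x + laurent_eval g x"
  unfolding laurent_eval_eq_poly_eval by (rule poly_eval_add) simp

lemma laurent_eval_diff: "laurent_eval (f - g) x = laurent_eval f x - laurent_eval g x"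
  unfolding laurent_eval_eq_poly_eval by (rule poly_eval_diff) simp

lemma laurent_eval_mult:
  assumes "x \<in> T_N"
  shows "laurent_eval (f * g) x = laurent_eval f x * laurent_eval g x"
  unfolding laurent_eval_eq_poly_eval by (rule poly_eval_mult_on) (use assms in \<open>auto simp: T_N_def\<close>)

text \<open>The value at \<open>y\<close> of the part of weight \<open>W\<close>. In contrast to the
  initial form it is additive in \<open>f\<close>, because \<open>W\<close> is fixed in
  advance.\<close>

definition partial_eval :: "('m \<Rightarrow> real) \<Rightarrow> real \<Rightarrow> ('m \<Rightarrow> complex) \<Rightarrow> ('m::ab_group_add \<Rightarrow>\<^sub>0 complex) \<Rightarrow> complex" where
  "partial_eval w W y f = poly_eval (\<lambda>a. a) (\<lambda>m. if w m = W then y m else 0) f"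

lemma partial_eval_diff: "partial_eval w W y (f - g) = partial_eval w W y f - partial_eval w W y g"
  unfolding partial_eval_def by (rule poly_eval_diff) simp

lemma partial_eval_single_mult:
  assumes "Modules.additive w" "\<And>a b. y (a + b) = y a * y b"
  shows "partial_eval w W y (Poly_Mapping.single m c * f) = c * y m * partial_eval w (W - w m) y f"
proof (cases "c = 0")
  case True
  then show ?thesis by (simp add: partial_eval_def poly_eval_def)
next
  case False
  have "partial_eval w W y (Poly_Mapping.single m c * f) =
      (\<Sum>k\<in>Poly_Mapping.keys f. c * Poly_Mapping.lookup f k * (if w (m + k) = W then y (m + k) else 0))"
    unfolding partial_eval_def poly_eval_def keys_single_mult[OF False]
    by (subst sum.reindex) (auto simp: lookup_single_mult)
  also have "\<dots> = (\<Sum>k\<in>Poly_Mapping.keys f. c * y m * (Poly_Mapping.lookup f k * (if w k = W - w m then y k else 0)))"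
    by (intro sum.cong) (auto simp: assms additive.add[OF assms(1)])
  finally show ?thesis by (simp add: partial_eval_def poly_eval_def sum_distrib_left)
qed

lemma partial_eval_eq_0:
  assumes "\<And>k. k \<in> Poly_Mapping.keys f \<Longrightarrow> w k > W"
  shows "partial_eval w W y f = 0"
  unfolding partial_eval_def poly_eval_def using assms by (intro sum.neutral) force

lemma initial_form_eval:
  "laurent_eval (initial_form w f) y = partial_eval w (weight w f) y f"
proof -
  let ?A = "{m \<in> Poly_Mapping.keys f. w m = weight w f}"
  have l: "Poly_Mapping.lookup (initial_form w f) k = (if k \<in> ?A then Poly_Mapping.lookup f k else 0)" for k
  proof -
    have "(\<Sum>m\<in>?A. Poly_Mapping.lookup f m when m = k) = (\<Sum>m\<in>?A. if m = k then Poly_Mapping.lookup f m else 0)"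
      by (intro sum.cong) (auto simp: when_def)
    then show ?thesis
      unfolding initial_form_def by (simp add: lookup_sum lookup_single)
  qed
  have "Poly_Mapping.keys (initial_form w f) \<subseteq> Poly_Mapping.keys f"
    by (auto simp: in_keys_iff l split: if_splits)
  then have "laurent_eval (initial_form w f) y = (\<Sum>m\<in>Poly_Mapping.keys f. Poly_Mapping.lookup (initial_form w f) m * y m)"
    unfolding laurent_eval_eq_poly_eval by (subst poly_eval_superset) auto
  also have "\<dots> = partial_eval w (weight w f) y f"
    unfolding partial_eval_def poly_eval_def by (intro sum.cong) (auto simp: l)
  finally show ?thesis .
qed

lemma mem_initial_locus_iff:
  "y \<in> initial_locus w X \<longleftrightarrow> y \<in> T_N \<and>
     (\<forall>f\<in>vanishing_ideal X. f \<noteq> 0 \<longrightarrow> partial_eval w (weight w f) y f = 0)"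
proof -
  let ?S = "{initial_form w f | f. f \<in> vanishing_ideal X \<and> f \<noteq> 0}"
  have "(\<forall>h\<in>is_ideal hull ?S. laurent_eval h y = 0) \<longleftrightarrow> (\<forall>h\<in>?S. laurent_eval h y = 0)" if y: "y \<in> T_N"
  proof
    assume *: "\<forall>h\<in>?S. laurent_eval h y = 0"
    have "is_ideal {h. laurent_eval h y = 0}"
      unfolding is_ideal_def by (simp add: laurent_eval_0 laurent_eval_add laurent_eval_mult[OF y])
    then have "is_ideal hull ?S \<subseteq> {h. laurent_eval h y = 0}" using * by (intro hull_minimal) auto
    then show "\<forall>h\<in>is_ideal hull ?S. laurent_eval h y = 0" by blast
  next
    assume "\<forall>h\<in>is_ideal hull ?S. laurent_eval h y = 0"
    then show "\<forall>h\<in>?S. laurent_eval h y = 0" using hull_subset[of ?S is_ideal] by blast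
  qed
  then have "y \<in> initial_locus w X \<longleftrightarrow> y \<in> T_N \<and> (\<forall>h\<in>?S. laurent_eval h y = 0)"
    unfolding initial_locus_def zero_locus_def initial_ideal_def by blast
  then show ?thesis by (auto simp: initial_form_eval)
qed

section \<open>Coordinates on a lattice of finite rank\<close>

locale free_lattice =
  fixes \<phi> :: "'m::ab_group_add \<Rightarrow> (nat \<Rightarrow>\<^sub>0 int)" and n :: nat
  assumes additive: "Modules.additive \<phi>" and bij: "bij_betw \<phi> UNIV {c. Poly_Mapping.keys c \<subseteq> {..<n}}"
begin

definition basis :: "nat \<Rightarrow> 'm" where
  "basis j = inv \<phi> (Poly_Mapping.single j 1)"

definition coord :: "'m \<Rightarrow> nat \<Rightarrow> int" where
  "coord m j = Poly_Mapping.lookup (\<phi> m) j"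

lemmas phi_simps = additive.add[OF additive] additive.diff[OF additive] additive.zero[OF additive] additive.minus[OF additive]

lemma phi_inj: "\<phi> a = \<phi> b \<longleftrightarrow> a = b"
  using bij by (auto simp: bij_betw_def inj_eq)

lemma phi_inv: "Poly_Mapping.keys c \<subseteq> {..<n} \<Longrightarrow> \<phi> (inv \<phi> c) = c"
  using bij by (intro f_inv_into_f) (auto simp: bij_betw_def)

lemma phi_keys: "Poly_Mapping.keys (\<phi> m) \<subseteq> {..<n}"
  using bij by (auto simp: bij_betw_def)

lemma coord_simps [simp]: "coord (a + b) j = coord a j + coord b j" "coord (a - b) j = coord a j - coord b j"
  "coord 0 j = 0" "coord (- a) j = - coord a j"
  by (simp_all add: coord_def phi_simps lookup_add lookup_minus)

lemma coord_ge [simp]: "j \<ge> n \<Longrightarrow> coord m j = 0"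
  using phi_keys[of m] by (force simp: coord_def in_keys_iff)

lemma coord_eqI: "(\<And>j. j < n \<Longrightarrow> coord a j = coord b j) \<Longrightarrow> a = b"
  unfolding phi_inj[symmetric]
  by (rule poly_mapping_eqI) (metis coord_def coord_ge not_le)

lemma coord_basis: "i < n \<Longrightarrow> coord (basis i) j = (if i = j then 1 else 0)"
  unfolding coord_def basis_def by (subst phi_inv) (auto simp: lookup_single when_def)

text \<open>Serves as an induction principle: an identity that is stable under differences has to be
  checked only on the basis.\<close>

lemma subgroup_eq_UNIV:
  assumes "0 \<in> K" "\<And>a b. a \<in> K \<Longrightarrow> b \<in> K \<Longrightarrow> a - b \<in> K" "\<And>j. j < n \<Longrightarrow> basis j \<in> K"
  shows "m \<in> K"
proof -
  have neg: "- a \<in> K" if "a \<in> K" for a using assms(2)[OF assms(1) that] by simp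
  have add: "a + b \<in> K" if "a \<in> K" "b \<in> K" for a b using assms(2)[OF that(1) neg[OF that(2)]] by simp
  define z where "z j k = inv \<phi> (Poly_Mapping.single j k)" for j k
  have coord_z: "coord (z j k) i = (if i = j then k else 0)" if "j < n" for i j k
    unfolding coord_def z_def using that by (subst phi_inv) (auto simp: lookup_single when_def)
  have z: "z j k \<in> K" if j: "j < n" for j k
  proof (induction k rule: int_induct[where k = 0])
    case base
    have "z j 0 = 0" by (rule coord_eqI) (simp add: coord_z[OF j])
    then show ?case using assms(1) by simp
  next
    case (step1 i)
    have "z j (i + 1) = z j i + basis j" by (rule coord_eqI) (simp add: coord_z[OF j] coord_basis[OF j])
    then show ?case using add step1 assms(3)[OF j] by simp
  next
    case (step2 i)
    have "z j (i - 1) = z j i - basis j" by (rule coord_eqI) (simp add: coord_z[OF j] coord_basis[OF j])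
    then show ?case using assms(2) step2 assms(3)[OF j] by simp
  qed
  have *: "(\<forall>j. j \<notin> J \<longrightarrow> coord m j = 0) \<longrightarrow> m \<in> K" if "finite J" "J \<subseteq> {..<n}" for J m
    using that
  proof (induction J arbitrary: m rule: finite_induct)
    case empty
    show ?case
    proof
      assume "\<forall>j. j \<notin> {} \<longrightarrow> coord m j = 0"
      then have "m = 0" by (intro coord_eqI) simp
      then show "m \<in> K" using assms(1) by simp
    qed
  next
    case (insert i J)
    show ?case
    proof
      assume *: "\<forall>j. j \<notin> insert i J \<longrightarrow> coord m j = 0"
      have i: "i < n" using insert by simp
      have "m - z i (coord m i) \<in> K"
      proof (rule insert.IH[rule_format])
        show "J \<subseteq> {..<n}" using insert.prems by simp
        show "coord (m - z i (coord m i)) j = 0" if "j \<notin> J" for j using * that by (auto simp: coord_z[OF i])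
      qed
      from add[OF this z[OF i, of "coord m i"]] show "m \<in> K" by simp
    qed
  qed
  show ?thesis by (rule *[of "{..<n}", THEN mp]) auto
qed

lemma additive_expand:
  assumes w: "Modules.additive (w :: 'm \<Rightarrow> real)"
  shows "w m = (\<Sum>j<n. of_int (coord m j) * w (basis j))"
proof -
  have "m \<in> {m. w m = (\<Sum>j<n. of_int (coord m j) * w (basis j))}"
  proof (rule subgroup_eq_UNIV)
    fix i assume "i < n"
    have "(\<Sum>j<n. of_int (coord (basis i) j) * w (basis j)) = (\<Sum>j<n. if j = i then w (basis j) else 0)"
      by (intro sum.cong) (auto simp: coord_basis[OF \<open>i < n\<close>])
    then show "basis i \<in> {m. w m = (\<Sum>j<n. of_int (coord m j) * w (basis j))}" using \<open>i < n\<close> by simp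
  qed (auto simp: additive.zero[OF w] additive.diff[OF w] left_diff_distrib sum_subtractf)
  then show ?thesis by blast
qed

lemma T_N_expand:
  assumes x: "x \<in> T_N"
  shows "x m = (\<Prod>j<n. x (basis j) powi coord m j)"
proof -
  have nz: "x a \<noteq> 0" and mult: "x (a + b) = x a * x b" and 1: "x 0 = 1" for a b using x by (auto simp: T_N_def)
  have diff: "x (a - b) = x a / x b" for a b using mult[of "a - b" b] nz by (simp add: field_simps)
  have "m \<in> {m. x m = (\<Prod>j<n. x (basis j) powi coord m j)}"
  proof (rule subgroup_eq_UNIV)
    fix i assume "i < n"
    have "(\<Prod>j<n. x (basis j) powi coord (basis i) j) = (\<Prod>j<n. if j = i then x (basis j) else 1)"
      by (intro prod.cong) (auto simp: coord_basis[OF \<open>i < n\<close>])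
    then show "basis i \<in> {m. x m = (\<Prod>j<n. x (basis j) powi coord m j)}" using \<open>i < n\<close> by simp
  qed (auto simp: 1 diff power_int_diff nz prod_dividef)
  then show ?thesis by blast
qed

text \<open>The l1-norm of the coordinate vector replaces the degree: it is subadditive, and only
  finitely many exponents have bounded degree.\<close>

definition mdeg :: "'m \<Rightarrow> nat" where
  "mdeg m = (\<Sum>j<n. nat \<bar>coord m j\<bar>)"

lemma mdeg_add_le: "mdeg (a + b) \<le> mdeg a + mdeg b"
  unfolding mdeg_def sum.distrib[symmetric] by (intro sum_mono) auto

lemma mdeg_0 [simp]: "mdeg 0 = 0"
  by (simp add: mdeg_def)

lemma finite_mdeg_le: "finite {m. mdeg m \<le> d}"
proof -
  let ?f = "\<lambda>m. restrict (coord m) {..<n}"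
  have "?f ` {m. mdeg m \<le> d} \<subseteq> PiE {..<n} (\<lambda>_. {- int d..int d})"
  proof
    fix f assume "f \<in> ?f ` {m. mdeg m \<le> d}"
    then obtain m where m: "f = ?f m" "mdeg m \<le> d" by auto
    have "coord m j \<in> {- int d..int d}" if "j < n" for j
    proof -
      have "nat \<bar>coord m j\<bar> \<le> mdeg m" unfolding mdeg_def using that by (intro member_le_sum) auto
      then have "\<bar>coord m j\<bar> \<le> int d" using m(2) by linarith
      then show ?thesis by (simp add: abs_le_iff)
    qed
    then show "f \<in> PiE {..<n} (\<lambda>_. {- int d..int d})" unfolding m(1) by (auto simp: PiE_iff)
  qed
  then have "finite (?f ` {m. mdeg m \<le> d})" by (rule finite_subset) (intro finite_PiE; simp)
  moreover have "inj_on ?f {m. mdeg m \<le> d}"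
    by (rule inj_onI, rule coord_eqI) (metis lessThan_iff restrict_apply')
  ultimately show ?thesis by (rule finite_imageD)
qed

end

section \<open>Graded Groebner bases\<close>

text \<open>Dickson's lemma for sequences: pass to a nondecreasing subsequence for one coordinate
  after the other.\<close>

lemma monotone_subsequence:
  fixes f :: "nat \<Rightarrow> 'c \<Rightarrow> nat"
  assumes "finite A"
  shows "\<exists>r :: nat \<Rightarrow> nat. strict_mono r \<and> (\<forall>c\<in>A. \<forall>i j. i \<le> j \<longrightarrow> f (r i) c \<le> f (r j) c)"
proof -
  have nat: "\<exists>s :: nat \<Rightarrow> nat. strict_mono s \<and> (\<forall>i j. i \<le> j \<longrightarrow> g (s i) \<le> g (s j))" for g :: "nat \<Rightarrow> nat"
  proof -
    have "\<exists>s. \<forall>k. (\<forall>m \<ge> s k. g (s k) \<le> g m) \<and> s k < s (Suc k)"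
    proof (rule dependent_nat_choice)
      show "\<exists>x. \<forall>m\<ge>x. g x \<le> g m"
        using ex_has_least_nat[of "\<lambda>_. True" 0 g] by blast
      fix x k :: nat assume "\<forall>m\<ge>x. g x \<le> g m"
      obtain y where "y > x" "\<And>m. m > x \<Longrightarrow> g y \<le> g m"
        using ex_has_least_nat[of "\<lambda>m. m > x" "Suc x" g] by blast
      then show "\<exists>y. (\<forall>m\<ge>y. g y \<le> g m) \<and> x < y" by (intro exI[of _ y]) auto
    qed
    then obtain s where s: "\<And>k m. m \<ge> s k \<Longrightarrow> g (s k) \<le> g m" "\<And>k. s k < s (Suc k)" by blast
    have sm: "strict_mono s" using s(2) by (simp add: strict_mono_Suc_iff)
    have mono: "g (s i) \<le> g (s j)" if "i \<le> j" for i j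
      using s(1)[of i "s j"] strict_mono_less_eq[OF sm, of i j] that by simp
    show ?thesis by (rule exI[of _ s]) (simp add: sm mono)
  qed
  show "\<exists>r :: nat \<Rightarrow> nat. strict_mono r \<and> (\<forall>c\<in>A. \<forall>i j. i \<le> j \<longrightarrow> f (r i) c \<le> f (r j) c)"
    using assms
  proof (induction A rule: finite_induct)
    case empty
    show ?case by (intro exI[of _ id]) (simp add: strict_mono_def)
  next
    case (insert a A)
    then obtain r :: "nat \<Rightarrow> nat" where r: "strict_mono r" "\<forall>c\<in>A. \<forall>i j. i \<le> j \<longrightarrow> f (r i) c \<le> f (r j) c" by blast
    obtain s :: "nat \<Rightarrow> nat" where s: "strict_mono s" "\<forall>i j. i \<le> j \<longrightarrow> f (r (s i)) a \<le> f (r (s j)) a"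
      using nat[of "\<lambda>i. f (r i) a"] by blast
    have "s i \<le> s j" if "i \<le> j" for i j using s(1) that by (simp add: strict_mono_less_eq)
    then have "\<forall>c\<in>insert a A. \<forall>i j. i \<le> j \<longrightarrow> f ((r \<circ> s) i) c \<le> f ((r \<circ> s) j) c"
      using r(2) s(2) by auto
    then show ?case using strict_mono_compose[OF r(1) s(1)] by (auto simp: comp_def)
  qed
qed

text \<open>\<open>P\<close> is the positive cone of a translation-invariant total order, in which a
  is below b if \<open>b - a \<in> P\<close>.\<close>

definition group_order :: "'m::ab_group_add set \<Rightarrow> bool" where
  "group_order P \<longleftrightarrow> 0 \<notin> P \<and> (\<forall>a\<in>P. \<forall>b\<in>P. a + b \<in> P) \<and> (\<forall>a. a \<noteq> 0 \<longrightarrow> a \<in> P \<or> - a \<in> P)"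

text \<open>The leading term is the smallest one, in accordance with the minimum that defines
  initial forms.\<close>

definition leading :: "'m::ab_group_add set \<Rightarrow> ('m \<Rightarrow>\<^sub>0 complex) \<Rightarrow> 'm \<Rightarrow> bool" where
  "leading P f a \<longleftrightarrow> a \<in> Poly_Mapping.keys f \<and> (\<forall>b\<in>Poly_Mapping.keys f. b \<noteq> a \<longrightarrow> b - a \<in> P)"

context
  fixes P :: "'m::ab_group_add set"
  assumes P: "group_order P"
begin

lemma group_order_add: "a \<in> P \<Longrightarrow> b \<in> P \<Longrightarrow> a + b \<in> P"
  using P by (simp add: group_order_def)

lemma group_order_total: "a \<noteq> b \<Longrightarrow> a - b \<in> P \<or> b - a \<in> P"
  using P minus_diff_eq[of a b] right_minus_eq[of a b] unfolding group_order_def by metis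

lemma group_order_trans: "a - b \<in> P \<Longrightarrow> b - c \<in> P \<Longrightarrow> a - c \<in> P"
  using group_order_add[of "a - b" "b - c"] by simp

lemma group_order_irrefl: "a - b \<in> P \<Longrightarrow> a \<noteq> b"
  using P by (auto simp: group_order_def)

lemma group_order_asym: "a - b \<in> P \<Longrightarrow> b - a \<notin> P"
  using group_order_trans[of a b a] group_order_irrefl[of a a] by blast

lemma group_order_min:
  assumes "finite A" "A \<noteq> {}"
  shows "\<exists>a\<in>A. \<forall>b\<in>A. b \<noteq> a \<longrightarrow> b - a \<in> P"
  using assms
proof (induction A rule: finite_ne_induct)
    case (insert x A)
    then obtain a where a: "a \<in> A" "\<forall>b\<in>A. b \<noteq> a \<longrightarrow> b - a \<in> P" by blast
    have "x \<noteq> a" using a insert by blast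
    then consider "x - a \<in> P" | "a - x \<in> P" using group_order_total by blast
    then show ?case
    proof cases
      case 1
      then show ?thesis using a by auto
    next
      case 2
      have "b - x \<in> P" if "b \<in> A" for b
        using 2 a(2) that group_order_trans[OF _ 2, of b] by (cases "b = a") auto
      then show ?thesis by auto
    qed
qed auto

lemma leading_exists:
  assumes "f \<noteq> 0"
  obtains a where "leading P f a"
proof -
  have "Poly_Mapping.keys f \<noteq> {}" using assms by (metis keys_zero poly_mapping_eqI in_keys_iff empty_iff lookup_zero)
  then obtain a where "a \<in> Poly_Mapping.keys f" "\<forall>b\<in>Poly_Mapping.keys f. b \<noteq> a \<longrightarrow> b - a \<in> P"
    using group_order_min[OF finite_keys] by blast
  then show thesis by (intro that[of a]) (simp add: leading_def)
qed

lemma leading_unique: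
  assumes "leading P f a" "leading P f b"
  shows "a = b"
proof (rule ccontr)
  assume "a \<noteq> b"
  with assms have "b - a \<in> P" "a - b \<in> P" by (auto simp: leading_def)
  then show False using group_order_asym by blast
qed

lemma leading_single_mult:
  assumes "c \<noteq> 0" "leading P f a"
  shows "leading P (Poly_Mapping.single m c * f) (m + a)"
  using assms unfolding leading_def keys_single_mult[OF assms(1)] by auto

lemma cancel_term:
  fixes f h :: "'m \<Rightarrow>\<^sub>0 complex"
  assumes "leading P h b"
  defines "f' \<equiv> f - Poly_Mapping.single 0 (Poly_Mapping.lookup f b / Poly_Mapping.lookup h b) * h"
  shows "b \<notin> Poly_Mapping.keys f'"
    "\<And>k. k \<in> Poly_Mapping.keys f' \<Longrightarrow> k \<in> Poly_Mapping.keys f \<or> (k \<in> Poly_Mapping.keys h \<and> k - b \<in> P)"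
    "\<And>k. k \<notin> Poly_Mapping.keys h \<Longrightarrow> Poly_Mapping.lookup f' k = Poly_Mapping.lookup f k"
proof -
  have l: "Poly_Mapping.lookup f' k = Poly_Mapping.lookup f k - Poly_Mapping.lookup f b / Poly_Mapping.lookup h b * Poly_Mapping.lookup h k" for k
    unfolding f'_def by (simp add: lookup_minus lookup_single_mult)
  show 1: "b \<notin> Poly_Mapping.keys f'" using assms(1) by (simp add: in_keys_iff l leading_def)
  show 3: "\<And>k. k \<notin> Poly_Mapping.keys h \<Longrightarrow> Poly_Mapping.lookup f' k = Poly_Mapping.lookup f k"
    by (simp add: l in_keys_iff)
  fix k assume k: "k \<in> Poly_Mapping.keys f'"
  show "k \<in> Poly_Mapping.keys f \<or> (k \<in> Poly_Mapping.keys h \<and> k - b \<in> P)"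
  proof (cases "k \<in> Poly_Mapping.keys h")
    case True
    moreover have "k \<noteq> b" using 1 k by blast
    ultimately show ?thesis using assms(1) by (auto simp: leading_def)
  next
    case False
    then show ?thesis using 3 k by (simp add: in_keys_iff)
  qed
qed

end

definition monomial_closed :: "('m::ab_group_add \<Rightarrow>\<^sub>0 complex) set \<Rightarrow> bool" where
  "monomial_closed I \<longleftrightarrow> (\<forall>f\<in>I. \<forall>g\<in>I. f - g \<in> I) \<and> (\<forall>f\<in>I. \<forall>m c. Poly_Mapping.single m c * f \<in> I)"

section \<open>Graded bases and reduction\<close>

context free_lattice
begin

definition bounded_by :: "nat \<Rightarrow> ('m \<Rightarrow>\<^sub>0 complex) \<Rightarrow> bool" where
  "bounded_by d f \<longleftrightarrow> (\<forall>m\<in>Poly_Mapping.keys f. mdeg m \<le> d)"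

text \<open>
  Leading terms are graded by the degree bound \<open>d\<close>: this replaces homogenization and makes all
  reductions take place in finite-dimensional spaces, although a group order is not a well-order.
\<close>
definition graded_basis :: "'m set \<Rightarrow> ('m \<Rightarrow>\<^sub>0 complex) set \<Rightarrow> (nat \<times> ('m \<Rightarrow>\<^sub>0 complex)) set \<Rightarrow> bool" where
  "graded_basis P I G \<longleftrightarrow> finite G \<and> (\<forall>(d, g)\<in>G. g \<in> I \<and> g \<noteq> 0 \<and> bounded_by d g) \<and>
     (\<forall>d f a. f \<in> I \<longrightarrow> bounded_by d f \<longrightarrow> leading P f a \<longrightarrow>
        (\<exists>(d', g)\<in>G. \<exists>b. leading P g b \<and> d' \<le> d \<and> mdeg (a - b) \<le> d - d'))"

text \<open>Dickson's lemma for pairs of a degree bound and an exponent, where divisibility means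
  that the quotient monomial fits into the remaining degree. A failure would produce an infinite
  sequence in which no member divides a later one, against monotone subsequences.\<close>

lemma finite_divisor_basis:
  assumes L: "\<And>d m. (d, m) \<in> L \<Longrightarrow> mdeg m \<le> d"
  shows "\<exists>B. finite B \<and> B \<subseteq> L \<and> (\<forall>p\<in>L. \<exists>q\<in>B. fst q \<le> fst p \<and> mdeg (snd p - snd q) \<le> fst p - fst q)"
proof (rule ccontr)
  define le where "le p q \<longleftrightarrow> fst p \<le> fst q \<and> mdeg (snd q - snd p) \<le> fst q - fst p" for p q :: "nat \<times> 'm"
  assume neg: "\<not> ?thesis"
  have ex: "\<exists>q\<in>L. \<forall>p\<in>B. \<not> le p q" if "finite B" "B \<subseteq> L" for B
  proof (rule ccontr)
    assume "\<not> ?thesis"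
    then have "\<forall>q\<in>L. \<exists>p\<in>B. le p q" by blast
    then have "finite B \<and> B \<subseteq> L \<and> (\<forall>p\<in>L. \<exists>q\<in>B. fst q \<le> fst p \<and> mdeg (snd p - snd q) \<le> fst p - fst q)"
      using that unfolding le_def by simp
    then show False using neg by (simp only: not_ex)
  qed
  have "\<exists>B. \<forall>k. (finite (B k) \<and> B k \<subseteq> L) \<and> (\<exists>q\<in>L. (\<forall>p\<in>B k. \<not> le p q) \<and> B (Suc k) = insert q (B k))"
  proof (rule dependent_nat_choice)
    fix B :: "(nat \<times> 'm) set" and k :: nat assume "finite B \<and> B \<subseteq> L"
    then obtain q where "q \<in> L" "\<forall>p\<in>B. \<not> le p q" using ex by blast
    then show "\<exists>B'. (finite B' \<and> B' \<subseteq> L) \<and> (\<exists>q\<in>L. (\<forall>p\<in>B. \<not> le p q) \<and> B' = insert q B)"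
      using \<open>finite B \<and> B \<subseteq> L\<close> by (intro exI[of _ "insert q B"]) auto
  qed auto
  then obtain B where B: "\<And>k. \<exists>q\<in>L. (\<forall>p\<in>B k. \<not> le p q) \<and> B (Suc k) = insert q (B k)" by blast
  then obtain q where q: "\<And>k. q k \<in> L" "\<And>k p. p \<in> B k \<Longrightarrow> \<not> le p (q k)" "\<And>k. B (Suc k) = insert (q k) (B k)" by metis
  have mono: "B i \<subseteq> B j" if "i \<le> j" for i j using that by (rule lift_Suc_mono_le[rotated]) (simp add: q(3) subset_insertI)
  have "q i \<in> B j" if "i < j" for i j using mono[of "Suc i" j] that q(3)[of i] by auto
  then have bad: "\<not> le (q i) (q j)" if "i < j" for i j using q(2) that by blast
  \<comment> \<open>The 2n + 1 coordinates are the positive parts, the negative parts and the slack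
    between bound and degree. If none of them decreases, signs do not cancel, and the degree of the
    difference is at most the difference of the degrees.\<close>
  define f where "f i c = (if c < n then nat (coord (snd (q i)) c) else if c < 2 * n then nat (- coord (snd (q i)) (c - n))
     else fst (q i) - mdeg (snd (q i)))" for i c
  obtain r :: "nat \<Rightarrow> nat" where r1: "strict_mono r" "\<forall>c\<in>{..2 * n}. \<forall>i j. i \<le> j \<longrightarrow> f (r i) c \<le> f (r j) c"
    using monotone_subsequence[of "{..2 * n}" f] by blast
  have r: "strict_mono r" "\<And>c i j. c \<in> {..2 * n} \<Longrightarrow> i \<le> j \<Longrightarrow> f (r i) c \<le> f (r j) c"
    using r1 by simp_all
  let ?p = "q (r 0)" and ?q = "q (r 1)"
  have slack: "fst ?p - mdeg (snd ?p) \<le> fst ?q - mdeg (snd ?q)" using r(2)[of "2 * n" 0 1] by (simp add: f_def)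
  have bd: "mdeg (snd ?p) \<le> fst ?p" "mdeg (snd ?q) \<le> fst ?q" using L q(1) by (metis prod.collapse)+
  have c: "nat \<bar>coord (snd ?q - snd ?p) j\<bar> + nat \<bar>coord (snd ?p) j\<bar> \<le> nat \<bar>coord (snd ?q) j\<bar>" if "j < n" for j
  proof -
    have 1: "nat (coord (snd ?p) j) \<le> nat (coord (snd ?q) j)"
      using r(2)[of j 0 1] that by (simp add: f_def)
    have 2: "nat (- coord (snd ?p) j) \<le> nat (- coord (snd ?q) j)"
      using r(2)[of "n + j" 0 1] that by (simp add: f_def)
    show ?thesis using 1 2 by simp linarith
  qed
  have "mdeg (snd ?q - snd ?p) + mdeg (snd ?p) \<le> mdeg (snd ?q)"
    unfolding mdeg_def sum.distrib[symmetric] using c by (intro sum_mono) auto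
  then have "le ?p ?q" unfolding le_def using slack bd by linarith
  moreover have "r 0 < r 1" using r(1) by (simp add: strict_mono_less)
  ultimately show False using bad by blast
qed

lemma graded_basis_exists:
  assumes P: "group_order P" and I: "monomial_closed I"
  obtains G where "graded_basis P I G"
proof -
  define L where "L = {(d, a). \<exists>f\<in>I. bounded_by d f \<and> leading P f a}"
  have L: "mdeg m \<le> d" if "(d, m) \<in> L" for d m
    using that by (auto simp: L_def bounded_by_def leading_def)
  have "\<exists>B. finite B \<and> B \<subseteq> L \<and> (\<forall>p\<in>L. \<exists>q\<in>B. fst q \<le> fst p \<and> mdeg (snd p - snd q) \<le> fst p - fst q)"
    by (rule finite_divisor_basis[OF L])
  then obtain B where B: "finite B" "B \<subseteq> L" "\<forall>p\<in>L. \<exists>q\<in>B. fst q \<le> fst p \<and> mdeg (snd p - snd q) \<le> fst p - fst q"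
    by blast
  have "\<forall>p\<in>B. \<exists>f. f \<in> I \<and> bounded_by (fst p) f \<and> leading P f (snd p)"
  proof
    fix p assume "p \<in> B"
    then have "p \<in> L" using B(2) by blast
    then show "\<exists>f. f \<in> I \<and> bounded_by (fst p) f \<and> leading P f (snd p)" unfolding L_def by (cases p) auto
  qed
  from bchoice[OF this] obtain h where h: "\<And>p. p \<in> B \<Longrightarrow> h p \<in> I" "\<And>p. p \<in> B \<Longrightarrow> bounded_by (fst p) (h p)"
    "\<And>p. p \<in> B \<Longrightarrow> leading P (h p) (snd p)" by blast
  have "graded_basis P I ((\<lambda>p. (fst p, h p)) ` B)"
    unfolding graded_basis_def
  proof (intro conjI allI impI)
    show "finite ((\<lambda>p. (fst p, h p)) ` B)" using B(1) by simp
    have "h p \<noteq> 0" if "p \<in> B" for p using h(3)[OF that] by (auto simp: leading_def)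
    then show "\<forall>(d, g)\<in>(\<lambda>p. (fst p, h p)) ` B. g \<in> I \<and> g \<noteq> 0 \<and> bounded_by d g" using h by auto
    fix d f a assume "f \<in> I" "bounded_by d f" "leading P f a"
    then have "(d, a) \<in> L" by (auto simp: L_def)
    then obtain p where p: "p \<in> B" "fst p \<le> d" "mdeg (a - snd p) \<le> d - fst p" using B(3) by fastforce
    show "\<exists>(d', g)\<in>(\<lambda>p. (fst p, h p)) ` B. \<exists>b. leading P g b \<and> d' \<le> d \<and> mdeg (a - b) \<le> d - d'"
      using p h(3)[OF p(1)] by auto
  qed
  then show thesis by (rule that)
qed

lemma bounded_by_single_mult:
  assumes "bounded_by d' g" "d' \<le> d" "mdeg m \<le> d - d'"
  shows "bounded_by d (Poly_Mapping.single m c * g)"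
proof (cases "c = 0")
  case True
  then show ?thesis by (simp add: bounded_by_def)
next
  case False
  have "mdeg (m + k) \<le> d" if "k \<in> Poly_Mapping.keys g" for k
  proof -
    have "mdeg k \<le> d'" using that assms(1) by (simp add: bounded_by_def)
    then show ?thesis using mdeg_add_le[of m k] assms(2,3) by linarith
  qed
  then show ?thesis unfolding bounded_by_def keys_single_mult[OF False] by blast
qed

lemma bounded_by_diff: "bounded_by d f \<Longrightarrow> bounded_by d g \<Longrightarrow> bounded_by d (f - g)"
  unfolding bounded_by_def using keys_diff[of f g] by blast

text \<open>
  In each degree, the leading terms for two orders are equally many, so one inclusion between them
  implies the other; the proof reduces an element with a leading term for \<open>P'\<close> that is none for \<open>P\<close>.
\<close>
lemma graded_basis_change_order:
  assumes P: "group_order P" "group_order P'" and I: "monomial_closed I" and G: "graded_basis P I G"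
    and same: "\<And>d g b. (d, g) \<in> G \<Longrightarrow> leading P g b \<Longrightarrow> leading P' g b"
  shows "graded_basis P' I G"
proof -
  have key: "\<exists>h\<in>I. bounded_by d h \<and> leading P h a" if f: "f \<in> I" "bounded_by d f" "leading P' f a" for d f a
  proof (rule ccontr)
    define D where "D = {c. \<exists>h\<in>I. bounded_by d h \<and> leading P h c}"
    assume "\<not> ?thesis"
    then have aD: "a \<notin> D" by (simp add: D_def)
    have Dfin: "finite D"
      by (rule finite_subset[OF _ finite_mdeg_le[of d]]) (auto simp: D_def bounded_by_def leading_def)
    have D': "\<exists>h\<in>I. bounded_by d h \<and> leading P' h c" if "c \<in> D" for c
    proof -
      obtain h where h: "h \<in> I" "bounded_by d h" "leading P h c" using \<open>c \<in> D\<close> by (auto simp: D_def)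
      then obtain d' g b where g: "(d', g) \<in> G" "leading P g b" "d' \<le> d" "mdeg (c - b) \<le> d - d'"
        using G unfolding graded_basis_def by blast
      have gI: "g \<in> I" "bounded_by d' g" using G g(1) by (auto simp: graded_basis_def)
      have "leading P' (Poly_Mapping.single (c - b) 1 * g) ((c - b) + b)"
        by (rule leading_single_mult[OF P(2) _ same[OF g(1,2)]]) simp
      moreover have "bounded_by d (Poly_Mapping.single (c - b) 1 * g)"
        by (rule bounded_by_single_mult[OF gI(2) g(3,4)])
      moreover have "Poly_Mapping.single (c - b) 1 * g \<in> I" using I gI(1) by (simp add: monomial_closed_def)
      ultimately show ?thesis by auto
    qed
    \<comment> \<open>Counts the elements of \<open>D\<close> that lie, for \<open>P'\<close>, at or
      above some term of \<open>f\<close> in \<open>D\<close>. Cancelling the smallest such term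
      moves all of them up, while the leading term \<open>a\<close>, which is outside
      \<open>D\<close>, stays in place.\<close>
    define \<mu> where "\<mu> f = card {c \<in> D. \<exists>c0\<in>Poly_Mapping.keys f \<inter> D. c = c0 \<or> c - c0 \<in> P'}" for f :: "'m \<Rightarrow>\<^sub>0 complex"
    show False
      using f
    proof (induction "\<mu> f" arbitrary: f rule: less_induct)
      case (less f)
      have "f \<noteq> 0" using less.prems(3) by (auto simp: leading_def)
      then obtain c where "leading P f c" by (rule leading_exists[OF P(1)])
      \<comment> \<open>The leading exponent for \<open>P\<close> belongs to \<open>D\<close> by
        definition, so there is always a term to cancel.\<close>
      then have "c \<in> Poly_Mapping.keys f \<inter> D" using less.prems by (auto simp: D_def leading_def)
      then have "\<exists>c0\<in>Poly_Mapping.keys f \<inter> D. \<forall>b\<in>Poly_Mapping.keys f \<inter> D. b \<noteq> c0 \<longrightarrow> b - c0 \<in> P'"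
        by (intro group_order_min[OF P(2)]) auto
      then obtain c0 where c0: "c0 \<in> Poly_Mapping.keys f \<inter> D"
        "\<forall>b\<in>Poly_Mapping.keys f \<inter> D. b \<noteq> c0 \<longrightarrow> b - c0 \<in> P'"
        by blast
      obtain h where h: "h \<in> I" "bounded_by d h" "leading P' h c0" using D' c0(1) by blast
      define f' where "f' = f - Poly_Mapping.single 0 (Poly_Mapping.lookup f c0 / Poly_Mapping.lookup h c0) * h"
      note f' = cancel_term[OF P(2) h(3), where f = f, folded f'_def]
      have f'I: "f' \<in> I" unfolding f'_def using I less.prems(1) h(1) by (simp add: monomial_closed_def)
      have f'd: "bounded_by d f'" unfolding f'_def
        by (intro bounded_by_diff less.prems(2) bounded_by_single_mult[OF h(2)]) auto
      have "c0 \<noteq> a" using aD c0(1) by blast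
      then have c0a: "c0 - a \<in> P'" using less.prems(3) c0(1) by (auto simp: leading_def)
      have ha: "k - a \<in> P'" if "k \<in> Poly_Mapping.keys h" for k
        using group_order_trans[OF P(2) _ c0a, of k] c0a h(3) that by (cases "k = c0") (auto simp: leading_def)
      then have "a \<notin> Poly_Mapping.keys h" using group_order_irrefl[OF P(2)] by blast
      then have "a \<in> Poly_Mapping.keys f'"
        using f'(3) less.prems(3) by (simp add: in_keys_iff leading_def)
      then have lead: "leading P' f' a"
        unfolding leading_def using f'(2) ha less.prems(3) by (auto simp: leading_def)
      have below: "b - c0 \<in> P'" if "b \<in> Poly_Mapping.keys f' \<inter> D" for b
        using f'(1,2) c0(2) that by (cases "b = c0") auto
      have "{c \<in> D. \<exists>b\<in>Poly_Mapping.keys f' \<inter> D. c = b \<or> c - b \<in> P'} \<subset>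
          {c \<in> D. \<exists>b\<in>Poly_Mapping.keys f \<inter> D. c = b \<or> c - b \<in> P'}"
      proof
        have gt: "c - c0 \<in> P'" if cD: "c \<in> D" and cb: "\<exists>b\<in>Poly_Mapping.keys f' \<inter> D. c = b \<or> c - b \<in> P'" for c
        proof -
          obtain b where b: "b \<in> Poly_Mapping.keys f' \<inter> D" "c = b \<or> c - b \<in> P'" using cb by blast
          then show ?thesis using below[OF b(1)] group_order_trans[OF P(2), of c b c0] by auto
        qed
        show "{c \<in> D. \<exists>b\<in>Poly_Mapping.keys f' \<inter> D. c = b \<or> c - b \<in> P'} \<subseteq>
          {c \<in> D. \<exists>b\<in>Poly_Mapping.keys f \<inter> D. c = b \<or> c - b \<in> P'}"
          using gt c0(1) by blast
        have "c0 \<notin> {c \<in> D. \<exists>b\<in>Poly_Mapping.keys f' \<inter> D. c = b \<or> c - b \<in> P'}"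
          using gt[of c0] group_order_irrefl[OF P(2), of c0 c0] by blast
        then show "{c \<in> D. \<exists>b\<in>Poly_Mapping.keys f' \<inter> D. c = b \<or> c - b \<in> P'} \<noteq>
          {c \<in> D. \<exists>b\<in>Poly_Mapping.keys f \<inter> D. c = b \<or> c - b \<in> P'}"
          using c0(1) by blast
      qed
      then have "\<mu> f' < \<mu> f" unfolding \<mu>_def by (intro psubset_card_mono) (use Dfin in auto)
      then show False by (rule less.hyps[OF _ f'I f'd lead])
    qed
  qed
  show ?thesis
    unfolding graded_basis_def
  proof (intro conjI allI impI)
    show "finite G" "\<forall>(d, g)\<in>G. g \<in> I \<and> g \<noteq> 0 \<and> bounded_by d g" using G by (auto simp: graded_basis_def)
    fix d f a assume "f \<in> I" "bounded_by d f" "leading P' f a"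
    then obtain h where "h \<in> I" "bounded_by d h" "leading P h a" using key by blast
    then obtain d' g b where g: "(d', g) \<in> G" "leading P g b" "d' \<le> d" "mdeg (a - b) \<le> d - d'"
      using G unfolding graded_basis_def by blast
    then show "\<exists>(d', g)\<in>G. \<exists>b. leading P' g b \<and> d' \<le> d \<and> mdeg (a - b) \<le> d - d'"
      using same by blast
  qed
qed

text \<open>Each reduction step subtracts a multiple of a basis element whose part of weight
  \<open>W\<close> vanishes at \<open>y\<close>, and the remainder starts at a larger exponent. The
  order need not be well-founded, but the degree bound confines all exponents to a finite set, so
  the remainder is eventually 0.\<close>

lemma partial_eval_reduction:
  assumes P: "group_order P" and I: "monomial_closed I" and G: "graded_basis P I G"
    and w: "Modules.additive w" "\<And>m. m \<in> P \<Longrightarrow> 0 \<le> w m" and y: "\<And>a b. y (a + b) = y a * y b"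
    and Gy: "\<And>d g b. (d, g) \<in> G \<Longrightarrow> leading P g b \<Longrightarrow> partial_eval w (w b) y g = 0"
    and f: "f \<in> I" "\<And>k. k \<in> Poly_Mapping.keys f \<Longrightarrow> W \<le> w k"
  shows "partial_eval w W y f = 0"
proof -
  have w': "w b \<le> w k" if "leading P g b" "k \<in> Poly_Mapping.keys g" for g b k
    using w(2)[of "k - b"] that by (cases "k = b") (auto simp: leading_def additive.diff[OF w(1)])
  define d where "d = Max (insert 0 (mdeg ` Poly_Mapping.keys f))"
  have "bounded_by d f" unfolding bounded_by_def d_def by (auto intro!: Max_ge)
  define \<mu> where "\<mu> f = card {c. mdeg c \<le> d \<and> (\<exists>a. leading P f a \<and> (c = a \<or> c - a \<in> P))}" for f :: "'m \<Rightarrow>\<^sub>0 complex"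
  show ?thesis
    using f \<open>bounded_by d f\<close>
  proof (induction "\<mu> f" arbitrary: f rule: less_induct)
    case (less f)
    show ?case
    proof (cases "f = 0")
      case True
      then show ?thesis by (simp add: partial_eval_def poly_eval_def)
    next
      case False
      then obtain a where a: "leading P f a" by (rule leading_exists[OF P])
      then obtain d' g b where g: "(d', g) \<in> G" "leading P g b" "d' \<le> d" "mdeg (a - b) \<le> d - d'"
        using G less.prems unfolding graded_basis_def by blast
      have gI: "g \<in> I" "bounded_by d' g" using G g(1) by (auto simp: graded_basis_def)
      define h where "h = Poly_Mapping.single (a - b) 1 * g"
      have h: "leading P h a" using leading_single_mult[OF P _ g(2), of 1 "a - b"] by (simp add: h_def)
      have hI: "h \<in> I" "bounded_by d h"
        unfolding h_def using I gI bounded_by_single_mult[OF gI(2) g(3,4)] by (simp_all add: monomial_closed_def)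
      have Wa: "W \<le> w a" using less.prems(2) a by (simp add: leading_def)
      have "partial_eval w W y h = y (a - b) * partial_eval w (W - w (a - b)) y g"
        unfolding h_def by (simp add: partial_eval_single_mult[OF w(1) y])
      also have "partial_eval w (W - w (a - b)) y g = 0"
      \<comment> \<open>The leading term has minimal weight in the multiple: either this weight is
        \<open>W\<close> and the hypothesis on the basis applies, or all weights exceed
        \<open>W\<close>.\<close>
      proof (cases "W = w a")
        case True
        then show ?thesis using Gy[OF g(1,2)] by (simp add: additive.diff[OF w(1)])
      next
        case False
        then show ?thesis using w'[OF g(2)] Wa
          by (intro partial_eval_eq_0) (fastforce simp: additive.diff[OF w(1)])
      qed
      finally have ph: "partial_eval w W y h = 0" by simp
      define f' where "f' = f - Poly_Mapping.single 0 (Poly_Mapping.lookup f a / Poly_Mapping.lookup h a) * h"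
      note f' = cancel_term[OF P h, where f = f, folded f'_def]
      have f'I: "f' \<in> I" unfolding f'_def using I less.prems(1) hI(1) by (simp add: monomial_closed_def)
      have f'd: "bounded_by d f'" unfolding f'_def
        by (intro bounded_by_diff less.prems(3) bounded_by_single_mult[OF hI(2)]) auto
      have f'a: "k - a \<in> P" if "k \<in> Poly_Mapping.keys f'" for k
        using f'(1,2) a that by (cases "k = a") (auto simp: leading_def)
      have f'W: "W \<le> w k" if "k \<in> Poly_Mapping.keys f'" for k
        using w(2)[OF f'a[OF that]] Wa by (simp add: additive.diff[OF w(1)])
      have eq: "partial_eval w W y f = partial_eval w W y f'"
        unfolding f'_def by (simp add: partial_eval_diff partial_eval_single_mult[OF w(1) y] additive.zero[OF w(1)] ph)
      have "{c. mdeg c \<le> d \<and> (\<exists>a. leading P f' a \<and> (c = a \<or> c - a \<in> P))} \<subset>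
        {c. mdeg c \<le> d \<and> (\<exists>a. leading P f a \<and> (c = a \<or> c - a \<in> P))}"
      proof
        have gt: "c - a \<in> P" if "leading P f' a'" "c = a' \<or> c - a' \<in> P" for c a'
        proof -
          have "a' - a \<in> P" using f'a that(1) by (simp add: leading_def)
          then show ?thesis using that(2) group_order_trans[OF P, of c a' a] by blast
        qed
        then show "{c. mdeg c \<le> d \<and> (\<exists>a. leading P f' a \<and> (c = a \<or> c - a \<in> P))} \<subseteq>
          {c. mdeg c \<le> d \<and> (\<exists>a. leading P f a \<and> (c = a \<or> c - a \<in> P))}" using a by blast
        have "a \<notin> {c. mdeg c \<le> d \<and> (\<exists>a. leading P f' a \<and> (c = a \<or> c - a \<in> P))}"
          using gt group_order_irrefl[OF P, of a a] by blast
        moreover have "a \<in> {c. mdeg c \<le> d \<and> (\<exists>a. leading P f a \<and> (c = a \<or> c - a \<in> P))}"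
          using a less.prems(3) by (auto simp: bounded_by_def leading_def)
        ultimately show "{c. mdeg c \<le> d \<and> (\<exists>a. leading P f' a \<and> (c = a \<or> c - a \<in> P))} \<noteq>
          {c. mdeg c \<le> d \<and> (\<exists>a. leading P f a \<and> (c = a \<or> c - a \<in> P))}" by blast
      qed
      then have "\<mu> f' < \<mu> f" unfolding \<mu>_def
        by (intro psubset_card_mono) (auto intro: finite_subset[OF _ finite_mdeg_le[of d]])
      then have "partial_eval w W y f' = 0" by (rule less.hyps[OF _ f'I f'W f'd])
      then show ?thesis using eq by simp
    qed
  qed
qed

end

section \<open>Limits of homomorphisms on a lattice\<close>

lemma tendsto_fun_iff:
  fixes f :: "'i \<Rightarrow> 'a \<Rightarrow> 'b::topological_space"
  shows "(f \<longlongrightarrow> l) F \<longleftrightarrow> (\<forall>a. ((\<lambda>i. f i a) \<longlongrightarrow> l a) F)"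
proof -
  have "limitin euclidean f l F \<longleftrightarrow> (\<forall>a. limitin euclidean (\<lambda>i. f i a) (l a) F)"
    unfolding euclidean_product_topology[symmetric] by (simp add: limitin_componentwise)
  then show ?thesis by simp
qed

lemma ultrafilter_bounded_real:
  fixes f :: "'a \<Rightarrow> real"
  assumes "ultrafilter U" "eventually (\<lambda>x. \<bar>f x\<bar> \<le> B) U"
  obtains l where "(f \<longlongrightarrow> l) U"
proof -
  have "eventually (\<lambda>x. f x \<in> cball 0 B) U" using assms(2) by simp
  then show thesis using ultrafilter_bounded_convergent[OF assms(1) bounded_cball] that by blast
qed

lemma additive_add: "Modules.additive f \<Longrightarrow> Modules.additive g \<Longrightarrow> Modules.additive (\<lambda>m. f m + g m)"
  for f g :: "'m::ab_group_add \<Rightarrow> real"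
  by (simp add: Modules.additive_def)

lemma additive_diff: "Modules.additive f \<Longrightarrow> Modules.additive g \<Longrightarrow> Modules.additive (\<lambda>m. f m - g m)"
  for f g :: "'m::ab_group_add \<Rightarrow> real"
  by (simp add: Modules.additive_def)

lemma additive_scale: "Modules.additive f \<Longrightarrow> Modules.additive (\<lambda>m. c * f m)"
  for f :: "'m::ab_group_add \<Rightarrow> real"
  by (simp add: Modules.additive_def distrib_left)

lemma additive_sum: "(\<And>j. j \<in> J \<Longrightarrow> Modules.additive (f j)) \<Longrightarrow> Modules.additive (\<lambda>m. \<Sum>j\<in>J. f j m)"
  for f :: "'i \<Rightarrow> 'm::ab_group_add \<Rightarrow> real"
  by (simp add: Modules.additive_def sum.distrib)

text \<open>
  The induction eliminates one coordinate for each bounded lattice point found.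
\<close>
lemma split_convergent_part:
  fixes c :: "'i \<Rightarrow> 'm::ab_group_add \<Rightarrow> real" and a :: "'b \<Rightarrow> 'i \<Rightarrow> real"
  assumes U: "ultrafilter U" and "finite J" "\<And>j. j \<in> J \<Longrightarrow> Modules.additive (c j)"
  shows "\<exists>w' l. (\<forall>k. Modules.additive (w' k)) \<and> Modules.additive l \<and>
    (\<forall>m. ((\<lambda>k. (\<Sum>j\<in>J. c j m * a k j) - w' k m) \<longlongrightarrow> l m) U) \<and>
    (\<forall>m. (\<forall>k. w' k m = 0) \<or> (\<forall>B. eventually (\<lambda>k. \<bar>w' k m\<bar> > B) U))"
  using assms(2,3)
proof (induction "card J" arbitrary: J c rule: less_induct)
  case less
  define w where "w k m = (\<Sum>j\<in>J. c j m * a k j)" for k m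
  have w: "Modules.additive (w k)" for k
    unfolding w_def using less.prems(2) additive_scale[of "c _" "a k _"] by (intro additive_sum) (simp add: mult.commute)
  show ?case
  \<comment> \<open>Points at which all \<open>c j\<close> vanish are left aside: there the sum is
    identically 0, as the dichotomy permits.\<close>
  proof (cases "\<exists>m. (\<exists>j\<in>J. c j m \<noteq> 0) \<and> (\<exists>B. \<not> eventually (\<lambda>k. \<bar>w k m\<bar> > B) U)")
    case False
    have "(\<forall>k. w k m = 0) \<or> (\<forall>B. eventually (\<lambda>k. \<bar>w k m\<bar> > B) U)" for m
    proof (cases "\<exists>j\<in>J. c j m \<noteq> 0")
      case True
      then show ?thesis using False by blast
    next
      case False
      then show ?thesis by (simp add: w_def)
    qed
    moreover have "Modules.additive (\<lambda>m::'m. 0::real)" by (simp add: Modules.additive_def)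
    ultimately show ?thesis using w by (intro exI[of _ w] exI[of _ "\<lambda>_. 0"]) (simp add: w_def)
  next
    case True
    then obtain m j0 B where m: "j0 \<in> J" "c j0 m \<noteq> 0" "\<not> eventually (\<lambda>k. \<bar>w k m\<bar> > B) U" by blast
    have "eventually (\<lambda>k. \<not> \<bar>w k m\<bar> > B) U" using m(3) ultrafilter_not_eventually[OF U] by blast
    then have "eventually (\<lambda>k. \<bar>w k m\<bar> \<le> B) U" by (simp add: not_less)
    then obtain l where l: "((\<lambda>k. w k m) \<longlongrightarrow> l) U" by (rule ultrafilter_bounded_real[OF U])
    \<comment> \<open>At the bounded point \<open>m\<close>, the number \<open>a k j0\<close> can be
      expressed by the convergent \<open>w k m\<close> and the other \<open>a k j\<close>. The new
      functionals \<open>c' j\<close> vanish at \<open>m\<close> and describe what remains without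
      the index \<open>j0\<close>.\<close>
    define c' where "c' j m' = c j m' - c j m / c j0 m * c j0 m'" for j m'
    have c': "Modules.additive (c' j)" if "j \<in> J - {j0}" for j
      unfolding c'_def using that less.prems(2) m(1) by (intro additive_diff additive_scale) auto
    have "card (J - {j0}) < card J" using less.prems(1) m(1) by (rule card_Diff1_less)
    then have "\<exists>w' l'. (\<forall>k. Modules.additive (w' k)) \<and> Modules.additive l' \<and>
      (\<forall>m. ((\<lambda>k. (\<Sum>j\<in>J - {j0}. c' j m * a k j) - w' k m) \<longlongrightarrow> l' m) U) \<and>
      (\<forall>m. (\<forall>k. w' k m = 0) \<or> (\<forall>B. eventually (\<lambda>k. \<bar>w' k m\<bar> > B) U))"
      by (rule less.hyps) (use less.prems(1) c' in simp_all)
    then obtain w' l' where IH: "\<forall>k. Modules.additive (w' k)" "Modules.additive l'"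
      "\<forall>m. ((\<lambda>k. (\<Sum>j\<in>J - {j0}. c' j m * a k j) - w' k m) \<longlongrightarrow> l' m) U"
      "\<forall>m. (\<forall>k. w' k m = 0) \<or> (\<forall>B. eventually (\<lambda>k. \<bar>w' k m\<bar> > B) U)"
      by blast
    have eq: "w k m' = (\<Sum>j\<in>J - {j0}. c' j m' * a k j) + c j0 m' / c j0 m * w k m" for k m'
    proof -
      have "w k x = c j0 x * a k j0 + (\<Sum>j\<in>J - {j0}. c j x * a k j)" for x
        unfolding w_def using less.prems(1) m(1) by (rule sum.remove)
      moreover have "(\<Sum>j\<in>J - {j0}. c' j m' * a k j) =
        (\<Sum>j\<in>J - {j0}. c j m' * a k j) - c j0 m' / c j0 m * (\<Sum>j\<in>J - {j0}. c j m * a k j)"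
        unfolding c'_def sum_distrib_left sum_subtractf[symmetric]
        by (intro sum.cong) (auto simp: algebra_simps)
      ultimately show ?thesis using m(2) by (simp add: algebra_simps)
    qed
    define l'' where "l'' m' = l' m' + l / c j0 m * c j0 m'" for m'
    have "Modules.additive l''"
      unfolding l''_def using IH(2) less.prems(2) m(1) by (intro additive_add additive_scale) auto
    moreover have "((\<lambda>k. w k m' - w' k m') \<longlongrightarrow> l'' m') U" for m'
    proof -
      have "((\<lambda>k. ((\<Sum>j\<in>J - {j0}. c' j m' * a k j) - w' k m') + w k m / c j0 m * c j0 m') \<longlongrightarrow> l' m' + l / c j0 m * c j0 m') U"
        by (intro tendsto_intros IH(3)[rule_format] l m(2))
      moreover have "(\<lambda>k. ((\<Sum>j\<in>J - {j0}. c' j m' * a k j) - w' k m') + w k m / c j0 m * c j0 m') = (\<lambda>k. w k m' - w' k m')"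
        by (rule ext) (simp add: eq[of _ m'])
      ultimately show ?thesis by (simp only: l''_def)
    qed
    ultimately show ?thesis using IH(1,4) unfolding w_def by blast
  qed
qed

lemma norm_on_R_N_props:
  fixes \<nu> :: "('m::ab_group_add \<Rightarrow> real) \<Rightarrow> real"
  assumes \<nu>: "norm_on_R_N \<nu>"
  shows "\<nu> (\<lambda>_. 0) = 0" "Modules.additive w \<Longrightarrow> 0 \<le> \<nu> w"
    "Modules.additive w \<Longrightarrow> \<nu> w = 0 \<longleftrightarrow> w = (\<lambda>_. 0)"
    "Modules.additive w \<Longrightarrow> \<nu> (\<lambda>m. c * w m) = \<bar>c\<bar> * \<nu> w"
    "Modules.additive v \<Longrightarrow> Modules.additive w \<Longrightarrow> \<nu> (\<lambda>m. v m + w m) \<le> \<nu> v + \<nu> w"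
proof -
  have "Modules.additive (\<lambda>_::'m. 0::real)" by (simp add: Modules.additive_def)
  then show "\<nu> (\<lambda>_. 0) = 0" using \<nu> unfolding norm_on_R_N_def R_N_def by blast
qed (use \<nu> in \<open>simp_all add: norm_on_R_N_def R_N_def\<close>)

section \<open>Polar coordinates, equations and norms\<close>

context free_lattice
begin

lemma Log_map_additive: "x \<in> T_N \<Longrightarrow> Modules.additive (Log_map x)"
  by (simp add: Modules.additive_def Log_map_def T_N_def norm_mult ln_mult)

lemma arg_map_mem: "x \<in> T_N \<Longrightarrow> arg_map x \<in> U_N"
  by (simp add: U_N_def T_N_def arg_map_def norm_mult norm_divide)

lemma polar: "x \<in> T_N \<Longrightarrow> x m = exp (Log_map x m) * arg_map x m"
  by (simp add: Log_map_def arg_map_def T_N_def flip: exp_of_real)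

lemma arg_map_polar:
  assumes "u \<in> U_N" "Modules.additive l"
  shows "(\<lambda>m. exp (complex_of_real (l m)) * u m) \<in> T_N" "arg_map (\<lambda>m. exp (complex_of_real (l m)) * u m) = u"
proof -
  show "(\<lambda>m. exp (complex_of_real (l m)) * u m) \<in> T_N"
    using assms by (auto simp: U_N_def T_N_def additive.add additive.zero exp_add)
  show "arg_map (\<lambda>m. exp (complex_of_real (l m)) * u m) = u"
    using assms(1) by (auto simp: U_N_def arg_map_def norm_mult exp_of_real)
qed

lemma zero_locus_vanishing_ideal:
  assumes "closed_subvariety X"
  shows "X = zero_locus (vanishing_ideal X)"
  using assms by (auto simp: closed_subvariety_def zero_locus_def vanishing_ideal_def)

lemma monomial_closed_vanishing_ideal:
  assumes "X \<subseteq> T_N"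
  shows "monomial_closed (vanishing_ideal X)"
  unfolding monomial_closed_def vanishing_ideal_def using assms
  by (auto simp: laurent_eval_diff laurent_eval_mult subset_iff)

text \<open>Some group order on the lattice, pulled back along the coordinates; it also breaks the
  ties where diverging logarithms give no comparison.\<close>

lemma group_order_phi: "group_order {m. 0 < \<phi> m}"
  unfolding group_order_def
proof (intro conjI allI ballI impI)
  fix a b assume "a \<in> {m. 0 < \<phi> m}" "b \<in> {m. 0 < \<phi> m}"
  then show "a + b \<in> {m. 0 < \<phi> m}" by (simp add: phi_simps add_pos_pos)
next
  fix a :: 'm assume "a \<noteq> 0"
  then have "\<phi> a \<noteq> 0" using phi_inj[of a 0] by (simp add: phi_simps)
  then show "a \<in> {m. 0 < \<phi> m} \<or> - a \<in> {m. 0 < \<phi> m}" by (auto simp: phi_simps)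
qed (simp add: phi_simps)

text \<open>For the weight 0 all terms have the same weight and \<open>partial_eval\<close> is plain
  evaluation, so reduction shows that the elements of a Groebner basis already cut out
  \<open>X\<close>.\<close>

lemma finitely_many_equations:
  fixes X :: "('m \<Rightarrow> complex) set"
  assumes X: "closed_subvariety X"
  obtains E where "finite E" "X = zero_locus E"
proof -
  let ?P = "{m. 0 < \<phi> m}" and ?I = "vanishing_ideal X"
  have XT: "X \<subseteq> T_N" using X by (auto simp: closed_subvariety_def zero_locus_def)
  have I: "monomial_closed ?I" by (rule monomial_closed_vanishing_ideal[OF XT])
  obtain G where G: "graded_basis ?P ?I G" by (rule graded_basis_exists[OF group_order_phi I])
  have fin: "finite (snd ` G)" and GI: "snd ` G \<subseteq> ?I" using G by (auto simp: graded_basis_def)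
  have pe: "partial_eval (\<lambda>_. 0) 0 y f = laurent_eval f y" for y f
    by (simp add: partial_eval_def laurent_eval_eq_poly_eval)
  have "laurent_eval f y = 0" if y: "y \<in> zero_locus (snd ` G)" and f: "f \<in> ?I" for y f
    unfolding pe[symmetric]
  proof (rule partial_eval_reduction[OF group_order_phi I G _ _ _ _ f])
    show "Modules.additive (\<lambda>_::'m. 0::real)" by (simp add: Modules.additive_def)
    show "y (a + b) = y a * y b" for a b using y by (simp add: zero_locus_def T_N_def)
    show "partial_eval (\<lambda>_. 0) 0 y g = 0" if "(d, g) \<in> G" for d g
      unfolding pe using y that by (force simp: zero_locus_def)
  qed simp_all
  then have "zero_locus (snd ` G) \<subseteq> zero_locus ?I" by (auto simp: zero_locus_def)
  moreover have "zero_locus ?I \<subseteq> zero_locus (snd ` G)" using GI by (auto simp: zero_locus_def)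
  ultimately show thesis using that[OF fin] zero_locus_vanishing_ideal[OF X] by blast
qed

text \<open>The constants are the norms of the coordinate functionals.\<close>

lemma norm_le_coordinates:
  assumes \<nu>: "norm_on_R_N (\<nu> :: ('m \<Rightarrow> real) \<Rightarrow> real)"
  obtains C where "\<And>w. Modules.additive w \<Longrightarrow> \<nu> w \<le> (\<Sum>j<n. \<bar>w (basis j)\<bar> * C j)"
proof -
  define \<delta> where "\<delta> j m = real_of_int (coord m j)" for j m
  have \<delta>: "Modules.additive (\<delta> j)" for j by (simp add: Modules.additive_def \<delta>_def)
  have "\<nu> (\<lambda>m. \<Sum>j\<in>J. c j * \<delta> j m) \<le> (\<Sum>j\<in>J. \<bar>c j\<bar> * \<nu> (\<delta> j))" if "finite J" for J c
    using that
  proof (induction J rule: finite_induct)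
    case empty
    then show ?case using norm_on_R_N_props(1)[OF \<nu>] by simp
  next
    case (insert i J)
    have A: "Modules.additive (\<lambda>m. c i * \<delta> i m)" "Modules.additive (\<lambda>m. \<Sum>j\<in>J. c j * \<delta> j m)"
      using \<delta> by (auto intro!: additive_scale additive_sum)
    have "\<nu> (\<lambda>m. \<Sum>j\<in>insert i J. c j * \<delta> j m) = \<nu> (\<lambda>m. c i * \<delta> i m + (\<Sum>j\<in>J. c j * \<delta> j m))"
      using insert by simp
    also have "\<dots> \<le> \<nu> (\<lambda>m. c i * \<delta> i m) + \<nu> (\<lambda>m. \<Sum>j\<in>J. c j * \<delta> j m)"
      by (rule norm_on_R_N_props(5)[OF \<nu> A])
    also have "\<nu> (\<lambda>m. c i * \<delta> i m) = \<bar>c i\<bar> * \<nu> (\<delta> i)"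
      by (rule norm_on_R_N_props(4)[OF \<nu> \<delta>])
    finally show ?case using insert by simp
  qed
  note * = this[OF finite_lessThan[of n]]
  have "\<nu> w \<le> (\<Sum>j<n. \<bar>w (basis j)\<bar> * \<nu> (\<delta> j))" if w: "Modules.additive w" for w
  proof -
    have "w = (\<lambda>m. \<Sum>j<n. w (basis j) * \<delta> j m)"
      by (rule ext, subst additive_expand[OF w]) (simp add: \<delta>_def mult.commute)
    then have "\<nu> w = \<nu> (\<lambda>m. \<Sum>j<n. w (basis j) * \<delta> j m)" by (rule arg_cong)
    also have "\<dots> \<le> (\<Sum>j<n. \<bar>w (basis j)\<bar> * \<nu> (\<delta> j))" by (rule *)
    finally show ?thesis .
  qed
  then show thesis by (rule that)
qed

lemma additive_coordinates_bounded:
  assumes w: "\<And>k. Modules.additive (w k :: 'm \<Rightarrow> real)"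
    and b: "\<And>j. j < n \<Longrightarrow> \<exists>B. eventually (\<lambda>k. \<bar>w k (basis j)\<bar> \<le> B) U"
  shows "\<exists>B. eventually (\<lambda>k. \<forall>j<n. \<bar>w k (basis j)\<bar> \<le> B) U"
proof -
  obtain B where B: "\<And>j. j < n \<Longrightarrow> eventually (\<lambda>k. \<bar>w k (basis j)\<bar> \<le> B j) U" using b by metis
  define M where "M = Max (insert 0 (B ` {..<n}))"
  have BM: "B j \<le> M" if "j < n" for j unfolding M_def using that by (intro Max_ge) auto
  have "eventually (\<lambda>k. \<forall>j\<in>{..<n}. \<bar>w k (basis j)\<bar> \<le> B j) U" using B by (intro eventually_ball_finite) auto
  then have "eventually (\<lambda>k. \<forall>j<n. \<bar>w k (basis j)\<bar> \<le> M) U"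
    by (rule eventually_mono) (use BM in \<open>auto intro: order_trans\<close>)
  then show ?thesis by blast
qed

end

section \<open>Coamoebas and phase limits\<close>

lemma tendsto_laurent_eval:
  assumes "\<And>m. ((\<lambda>k. x k m) \<longlongrightarrow> y m) F"
  shows "((\<lambda>k. laurent_eval f (x k)) \<longlongrightarrow> laurent_eval f y) F"
  unfolding laurent_eval_def by (intro tendsto_sum tendsto_mult tendsto_const assms)

context free_lattice
begin

lemma tendsto_T_N:
  assumes "\<And>k. x k \<in> T_N" "y \<in> T_N" "\<And>j. j < n \<Longrightarrow> ((\<lambda>k. x k (basis j)) \<longlongrightarrow> y (basis j)) F"
  shows "((\<lambda>k. x k m) \<longlongrightarrow> y m) F"
proof -
  have nz: "y a \<noteq> 0" for a using assms(2) by (simp add: T_N_def)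
  have "((\<lambda>k. \<Prod>j<n. x k (basis j) powi coord m j) \<longlongrightarrow> (\<Prod>j<n. y (basis j) powi coord m j)) F"
    by (intro tendsto_prod tendsto_power_int assms(3) nz) simp
  then show ?thesis by (simp only: T_N_expand[OF assms(1), of _ m] T_N_expand[OF assms(2), of m])
qed

text \<open>Equivalence of norms by compactness: otherwise the homomorphisms, divided by their
  l1-norms, have an ultralimit of l1-norm 1 whose norm \<open>\<nu>\<close> is 0.\<close>

lemma norm_bounded_imp_coordinates_bounded:
  assumes \<nu>: "norm_on_R_N (\<nu> :: ('m \<Rightarrow> real) \<Rightarrow> real)" and U: "ultrafilter U"
    and w: "\<And>k. Modules.additive (w k :: 'm \<Rightarrow> real)" and B: "eventually (\<lambda>k. \<nu> (w k) \<le> B) U" and j: "j < n"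
  shows "\<exists>B'. eventually (\<lambda>k. \<bar>w k (basis j)\<bar> \<le> B') U"
proof -
  define s where "s k = (\<Sum>j<n. \<bar>w k (basis j)\<bar>)" for k
  have s: "\<bar>w k (basis j)\<bar> \<le> s k" if "j < n" for k j
    unfolding s_def using that by (intro member_le_sum) auto
  have s0: "0 \<le> s k" for k unfolding s_def by (intro sum_nonneg) auto
  have U0: "U \<noteq> bot" using U by (simp add: ultrafilter_def)
  have "\<exists>B'. eventually (\<lambda>k. s k \<le> B') U"
  proof (rule ccontr)
    assume "\<not> ?thesis"
    then have big: "eventually (\<lambda>k. \<not> s k \<le> B') U" for B' using ultrafilter_not_eventually[OF U] by blast
    have "eventually (\<lambda>k. Z \<le> s k) U" for Z using big[of Z] by (rule eventually_mono) simp
    then have top: "filterlim s at_top U" by (simp add: filterlim_at_top)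
    have pos: "eventually (\<lambda>k. 0 < s k) U" using big[of 0] by (rule eventually_mono) auto
    define v where "v k m = inverse (s k) * w k m" for k m
    have v: "Modules.additive (v k)" for k unfolding v_def by (rule additive_scale[OF w])
    have "\<exists>l. ((\<lambda>k. v k (basis j)) \<longlongrightarrow> l) U" if "j < n" for j
    proof -
      have "\<bar>v k (basis j)\<bar> \<le> 1" for k
        using s[OF that, of k] s0[of k] by (cases "s k = 0") (auto simp: v_def abs_mult field_simps)
      then have "eventually (\<lambda>k. \<bar>v k (basis j)\<bar> \<le> 1) U" by simp
      then show ?thesis by (rule ultrafilter_bounded_real[OF U]) blast
    qed
    then obtain l where l: "\<And>j. j < n \<Longrightarrow> ((\<lambda>k. v k (basis j)) \<longlongrightarrow> l j) U" by metis
    define v0 where "v0 m = (\<Sum>j<n. of_int (coord m j) * l j)" for m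
    have v0: "Modules.additive v0" by (simp add: Modules.additive_def v0_def distrib_right sum.distrib)
    have v0b: "v0 (basis i) = l i" if "i < n" for i
    proof -
      have "v0 (basis i) = (\<Sum>j<n. if j = i then l j else 0)"
        unfolding v0_def by (intro sum.cong) (auto simp: coord_basis[OF that])
      then show ?thesis using that by simp
    qed
    have "((\<lambda>k. \<Sum>j<n. \<bar>v k (basis j)\<bar>) \<longlongrightarrow> (\<Sum>j<n. \<bar>l j\<bar>)) U"
      by (intro tendsto_sum tendsto_rabs l) simp
    moreover have "eventually (\<lambda>k. (\<Sum>j<n. \<bar>v k (basis j)\<bar>) = 1) U"
      using pos by (rule eventually_mono) (simp add: v_def abs_mult flip: sum_distrib_left s_def)
    then have "((\<lambda>k. \<Sum>j<n. \<bar>v k (basis j)\<bar>) \<longlongrightarrow> 1) U" by (rule tendsto_eventually)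
    ultimately have l1: "(\<Sum>j<n. \<bar>l j\<bar>) = 1" by (rule tendsto_unique[OF U0])
    obtain C where C: "\<And>w. Modules.additive w \<Longrightarrow> \<nu> w \<le> (\<Sum>j<n. \<bar>w (basis j)\<bar> * C j)"
      using norm_le_coordinates[OF \<nu>] by blast
    have le: "\<nu> v0 \<le> (\<Sum>j<n. \<bar>l j - v k (basis j)\<bar> * C j) + \<nu> (v k)" for k
    proof -
      have "\<nu> v0 = \<nu> (\<lambda>m. (v0 m - v k m) + v k m)" by simp
      also have "\<dots> \<le> \<nu> (\<lambda>m. v0 m - v k m) + \<nu> (v k)"
        by (rule norm_on_R_N_props(5)[OF \<nu> additive_diff[OF v0 v] v])
      also have "\<nu> (\<lambda>m. v0 m - v k m) \<le> (\<Sum>j<n. \<bar>v0 (basis j) - v k (basis j)\<bar> * C j)"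
        by (rule C[OF additive_diff[OF v0 v]])
      also have "\<dots> = (\<Sum>j<n. \<bar>l j - v k (basis j)\<bar> * C j)" by (intro sum.cong) (auto simp: v0b)
      finally show ?thesis by simp
    qed
    have "((\<lambda>k. \<nu> (v k)) \<longlongrightarrow> 0) U"
    proof (rule tendsto_sandwich)
      show "eventually (\<lambda>k. 0 \<le> \<nu> (v k)) U" using norm_on_R_N_props(2)[OF \<nu> v] by simp
      show "eventually (\<lambda>k. \<nu> (v k) \<le> B * inverse (s k)) U"
        using B pos
      proof (rule eventually_elim2)
        fix k assume "\<nu> (w k) \<le> B" "0 < s k"
        have "\<nu> (v k) = \<bar>inverse (s k)\<bar> * \<nu> (w k)"
          unfolding v_def by (rule norm_on_R_N_props(4)[OF \<nu> w])
        then show "\<nu> (v k) \<le> B * inverse (s k)"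
          using \<open>\<nu> (w k) \<le> B\<close> \<open>0 < s k\<close> by (simp add: mult.commute mult_left_mono)
      qed
      have "((\<lambda>k. inverse (s k)) \<longlongrightarrow> 0) U" by (rule tendsto_inverse_0_at_top[OF top])
      then show "((\<lambda>k. B * inverse (s k)) \<longlongrightarrow> 0) U" by (rule tendsto_mult_right_zero)
    qed simp
    then have "((\<lambda>k. (\<Sum>j<n. \<bar>l j - v k (basis j)\<bar> * C j) + \<nu> (v k)) \<longlongrightarrow> (\<Sum>j<n. \<bar>l j - l j\<bar> * C j) + 0) U"
      by (intro tendsto_add tendsto_sum tendsto_mult tendsto_rabs tendsto_diff tendsto_const l) auto
    then have "((\<lambda>k. (\<Sum>j<n. \<bar>l j - v k (basis j)\<bar> * C j) + \<nu> (v k)) \<longlongrightarrow> 0) U" by simp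
    then have "\<nu> v0 \<le> 0" by (rule tendsto_lowerbound) (use le U0 in simp_all)
    then have "\<nu> v0 = 0" using norm_on_R_N_props(2)[OF \<nu> v0] by linarith
    then have "v0 = (\<lambda>_. 0)" using norm_on_R_N_props(3)[OF \<nu> v0] by blast
    then have "l j = 0" if "j < n" for j using v0b[OF that] by simp
    then show False using l1 by simp
  qed
  then obtain B' where "eventually (\<lambda>k. s k \<le> B') U" by blast
  then have "eventually (\<lambda>k. \<bar>w k (basis j)\<bar> \<le> B') U"
    by (rule eventually_mono) (use s[OF j] order_trans in blast)
  then show ?thesis by blast
qed

lemma bounded_limit_in_coamoeba:
  assumes X: "closed_subvariety X" and U: "ultrafilter U" and x: "\<And>k. x k \<in> X" and u: "u \<in> U_N"
    and arg: "\<And>m. ((\<lambda>k. arg_map (x k) m) \<longlongrightarrow> u m) U"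
    and bd: "\<And>j. j < n \<Longrightarrow> \<exists>B. eventually (\<lambda>k. \<bar>Log_map (x k) (basis j)\<bar> \<le> B) U"
  shows "u \<in> coamoeba X"
proof -
  obtain E where E: "X = zero_locus E" using X by (auto simp: closed_subvariety_def)
  have xT: "x k \<in> T_N" for k using x E by (auto simp: zero_locus_def)
  have U0: "U \<noteq> bot" using U by (simp add: ultrafilter_def)
  have "\<exists>l. ((\<lambda>k. Log_map (x k) (basis j)) \<longlongrightarrow> l) U" if "j < n" for j
    using bd[OF that] ultrafilter_bounded_real[OF U] by metis
  then obtain l where l: "\<And>j. j < n \<Longrightarrow> ((\<lambda>k. Log_map (x k) (basis j)) \<longlongrightarrow> l j) U" by metis
  define l0 where "l0 m = (\<Sum>j<n. of_int (coord m j) * l j)" for m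
  have l0: "Modules.additive l0" by (simp add: Modules.additive_def l0_def distrib_right sum.distrib)
  have lim: "((\<lambda>k. Log_map (x k) m) \<longlongrightarrow> l0 m) U" for m
    unfolding l0_def additive_expand[OF Log_map_additive[OF xT], of _ m]
    by (intro tendsto_intros l) simp
  define y where "y m = exp (complex_of_real (l0 m)) * u m" for m
  have y: "y \<in> T_N" "arg_map y = u" unfolding y_def by (rule arg_map_polar[OF u l0])+
  have "((\<lambda>k. exp (complex_of_real (Log_map (x k) m)) * arg_map (x k) m) \<longlongrightarrow> y m) U" for m
    unfolding y_def by (intro tendsto_intros lim arg)
  then have xy: "((\<lambda>k. x k m) \<longlongrightarrow> y m) U" for m by (simp only: polar[OF xT, of _ m] of_real_exp[symmetric] exp_of_real)
  have "laurent_eval f y = 0" if "f \<in> E" for f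
  proof -
    have "((\<lambda>k. laurent_eval f (x k)) \<longlongrightarrow> laurent_eval f y) U" by (rule tendsto_laurent_eval[OF xy])
    moreover have "laurent_eval f (x k) = 0" for k using x[of k] that by (simp add: E zero_locus_def)
    ultimately have "((\<lambda>_. 0) \<longlongrightarrow> laurent_eval f y) U" by simp
    then show ?thesis using U0 by (simp add: tendsto_const_iff)
  qed
  then have "y \<in> X" using y by (simp add: E zero_locus_def)
  then show ?thesis unfolding coamoeba_def using y(2) by blast
qed

lemma tendsto_arg_map:
  assumes x: "\<And>k. x k \<in> T_N" and u: "u \<in> U_N"
    and d: "\<And>k j. j < n \<Longrightarrow> dist (arg_map (x k) (basis j)) (u (basis j)) < inverse (real (Suc k))"
  shows "(\<lambda>k. arg_map (x k) m) \<longlonglongrightarrow> u m"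
proof (rule tendsto_T_N)
  fix j assume "j < n"
  show "((\<lambda>k. arg_map (x k) (basis j)) \<longlongrightarrow> u (basis j)) sequentially"
  proof (rule metric_tendsto_imp_tendsto[OF LIMSEQ_inverse_real_of_nat])
    show "eventually (\<lambda>k. dist (arg_map (x k) (basis j)) (u (basis j)) \<le> dist (inverse (real (Suc k))) 0) sequentially"
      by (intro always_eventually allI) (use less_imp_le[OF d[OF \<open>j < n\<close>]] in \<open>simp add: dist_real_def\<close>)
  qed
qed (use arg_map_mem[OF x] u in \<open>auto simp: U_N_def\<close>)

text \<open>Phase limits are defined by sequences, while the limits here run along an arbitrary
  filter. For each k a point is picked whose arguments on the basis are within 1 / (k + 1) of
  \<open>u\<close> and whose norm exceeds k.\<close>

lemma phase_limit_setI:
  assumes F: "F \<noteq> bot" and X: "X \<subseteq> T_N" and z: "eventually (\<lambda>i. z i \<in> X) F" and u: "u \<in> U_N"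
    and arg: "\<And>j. j < n \<Longrightarrow> ((\<lambda>i. arg_map (z i) (basis j)) \<longlongrightarrow> u (basis j)) F"
    and unb: "\<And>B. eventually (\<lambda>i. \<nu> (Log_map (z i)) > B) F"
  shows "u \<in> phase_limit_set \<nu> X"
proof -
  have "\<exists>x\<in>X. (\<forall>j<n. dist (arg_map x (basis j)) (u (basis j)) < inverse (real (Suc k))) \<and> \<nu> (Log_map x) > real k" for k
  proof -
    have "eventually (\<lambda>i. \<forall>j\<in>{..<n}. dist (arg_map (z i) (basis j)) (u (basis j)) < inverse (real (Suc k))) F"
      by (intro eventually_ball_finite ballI tendstoD[OF arg]) auto
    from eventually_conj[OF this eventually_conj[OF z unb[of "real k"]]] show ?thesis
      using eventually_happens[of _ F] F by blast
  qed
  then have "\<forall>k. \<exists>x. x \<in> X \<and> (\<forall>j<n. dist (arg_map x (basis j)) (u (basis j)) < inverse (real (Suc k))) \<and> \<nu> (Log_map x) > real k"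
    by blast
  from choice[OF this] obtain x where x: "\<And>k. x k \<in> X"
    "\<And>k j. j < n \<Longrightarrow> dist (arg_map (x k) (basis j)) (u (basis j)) < inverse (real (Suc k))"
    "\<And>k. \<nu> (Log_map (x k)) > real k" by blast
  have "filterlim (\<lambda>k. \<nu> (Log_map (x k))) at_top sequentially"
    by (rule filterlim_at_top_mono[OF filterlim_real_sequentially]) (intro always_eventually allI less_imp_le x(3))
  moreover have "(\<lambda>k. arg_map (x (id k))) \<longlonglongrightarrow> u"
    unfolding tendsto_fun_iff using tendsto_arg_map[OF _ u x(2)] x(1) X by auto
  ultimately show ?thesis
    unfolding phase_limit_set_def using x(1) u
    by (intro CollectI conjI exI[of _ x] exI[of _ id]) (auto simp: strict_mono_def)
qed

text \<open>An ultrafilter decides whether the norms of the logarithms are bounded: the bounded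
  alternative gives a point of \<open>X\<close> with argument \<open>u\<close>, the unbounded one a
  phase limit.\<close>

lemma closure_coamoeba:
  fixes X :: "('m \<Rightarrow> complex) set"
  assumes X: "closed_subvariety X" and \<nu>: "norm_on_R_N \<nu>"
  shows "top_of_set U_N closure_of coamoeba X = coamoeba X \<union> phase_limit_set \<nu> X"
proof -
  have XT: "X \<subseteq> T_N" using X by (auto simp: closed_subvariety_def zero_locus_def)
  have coU: "coamoeba X \<subseteq> U_N" using XT arg_map_mem by (auto simp: coamoeba_def)
  have eq: "top_of_set U_N closure_of coamoeba X = U_N \<inter> closure (coamoeba X)"
    using coU by (simp add: closure_of_subtopology inf.absorb2)
  have "coamoeba X \<union> phase_limit_set \<nu> X \<subseteq> U_N \<inter> closure (coamoeba X)"
  proof -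
    have "u \<in> closure (coamoeba X)" if uP: "u \<in> phase_limit_set \<nu> X" for u
    proof -
      obtain x and r :: "nat \<Rightarrow> nat" where x: "\<And>k. x k \<in> X" "(\<lambda>k. arg_map (x (r k))) \<longlonglongrightarrow> u"
        using uP unfolding phase_limit_set_def by blast
      have "arg_map (x (r k)) \<in> closure (coamoeba X)" for k
        by (rule subsetD[OF closure_subset]) (simp add: coamoeba_def x(1))
      then have "eventually (\<lambda>k. arg_map (x (r k)) \<in> closure (coamoeba X)) sequentially" by simp
      then show ?thesis by (rule Lim_in_closed_set[OF closed_closure _ sequentially_bot x(2)])
    qed
    moreover have "phase_limit_set \<nu> X \<subseteq> U_N" by (auto simp: phase_limit_set_def)
    ultimately show ?thesis using coU closure_subset[of "coamoeba X"] by blast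
  qed
  moreover have "u \<in> coamoeba X \<union> phase_limit_set \<nu> X" if u: "u \<in> U_N" "u \<in> closure (coamoeba X)" for u
  proof -
    have "\<exists>x\<in>X. \<forall>j<n. dist (arg_map x (basis j)) (u (basis j)) < inverse (real (Suc k))" for k
    proof -
      let ?V = "{v. \<forall>j\<in>{..<n}. v (basis j) \<in> ball (u (basis j)) (inverse (real (Suc k)))}"
      have "open ?V" by (rule product_topology_basis') simp_all
      moreover have "u \<in> ?V" by simp
      ultimately have "coamoeba X \<inter> ?V \<noteq> {}" using u(2) unfolding closure_iff_nhds_not_empty by blast
      then obtain x where "x \<in> X" "arg_map x \<in> ?V" unfolding coamoeba_def by blast
      then show ?thesis by (intro bexI[of _ x]) (simp_all add: dist_commute)
    qed
    then have "\<forall>k. \<exists>x. x \<in> X \<and> (\<forall>j<n. dist (arg_map x (basis j)) (u (basis j)) < inverse (real (Suc k)))"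
      by blast
    from choice[OF this] obtain x where x: "\<And>k. x k \<in> X"
      "\<And>k j. j < n \<Longrightarrow> dist (arg_map (x k) (basis j)) (u (basis j)) < inverse (real (Suc k))" by blast
    have xT: "x k \<in> T_N" for k using x(1) XT by blast
    have arg: "((\<lambda>k. arg_map (x k) m) \<longlongrightarrow> u m) sequentially" for m
      by (rule tendsto_arg_map[OF xT u(1) x(2)])
    obtain U where U: "ultrafilter U" "U \<le> sequentially" by (rule ultrafilter_exists[OF sequentially_bot])
    have argU: "((\<lambda>k. arg_map (x k) m) \<longlongrightarrow> u m) U" for m by (rule tendsto_mono[OF U(2) arg])
    show ?thesis
    proof (cases "\<exists>B. eventually (\<lambda>k. \<nu> (Log_map (x k)) \<le> B) U")
      case True
      then obtain B where B: "eventually (\<lambda>k. \<nu> (Log_map (x k)) \<le> B) U" by blast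
      have "\<exists>B. eventually (\<lambda>k. \<bar>Log_map (x k) (basis j)\<bar> \<le> B) U" if "j < n" for j
        by (rule norm_bounded_imp_coordinates_bounded[OF \<nu> U(1) Log_map_additive[OF xT] B that])
      then have "u \<in> coamoeba X"
        by (rule bounded_limit_in_coamoeba[OF X U(1) x(1) u(1) argU])
      then show ?thesis by blast
    next
      case False
      then have "eventually (\<lambda>k. \<nu> (Log_map (x k)) > B) U" for B
        using ultrafilter_not_eventually[OF U(1), of "\<lambda>k. \<nu> (Log_map (x k)) \<le> B"] by (simp add: not_le)
      moreover have "U \<noteq> bot" using U(1) by (simp add: ultrafilter_def)
      ultimately have "u \<in> phase_limit_set \<nu> X" using x(1) by (intro phase_limit_setI[OF _ XT _ u(1) argU]) simp_all
      then show ?thesis by blast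
    qed
  qed
  ultimately show ?thesis unfolding eq by blast
qed

lemma phase_limit_set_subset:
  fixes X :: "('m \<Rightarrow> complex) set"
  assumes X: "closed_subvariety X" and \<nu>: "norm_on_R_N \<nu>" and u: "u \<in> phase_limit_set \<nu> X"
  obtains w where "w \<in> R_N" "w \<noteq> (\<lambda>_. 0)" "u \<in> coamoeba (initial_locus w X)"
proof -
  let ?I = "vanishing_ideal X"
  have XT: "X \<subseteq> T_N" using X by (auto simp: closed_subvariety_def zero_locus_def)
  obtain x0 r where x0: "\<And>k. x0 k \<in> X" "filterlim (\<lambda>k. \<nu> (Log_map (x0 k))) at_top sequentially"
    "strict_mono r" "(\<lambda>k. arg_map (x0 (r k))) \<longlonglongrightarrow> u" and uU: "u \<in> U_N"
    using u unfolding phase_limit_set_def by blast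
  obtain U where U: "ultrafilter U" "U \<le> sequentially" by (rule ultrafilter_exists[OF sequentially_bot])
  have U0: "U \<noteq> bot" using U by (simp add: ultrafilter_def)
  define x where "x k = x0 (r k)" for k
  have xX: "x k \<in> X" and xT: "x k \<in> T_N" for k using x0(1) XT by (auto simp: x_def)
  have arg: "((\<lambda>k. arg_map (x k) m) \<longlongrightarrow> u m) U" for m
    using tendsto_mono[OF U(2) x0(4)] unfolding x_def tendsto_fun_iff by blast
  have "filterlim (\<lambda>k. \<nu> (Log_map (x k))) at_top sequentially"
    unfolding x_def by (rule filterlim_compose[OF x0(2) filterlim_subseq[OF x0(3)]])
  then have unb: "eventually (\<lambda>k. \<nu> (Log_map (x k)) > B) U" for B
    using filter_leD[OF U(2)] by (simp add: filterlim_at_top_dense)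
  \<comment> \<open>The sign makes terms of small weight dominant, in agreement with initial forms
    being taken at the minimum.\<close>
  define W where "W k m = - Log_map (x k) m" for k m
  have W: "Modules.additive (W k)" for k
    by (simp add: Modules.additive_def W_def additive.add[OF Log_map_additive[OF xT]])
  have Wx: "W k m = (\<Sum>j\<in>{..<n}. of_int (coord m j) * W k (basis j))" for k m by (rule additive_expand[OF W])
  have ca: "Modules.additive (\<lambda>m. real_of_int (coord m j))" for j by (simp add: Modules.additive_def)
  have "\<exists>w' l. (\<forall>k. Modules.additive (w' k)) \<and> Modules.additive l \<and>
    (\<forall>m. ((\<lambda>k. (\<Sum>j\<in>{..<n}. of_int (coord m j) * W k (basis j)) - w' k m) \<longlongrightarrow> l m) U) \<and>
    (\<forall>m. (\<forall>k. w' k m = 0) \<or> (\<forall>B. eventually (\<lambda>k. \<bar>w' k m\<bar> > B) U))"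
    by (rule split_convergent_part[OF U(1)]) (auto simp: ca)
  then obtain w' l where w': "\<And>k. Modules.additive (w' k)" and l: "Modules.additive l"
    and lim: "\<And>m. ((\<lambda>k. W k m - w' k m) \<longlongrightarrow> l m) U"
    and dich: "\<And>m. (\<forall>k. w' k m = 0) \<or> (\<forall>B. eventually (\<lambda>k. \<bar>w' k m\<bar> > B) U)"
    unfolding Wx[symmetric] by blast
  define y where "y m = exp (complex_of_real (- l m)) * u m" for m
  have nl: "Modules.additive (\<lambda>m. - l m)" by (simp add: Modules.additive_def additive.add[OF l])
  have y: "y \<in> T_N" "arg_map y = u" unfolding y_def by (rule arg_map_polar[OF uU nl])+
  \<comment> \<open>The bounded factor of \<open>x k\<close>: after the diverging moduli
    \<open>exp (- w' k m)\<close> are split off, it converges to \<open>y\<close>, whose argument is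
    \<open>u\<close>.\<close>
  define Y where "Y k m = exp (complex_of_real (- (W k m - w' k m))) * arg_map (x k) m" for k m
  have Y: "((\<lambda>k. Y k m) \<longlongrightarrow> y m) U" for m
    unfolding Y_def y_def by (intro tendsto_intros lim arg)
  have xY: "x k m = exp (complex_of_real (- w' k m)) * Y k m" for k m
    unfolding Y_def mult.assoc[symmetric] exp_add[symmetric] of_real_add[symmetric]
    by (subst polar[OF xT]) (simp add: W_def exp_of_real)
  define M0 where "M0 = {m. \<forall>k. w' k m = 0}"
  have dvg: "eventually (\<lambda>k. \<bar>w' k m\<bar> > B) U" if "m \<notin> M0" for m B
    using dich[of m] that unfolding M0_def by blast
  have M0sub: "a - b \<in> M0" "a + b \<in> M0" if "a \<in> M0" "b \<in> M0" for a b
    using that by (auto simp: M0_def additive.diff[OF w'] additive.add[OF w'])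
  define big where "big = {m. eventually (\<lambda>k. w' k m > 0) U}"
  have tri: "m \<in> big \<or> - m \<in> big" if "m \<notin> M0" for m
  proof (rule ccontr)
    assume neg: "\<not> ?thesis"
    have "eventually (\<lambda>k. \<bar>w' k m\<bar> > 0) U" by (rule dvg[OF that])
    moreover have "eventually (\<lambda>k. \<not> w' k m > 0) U" "eventually (\<lambda>k. \<not> w' k (- m) > 0) U"
      using neg ultrafilter_not_eventually[OF U(1)] by (auto simp: big_def)
    ultimately have "eventually (\<lambda>k. False) U"
      by eventually_elim (auto simp: additive.minus[OF w'])
    then show False using U0 by (simp add: trivial_limit_def)
  qed
  \<comment> \<open>Points at which the homomorphisms diverge are positive or negative by the
    prevailing sign; on the subgroup \<open>M0\<close>, where they vanish, the order of the
    coordinate vectors decides.\<close>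
  define P where "P = big \<union> {m \<in> M0. 0 < \<phi> m}"
  have nbM: "m \<notin> big" if "m \<in> M0" for m
    using that U0 by (auto simp: M0_def big_def trivial_limit_def)
  have P: "group_order P"
    unfolding group_order_def
  proof (intro conjI ballI allI impI)
    have "0 \<in> M0" by (simp add: M0_def additive.zero[OF w'])
    then show "0 \<notin> P" using nbM by (auto simp: P_def phi_simps)
  next
    fix a b assume ab: "a \<in> P" "b \<in> P"
    have bb: "a + b \<in> big" if "a \<in> big" "b \<in> big" for a b
      using that unfolding big_def mem_Collect_eq by eventually_elim (simp add: additive.add[OF w'])
    have bM: "a + b \<in> big" "b + a \<in> big" if "a \<in> big" "b \<in> M0" for a b
      using that by (simp_all add: big_def M0_def additive.add[OF w'])
    show "a + b \<in> P" using ab bb bM M0sub by (auto simp: P_def phi_simps add_pos_pos)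
  next
    fix a :: 'm assume "a \<noteq> 0"
    then have "\<phi> a \<noteq> 0" using phi_inj[of a 0] by (simp add: phi_simps)
    moreover have "- a \<in> M0" if "a \<in> M0" using that by (simp add: M0_def additive.minus[OF w'])
    ultimately show "a \<in> P \<or> - a \<in> P" using tri[of a] by (auto simp: P_def phi_simps)
  qed
  have I: "monomial_closed ?I" by (rule monomial_closed_vanishing_ideal[OF XT])
  obtain G where G: "graded_basis P ?I G" by (rule graded_basis_exists[OF P I])
  \<comment> \<open>All differences of exponents within basis elements: a finite set, so that one
    index \<open>k\<close> reproduces every sign in it.\<close>
  define D where "D = (\<Union>(d, g)\<in>G. \<Union>b\<in>Poly_Mapping.keys g. (\<lambda>m. m - b) ` Poly_Mapping.keys g)"
  have "finite D" unfolding D_def using G by (auto simp: graded_basis_def)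
  \<comment> \<open>This is where unboundedness enters: it forces the diverging part, and with it
    the weight chosen below, to be nonzero.\<close>
  have "\<exists>j<n. basis j \<notin> M0"
  proof (rule ccontr)
    assume "\<not> ?thesis"
    then have z: "w' k (basis j) = 0" if "j < n" for j k using that by (auto simp: M0_def)
    have "\<exists>B. eventually (\<lambda>k. \<bar>W k (basis j)\<bar> \<le> B) U" if "j < n" for j
    proof -
      have "((\<lambda>k. W k (basis j)) \<longlongrightarrow> l (basis j)) U" using lim[of "basis j"] z[OF that] by simp
      then have "eventually (\<lambda>k. dist (W k (basis j)) (l (basis j)) < 1) U" by (rule tendstoD) simp
      then have "eventually (\<lambda>k. \<bar>W k (basis j)\<bar> \<le> \<bar>l (basis j)\<bar> + 1) U"
        by (rule eventually_mono) (auto simp: dist_real_def)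
      then show ?thesis by blast
    qed
    then have "\<exists>B. eventually (\<lambda>k. \<forall>j<n. \<bar>W k (basis j)\<bar> \<le> B) U"
      by (rule additive_coordinates_bounded[of W, OF W])
    then obtain B where B: "eventually (\<lambda>k. \<forall>j<n. \<bar>W k (basis j)\<bar> \<le> B) U" by blast
    obtain C where C: "\<And>w. Modules.additive w \<Longrightarrow> \<nu> w \<le> (\<Sum>j<n. \<bar>w (basis j)\<bar> * C j)"
      using norm_le_coordinates[OF \<nu>] by blast
    have bnd: "\<nu> (Log_map (x k)) \<le> (\<Sum>j<n. B * \<bar>C j\<bar>)" if "\<forall>j<n. \<bar>W k (basis j)\<bar> \<le> B" for k
    proof -
      have "\<nu> (Log_map (x k)) \<le> (\<Sum>j<n. \<bar>Log_map (x k) (basis j)\<bar> * C j)" by (rule C[OF Log_map_additive[OF xT]])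
      also have "\<dots> \<le> (\<Sum>j<n. B * \<bar>C j\<bar>)"
      proof (intro sum_mono)
        fix j assume "j \<in> {..<n}"
        then have "\<bar>Log_map (x k) (basis j)\<bar> \<le> B" using that by (simp add: W_def)
        then have "\<bar>Log_map (x k) (basis j)\<bar> * \<bar>C j\<bar> \<le> B * \<bar>C j\<bar>" by (intro mult_right_mono) auto
        moreover have "\<bar>Log_map (x k) (basis j)\<bar> * C j \<le> \<bar>Log_map (x k) (basis j)\<bar> * \<bar>C j\<bar>" by (intro mult_left_mono) auto
        ultimately show "\<bar>Log_map (x k) (basis j)\<bar> * C j \<le> B * \<bar>C j\<bar>" by linarith
      qed
      finally show ?thesis .
    qed
    from eventually_conj[OF B unb[of "\<Sum>j<n. B * \<bar>C j\<bar>"]] have "eventually (\<lambda>k. False) U"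
      by (rule eventually_mono) (metis bnd not_le)
    then show False using U0 by (simp add: trivial_limit_def)
  qed
  then obtain j0 where j0: "basis j0 \<notin> M0" by blast
  have "eventually (\<lambda>k. \<forall>m\<in>D \<inter> big. w' k m > 0) U"
    using \<open>finite D\<close> by (intro eventually_ball_finite) (auto simp: big_def)
  moreover have "eventually (\<lambda>k. \<bar>w' k (basis j0)\<bar> > 0) U" by (rule dvg[OF j0])
  ultimately have "eventually (\<lambda>k. (\<forall>m\<in>D \<inter> big. w' k m > 0) \<and> \<bar>w' k (basis j0)\<bar> > 0) U" by (rule eventually_conj)
  then obtain k where k: "\<forall>m\<in>D \<inter> big. w' k m > 0" "\<bar>w' k (basis j0)\<bar> > 0"
    using eventually_happens[of _ U] U0 by blast
  define w where "w = w' k"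
  have w: "Modules.additive w" "w \<noteq> (\<lambda>_. 0)" using w' k(2) by (auto simp: w_def)
  have wM0: "w m = 0" if "m \<in> M0" for m using that by (simp add: w_def M0_def)
  \<comment> \<open>Ties of the weight \<open>w\<close> are broken by \<open>P\<close>, so that
    leading terms for \<open>P'\<close> have minimal weight.\<close>
  define P' where "P' = {m. w m > 0 \<or> (w m = 0 \<and> m \<in> P)}"
  have P': "group_order P'"
    unfolding group_order_def
  proof (intro conjI ballI allI impI)
    show "0 \<notin> P'" using P by (simp add: P'_def group_order_def additive.zero[OF w(1)])
  next
    fix a b assume "a \<in> P'" "b \<in> P'"
    then show "a + b \<in> P'" using group_order_add[OF P, of a b] by (auto simp: P'_def additive.add[OF w(1)])
  next
    fix a :: 'm assume "a \<noteq> 0"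
    then have "a \<in> P \<or> - a \<in> P" using P by (auto simp: group_order_def)
    then show "a \<in> P' \<or> - a \<in> P'" by (auto simp: P'_def additive.minus[OF w(1)])
  qed
  have keyD: "m - b \<in> D" if "(d, g) \<in> G" "m \<in> Poly_Mapping.keys g" "b \<in> Poly_Mapping.keys g" for d g m b
    unfolding D_def using that by blast
  have same: "leading P' g b" if g: "(d, g) \<in> G" "leading P g b" for d g b
    unfolding leading_def
  proof (intro conjI ballI impI)
    show b: "b \<in> Poly_Mapping.keys g" using g(2) by (simp add: leading_def)
    fix m assume m: "m \<in> Poly_Mapping.keys g" "m \<noteq> b"
    then have mb: "m - b \<in> P" using g(2) by (simp add: leading_def)
    show "m - b \<in> P'"
    proof (cases "m - b \<in> big")
      case True
      then show ?thesis using k(1) keyD[OF g(1) m(1) b] by (auto simp: P'_def w_def)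
    next
      case False
      then show ?thesis using mb wM0 by (auto simp: P_def P'_def)
    qed
  qed
  have G': "graded_basis P' ?I G" by (rule graded_basis_change_order[OF P P' I G same])
  have Gy: "partial_eval w (w b) y g = 0" if g: "(d, g) \<in> G" "leading P' g b" for d g b
  proof -
    have gI: "g \<in> ?I" "g \<noteq> 0" using G g(1) by (auto simp: graded_basis_def)
    obtain b' where b': "leading P g b'" by (rule leading_exists[OF P gI(2)])
    have "b' = b" by (rule leading_unique[OF P' same[OF g(1) b'] g(2)])
    then have b: "leading P g b" using b' by simp
    then have bk: "b \<in> Poly_Mapping.keys g" by (simp add: leading_def)
    \<comment> \<open>After division by the size of the term at \<open>b\<close>, terms that differ
      from it by an element of \<open>M0\<close> converge to their value at \<open>y\<close>, and
      the others decay. By the choice of \<open>k\<close>, these are exactly the terms of the same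
      weight as \<open>b\<close> and those of larger weight.\<close>
    have summand: "((\<lambda>i. exp (complex_of_real (- w' i (m - b))) * Y i m) \<longlongrightarrow> (if w m = w b then y m else 0)) U"
      if m: "m \<in> Poly_Mapping.keys g" for m
    proof (cases "m - b \<in> M0")
      case True
      then have "w m = w b" using wM0[OF True] by (simp add: additive.diff[OF w(1)])
      then show ?thesis using True Y[of m] by (simp add: M0_def)
    next
      case False
      have "m \<noteq> b" using False by (auto simp: M0_def additive.zero[OF w'])
      then have "m - b \<in> P" using b m by (simp add: leading_def)
      then have mb: "m - b \<in> big" using False by (simp add: P_def)
      have "w (m - b) > 0" using k(1) mb keyD[OF g(1) m bk] by (simp add: w_def)
      then have ne: "w m \<noteq> w b" by (simp add: additive.diff[OF w(1)])
      have "eventually (\<lambda>i. B \<le> w' i (m - b)) U" for B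
      proof -
        have "eventually (\<lambda>i. \<bar>w' i (m - b)\<bar> > B) U" by (rule dvg[OF False])
        moreover have "eventually (\<lambda>i. w' i (m - b) > 0) U" using mb by (simp add: big_def)
        ultimately show ?thesis by eventually_elim auto
      qed
      then have "filterlim (\<lambda>i. w' i (m - b)) at_top U" by (simp add: filterlim_at_top)
      then have "((\<lambda>i. exp (- w' i (m - b))) \<longlongrightarrow> 0) U"
        by (intro filterlim_compose[OF exp_at_bot]) (simp add: filterlim_uminus_at_bot)
      then have "((\<lambda>i. complex_of_real (exp (- w' i (m - b)))) \<longlongrightarrow> complex_of_real 0) U" by (rule tendsto_of_real)
      then have "((\<lambda>i. complex_of_real (exp (- w' i (m - b))) * Y i m) \<longlongrightarrow> complex_of_real 0 * y m) U"
        by (rule tendsto_mult[OF _ Y])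
      then show ?thesis using ne by (simp add: exp_of_real del: of_real_minus)
    qed
    have "((\<lambda>i. \<Sum>m\<in>Poly_Mapping.keys g. Poly_Mapping.lookup g m * (exp (complex_of_real (- w' i (m - b))) * Y i m)) \<longlongrightarrow>
      (\<Sum>m\<in>Poly_Mapping.keys g. Poly_Mapping.lookup g m * (if w m = w b then y m else 0))) U"
      by (intro tendsto_sum tendsto_mult tendsto_const summand)
    moreover have "(\<Sum>m\<in>Poly_Mapping.keys g. Poly_Mapping.lookup g m * (exp (complex_of_real (- w' i (m - b))) * Y i m)) = 0" for i
    proof -
      have "(\<Sum>m\<in>Poly_Mapping.keys g. Poly_Mapping.lookup g m * (exp (complex_of_real (- w' i (m - b))) * Y i m)) =
        exp (complex_of_real (w' i b)) * laurent_eval g (x i)"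
        unfolding laurent_eval_def sum_distrib_left
      proof (intro sum.cong refl)
        fix m
        have "exp (complex_of_real (- w' i (m - b))) = exp (complex_of_real (w' i b)) * exp (complex_of_real (- w' i m))"
          unfolding exp_add[symmetric] by (simp add: additive.diff[OF w'])
        then show "Poly_Mapping.lookup g m * (exp (complex_of_real (- w' i (m - b))) * Y i m) =
          exp (complex_of_real (w' i b)) * (Poly_Mapping.lookup g m * x i m)" by (simp add: xY[of i m])
      qed
      also have "laurent_eval g (x i) = 0" using gI(1) xX by (simp add: vanishing_ideal_def)
      finally show ?thesis by simp
    qed
    ultimately have "((\<lambda>i. 0) \<longlongrightarrow> partial_eval w (w b) y g) U" by (simp add: partial_eval_def poly_eval_def)
    then show ?thesis using U0 by (simp add: tendsto_const_iff)
  qed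
  have "partial_eval w (weight w f) y f = 0" if f: "f \<in> ?I" "f \<noteq> 0" for f
  proof (rule partial_eval_reduction[OF P' I G' w(1) _ _ Gy f(1)])
    show "0 \<le> w m" if "m \<in> P'" for m using that by (auto simp: P'_def)
    show "y (a + b) = y a * y b" for a b using y(1) by (simp add: T_N_def)
    show "weight w f \<le> w m" if "m \<in> Poly_Mapping.keys f" for m
      unfolding weight_def using that by (intro Min_le) auto
  qed
  then have "y \<in> initial_locus w X" using y(1) by (simp add: mem_initial_locus_iff)
  then have "u \<in> coamoeba (initial_locus w X)" unfolding coamoeba_def using y(2) by blast
  then show thesis using that w by (simp add: R_N_def)
qed

end

section \<open>Points with a given initial point\<close>

lemma subfield_on_fractions:
  assumes R: "1 \<in> R" "\<And>a b. a \<in> R \<Longrightarrow> b \<in> R \<Longrightarrow> a - b \<in> R" "\<And>a b. a \<in> R \<Longrightarrow> b \<in> R \<Longrightarrow> a * b \<in> R"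
  shows "subfield_on {u / v | u v. u \<in> R \<and> v \<in> R \<and> v \<noteq> (0::'k::field)}"
proof -
  let ?L = "{u / v | u v. u \<in> R \<and> v \<in> R \<and> v \<noteq> 0}"
  have I: "u / v \<in> ?L" if "u \<in> R" "v \<in> R" "v \<noteq> 0" for u v using that by blast
  have 0: "0 \<in> R" using R(2)[OF R(1) R(1)] by simp
  show ?thesis
    unfolding subfield_on_def
  proof (intro conjI ballI)
    show "1 \<in> ?L" using I[OF R(1) R(1)] by simp
    fix a b assume "a \<in> ?L" "b \<in> ?L"
    then obtain u v u' v' where ab: "a = u / v" "b = u' / v'" and uv: "u \<in> R" "v \<in> R" "v \<noteq> 0" "u' \<in> R" "v' \<in> R" "v' \<noteq> 0"
      by blast
    have "a - b = (u * v' - u' * v) / (v * v')" "a * b = (u * u') / (v * v')" using uv by (simp_all add: ab field_simps)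
    then show "a - b \<in> ?L" "a * b \<in> ?L" using uv R by (simp_all only: I R mult_eq_0_iff de_Morgan_disj simp_thms)
    show "inverse a \<in> ?L"
    proof (cases "u = 0")
      case True
      then show ?thesis using I[OF 0 R(1)] by (simp add: ab)
    next
      case False
      then show ?thesis using I[OF uv(2,1)] by (simp add: ab)
    qed
  qed
qed

text \<open>\<open>L\<close> consists of the quotients of finite sums of terms c t^s with real s. A
  nonzero sum is its lowest power of t times an element whose residue at either place is the lowest
  coefficient, so exponents and coefficients alone determine the residue of a quotient.\<close>

lemma puiseux_subfield:
  fixes \<Phi> \<Phi>' :: "('k::field \<times> complex) set" and \<iota> :: "complex \<Rightarrow> 'k" and \<tau> :: "real \<Rightarrow> 'k"
  assumes place: "place \<Phi>" "place \<Phi>'"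
    and \<iota>: "\<And>a b. \<iota> (a + b) = \<iota> a + \<iota> b" "\<And>a b. \<iota> (a * b) = \<iota> a * \<iota> b" "\<iota> 1 = 1" "\<And>a. (\<iota> a, a) \<in> \<Phi>" "\<And>a. (\<iota> a, a) \<in> \<Phi>'"
    and \<tau>: "\<And>r s. \<tau> (r + s) = \<tau> r * \<tau> s" "\<tau> 0 = 1" "\<And>s. s > 0 \<Longrightarrow> (\<tau> s, 0) \<in> \<Phi>" "\<And>s. s > 0 \<Longrightarrow> (\<tau> s, 0) \<in> \<Phi>'"
  shows "\<exists>L. subfield_on L \<and> range \<iota> \<subseteq> L \<and> range \<tau> \<subseteq> L \<and> (\<forall>x y. x \<in> L \<longrightarrow> (x, y) \<in> \<Phi> \<longrightarrow> (x, y) \<in> \<Phi>')"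
proof -
  define R where "R = range (poly_eval \<iota> \<tau>)"
  have "\<iota> 0 + 0 = \<iota> 0 + \<iota> 0" using \<iota>(1)[of 0 0] by (simp only: add_0_right)
  then have \<iota>0: "\<iota> 0 = 0" by (simp only: add_left_cancel)
  have \<tau>nz: "\<tau> s \<noteq> 0" for s using \<tau>(1)[of s "- s"] \<tau>(2) by auto
  have R: "1 \<in> R" "\<And>a b. a \<in> R \<Longrightarrow> b \<in> R \<Longrightarrow> a - b \<in> R" "\<And>a b. a \<in> R \<Longrightarrow> b \<in> R \<Longrightarrow> a * b \<in> R"
    and \<iota>R: "\<iota> a \<in> R" and \<tau>R: "\<tau> s \<in> R" for a s
  proof -
    have single: "\<iota> c * \<tau> s \<in> R" for c s
      unfolding R_def by (rule range_eqI[of _ _ "Poly_Mapping.single s c"]) (simp add: poly_eval_single \<iota>0)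
    show "1 \<in> R" "\<iota> a \<in> R" "\<tau> s \<in> R" using single[of 1 0] single[of a 0] single[of 1 s] by (simp_all add: \<iota>(3) \<tau>(2))
    fix a b assume "a \<in> R" "b \<in> R"
    then obtain f g where fg: "a = poly_eval \<iota> \<tau> f" "b = poly_eval \<iota> \<tau> g" unfolding R_def by blast
    have "a - b = poly_eval \<iota> \<tau> (f - g)" unfolding fg by (rule poly_eval_diff[symmetric, OF \<iota>(1)])
    moreover have "a * b = poly_eval \<iota> \<tau> (f * g)" unfolding fg by (rule poly_eval_mult_on[symmetric, OF \<iota>(1,2) \<tau>(1)])
    ultimately show "a - b \<in> R" "a * b \<in> R" unfolding R_def by blast+
  qed
  have unit: "\<exists>s u \<alpha>. r = \<tau> s * u \<and> \<alpha> \<noteq> 0 \<and> (u, \<alpha>) \<in> \<Phi> \<and> (u, \<alpha>) \<in> \<Phi>'" if r: "r \<in> R" "r \<noteq> 0" for r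
  proof -
    obtain f where f: "r = poly_eval \<iota> \<tau> f" using r(1) unfolding R_def by blast
    let ?K = "Poly_Mapping.keys f"
    let ?s = "Min ?K" and ?c = "Poly_Mapping.lookup f"
    have ne: "?K \<noteq> {}" using r(2) by (auto simp: f poly_eval_def)
    let ?u = "\<Sum>s\<in>?K. \<iota> (?c s) * \<tau> (s - ?s)"
    have "r = \<tau> ?s * ?u"
      unfolding f poly_eval_def sum_distrib_left
      by (intro sum.cong refl) (simp add: mult.left_commute flip: \<tau>(1))
    moreover have "?c ?s \<noteq> 0" using Min_in[OF _ ne] by (simp add: in_keys_iff)
    moreover have "(?u, ?c ?s) \<in> \<Psi>" if \<Psi>: "place \<Psi>" "\<And>a. (\<iota> a, a) \<in> \<Psi>" "\<And>s. s > 0 \<Longrightarrow> (\<tau> s, 0) \<in> \<Psi>" for \<Psi> :: "('k \<times> complex) set"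
    proof -
      note h = place_imp_hom_graph[OF \<Psi>(1)]
      have "(\<iota> (?c s) * \<tau> (s - ?s), if s = ?s then ?c ?s else 0) \<in> \<Psi>" if "s \<in> ?K" for s
      proof (cases "s = ?s")
        case True
        then show ?thesis using \<Psi>(2) by (simp add: \<tau>(2))
      next
        case False
        then have "s - ?s > 0" using Min_le[OF _ that] by simp
        from hom_graph_mult[OF h \<Psi>(2) \<Psi>(3)[OF this], of "?c s"] show ?thesis using False by simp
      qed
      then have "(?u, \<Sum>s\<in>?K. if s = ?s then ?c ?s else 0) \<in> \<Psi>" by (rule hom_graph_sum[OF h])
      then show ?thesis using Min_in[OF _ ne] by (simp add: sum.delta)
    qed
    note this[OF place(1) \<iota>(4) \<tau>(3)] this[OF place(2) \<iota>(5) \<tau>(4)]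
    ultimately show ?thesis by blast
  qed
  let ?L = "{u / v | u v. u \<in> R \<and> v \<in> R \<and> v \<noteq> 0}"
  have L: "subfield_on ?L" by (rule subfield_on_fractions[OF R])
  have RL: "r \<in> ?L" if "r \<in> R" for r using that R(1) by (intro CollectI exI[of _ r] exI[of _ 1]) simp
  have agree: "(x, y) \<in> \<Phi>'" if x: "x \<in> ?L" "(x, y) \<in> \<Phi>" for x y
  proof -
    note h = place_imp_hom_graph[OF place(1)] and h' = place_imp_hom_graph[OF place(2)]
    obtain a b where ab: "x = a / b" "a \<in> R" "b \<in> R" "b \<noteq> 0" using x(1) by blast
    show ?thesis
    proof (cases "a = 0")
      case True
      then have "x = 0" by (simp add: ab)
      then have "y = 0" using hom_graph_zeroD[OF h, of y] x(2) by simp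
      then show ?thesis using hom_graph_zero[OF h'] \<open>x = 0\<close> by simp
    next
      case False
      obtain s u \<alpha> where u: "a = \<tau> s * u" "\<alpha> \<noteq> 0" "(u, \<alpha>) \<in> \<Phi>" "(u, \<alpha>) \<in> \<Phi>'" using unit[OF ab(2) False] by blast
      obtain r v \<beta> where v: "b = \<tau> r * v" "\<beta> \<noteq> 0" "(v, \<beta>) \<in> \<Phi>" "(v, \<beta>) \<in> \<Phi>'" using unit[OF ab(3,4)] by blast
      define q \<gamma> where "q = u * inverse v" and "\<gamma> = \<alpha> * inverse \<beta>"
      have q: "(q, \<gamma>) \<in> \<Phi>" "(q, \<gamma>) \<in> \<Phi>'" "\<gamma> \<noteq> 0"
        unfolding q_def \<gamma>_def using u v
        by (auto intro!: hom_graph_mult[OF h] hom_graph_mult[OF h'] hom_graph_inverse_if_place[OF h place(1)] hom_graph_inverse_if_place[OF h' place(2)])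
      have \<tau>q: "\<tau> (r - s) * \<tau> s = \<tau> r" "\<tau> (s - r) * \<tau> r = \<tau> s" by (simp_all flip: \<tau>(1))
      have xq: "x = \<tau> (s - r) * q" using \<tau>nz[of r] by (simp add: ab(1) u(1) v(1) q_def divide_inverse flip: \<tau>q(2))
      consider "s = r" | "s > r" | "s < r" by linarith
      then show ?thesis
      proof cases
        case 1
        then have "x = q" by (simp add: xq \<tau>(2))
        then show ?thesis using hom_graph_unique[OF h x(2)] q by auto
      next
        case 2
        then have "(x, 0) \<in> \<Phi>" "(x, 0) \<in> \<Phi>'"
          using hom_graph_mult[OF h \<tau>(3) q(1), of "s - r"] hom_graph_mult[OF h' \<tau>(4) q(2), of "s - r"] by (simp_all add: xq)
        then show ?thesis using hom_graph_unique[OF h x(2)] by auto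
      next
        case 3
        \<comment> \<open>A quotient of negative order is infinitely large and has no residue, so
          this case is contradictory.\<close>
        have "\<tau> (r - s) * x = q" by (simp add: xq \<tau>(2) flip: mult.assoc \<tau>(1))
        moreover have "(\<tau> (r - s) * x, 0 * y) \<in> \<Phi>" by (rule hom_graph_mult[OF h \<tau>(3) x(2)]) (use 3 in simp)
        ultimately have "(q, 0) \<in> \<Phi>" by simp
        then show ?thesis using hom_graph_unique[OF h q(1)] q(3) by auto
      qed
    qed
  qed
  show ?thesis
    by (intro exI[of _ ?L] conjI L image_subsetI RL[OF \<iota>R] RL[OF \<tau>R] allI impI) (rule agree)
qed

text \<open>Dividing by the smallest power with nonzero coefficient and letting \<open>t\<close>
  tend to 0 isolates that coefficient.\<close>

lemma powr_independent:
  assumes B: "finite B" and "\<epsilon> > 0" and *: "\<And>t. 0 < t \<Longrightarrow> t < \<epsilon> \<Longrightarrow> (\<Sum>s\<in>B. a s * complex_of_real (t powr s)) = 0"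
    and "s \<in> B"
  shows "a s = 0"
proof (rule ccontr)
  assume "a s \<noteq> 0"
  define B' where "B' = {s \<in> B. a s \<noteq> 0}"
  have B': "finite B'" "B' \<noteq> {}" using B \<open>a s \<noteq> 0\<close> \<open>s \<in> B\<close> by (auto simp: B'_def)
  define s0 where "s0 = Min B'"
  have s0: "s0 \<in> B'" unfolding s0_def using B' by (rule Min_in)
  have ev: "eventually (\<lambda>t. t \<in> {0<..<\<epsilon>}) (at_right 0)" using \<open>\<epsilon> > 0\<close> by (rule eventually_at_right_real)
  have lim: "((\<lambda>t. a s * complex_of_real (t powr (s - s0))) \<longlongrightarrow> (if s = s0 then a s0 else 0)) (at_right 0)" if "s \<in> B'" for s
  proof (cases "s = s0")
    case True
    have "eventually (\<lambda>t. a s * complex_of_real (t powr (s - s0)) = a s0) (at_right 0)"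
      using ev by eventually_elim (simp add: True)
    then show ?thesis using True by (simp add: tendsto_eventually)
  next
    case False
    then have pos: "s - s0 > 0" using Min_le[OF B'(1) that] by (simp add: s0_def)
    have nn: "eventually (\<lambda>t. 0 \<le> t) (at_right (0::real))" using ev by eventually_elim simp
    have "((\<lambda>t. t powr (s - s0)) \<longlongrightarrow> 0 powr (s - s0)) (at_right 0)"
      by (rule tendsto_powr'[OF tendsto_ident_at tendsto_const]) (intro disjI2 conjI pos nn)
    then have "((\<lambda>t. a s * complex_of_real (t powr (s - s0))) \<longlongrightarrow> a s * of_real (0 powr (s - s0))) (at_right 0)"
      by (rule tendsto_mult[OF tendsto_const tendsto_of_real])
    then show ?thesis using False by simp
  qed
  have "((\<lambda>t. \<Sum>s\<in>B'. a s * complex_of_real (t powr (s - s0))) \<longlongrightarrow> (\<Sum>s\<in>B'. if s = s0 then a s0 else 0)) (at_right 0)"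
    by (intro tendsto_sum lim)
  then have "((\<lambda>t. \<Sum>s\<in>B'. a s * complex_of_real (t powr (s - s0))) \<longlongrightarrow> a s0) (at_right 0)"
    using s0 B'(1) by (simp add: sum.delta)
  moreover have "eventually (\<lambda>t. (\<Sum>s\<in>B'. a s * complex_of_real (t powr (s - s0))) = 0) (at_right 0)"
    using ev
  proof eventually_elim
    case (elim t)
    have "(\<Sum>s\<in>B'. a s * complex_of_real (t powr (s - s0))) = (\<Sum>s\<in>B'. a s * complex_of_real (t powr s)) * of_real (t powr (- s0))"
      unfolding sum_distrib_right by (intro sum.cong refl) (simp add: powr_diff powr_minus divide_inverse)
    also have "(\<Sum>s\<in>B'. a s * complex_of_real (t powr s)) = (\<Sum>s\<in>B. a s * complex_of_real (t powr s))"
      unfolding B'_def using B by (intro sum.mono_neutral_left) auto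
    finally show ?case using *[of t] elim by simp
  qed
  then have "((\<lambda>t. \<Sum>s\<in>B'. a s * complex_of_real (t powr (s - s0))) \<longlongrightarrow> 0) (at_right 0)" by (rule tendsto_eventually)
  ultimately have "a s0 = 0" by (rule tendsto_unique[OF trivial_limit_at_right_real])
  then show False using s0 by (simp add: B'_def)
qed

text \<open>
  The pair \<open>(m, s)\<close> stands for the monomial \<open>\<xi>\<^sup>m t\<^sup>s\<close>.  The polynomials in \<open>shifted_polys w\<close> stay
  bounded along a path \<open>\<xi>\<^sup>m = t powr w m * y m\<close> with \<open>t \<rightarrow> 0\<close>, and \<open>residue_eval w y\<close> is their limit.
\<close>
definition shifted_polys :: "('m::ab_group_add \<Rightarrow> real) \<Rightarrow> ('m \<times> real \<Rightarrow>\<^sub>0 complex) set" where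
  "shifted_polys w = {G. \<forall>k\<in>Poly_Mapping.keys G. 0 \<le> snd k + w (fst k)}"

definition residue_eval :: "('m::ab_group_add \<Rightarrow> real) \<Rightarrow> ('m \<Rightarrow> complex) \<Rightarrow> ('m \<times> real \<Rightarrow>\<^sub>0 complex) \<Rightarrow> complex" where
  "residue_eval w y = poly_eval (\<lambda>c. c) (\<lambda>k. if snd k + w (fst k) = 0 then y (fst k) else 0)"

definition curve_eval :: "('m::ab_group_add \<Rightarrow> complex) \<Rightarrow> real \<Rightarrow> ('m \<times> real \<Rightarrow>\<^sub>0 complex) \<Rightarrow> complex" where
  "curve_eval x t = poly_eval (\<lambda>c. c) (\<lambda>k. x (fst k) * complex_of_real (t powr snd k))"

lemma curve_eval_ops:
  assumes "x \<in> T_N"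
  shows "curve_eval x t (F - G) = curve_eval x t F - curve_eval x t G" "curve_eval x t (F * G) = curve_eval x t F * curve_eval x t G"
  unfolding curve_eval_def using assms
  by (intro poly_eval_diff poly_eval_mult_on; simp add: T_N_def powr_add)+

lemma residue_eval_ops:
  assumes w: "Modules.additive w" and y: "y \<in> T_N" and FG: "F \<in> shifted_polys w" "G \<in> shifted_polys w"
  shows "F - G \<in> shifted_polys w" "F * G \<in> shifted_polys w"
    "residue_eval w y (F - G) = residue_eval w y F - residue_eval w y G" "residue_eval w y (F * G) = residue_eval w y F * residue_eval w y G"
proof -
  show "F - G \<in> shifted_polys w"
    using FG keys_diff[of F G] unfolding shifted_polys_def by blast
  show "F * G \<in> shifted_polys w"
    unfolding shifted_polys_def
  proof (intro CollectI ballI)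
    fix k assume "k \<in> Poly_Mapping.keys (F * G)"
    then obtain a b where "k = a + b" "a \<in> Poly_Mapping.keys F" "b \<in> Poly_Mapping.keys G" using keys_mult[of F G] by blast
    moreover from this FG have "0 \<le> snd a + w (fst a)" "0 \<le> snd b + w (fst b)" by (simp_all add: shifted_polys_def)
    ultimately show "0 \<le> snd k + w (fst k)" by (simp add: additive.add[OF w])
  qed
  show "residue_eval w y (F - G) = residue_eval w y F - residue_eval w y G"
    unfolding residue_eval_def by (rule poly_eval_diff) simp
  show "residue_eval w y (F * G) = residue_eval w y F * residue_eval w y G"
    unfolding residue_eval_def
  proof (rule poly_eval_mult_on)
    fix a b assume "a \<in> Poly_Mapping.keys F" "b \<in> Poly_Mapping.keys G"
    with FG have "0 \<le> snd a + w (fst a)" "0 \<le> snd b + w (fst b)" by (simp_all add: shifted_polys_def)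
    \<comment> \<open>Two nonnegative orders have sum 0 only if both are 0, which makes the residue
      multiplicative.\<close>
    then have "snd (a + b) + w (fst (a + b)) = 0 \<longleftrightarrow> snd a + w (fst a) = 0 \<and> snd b + w (fst b) = 0"
      by (simp add: additive.add[OF w]) linarith
    then show "(if snd (a + b) + w (fst (a + b)) = 0 then y (fst (a + b)) else 0) =
      (if snd a + w (fst a) = 0 then y (fst a) else 0) * (if snd b + w (fst b) = 0 then y (fst b) else 0)"
      using y by (simp add: T_N_def)
  qed simp_all
qed

text \<open>If \<open>G\<close> vanished for all points of \<open>X\<close> and all small
  \<open>t\<close>, the coefficients of the separate powers of \<open>t\<close> would lie in the
  ideal of \<open>X\<close>. Their parts of weight \<open>- s\<close> vanish at the initial point
  \<open>y\<close>, and the residue of \<open>G\<close> is the sum of these parts.\<close>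

lemma nonvanishing_near_zero:
  assumes y: "y \<in> initial_locus w X" and G: "G \<in> shifted_polys w" "residue_eval w y G \<noteq> 0" and "\<epsilon> > 0"
  shows "\<exists>x\<in>X. \<exists>t. 0 < t \<and> t < \<epsilon> \<and> curve_eval x t G \<noteq> 0"
proof (rule ccontr)
  assume neg: "\<not> ?thesis"
  let ?A = "fst ` Poly_Mapping.keys G" and ?B = "snd ` Poly_Mapping.keys G"
  define f where "f s = (\<Sum>m\<in>?A. Poly_Mapping.single m (Poly_Mapping.lookup G (m, s)))" for s
  have AB: "finite ?A" "finite ?B" "Poly_Mapping.keys G \<subseteq> ?A \<times> ?B" by force+
  have lf: "Poly_Mapping.lookup (f s) m = Poly_Mapping.lookup G (m, s)" for s m
  proof -
    have "Poly_Mapping.lookup (f s) m = (\<Sum>k\<in>?A. if k = m then Poly_Mapping.lookup G (m, s) else 0)"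
      unfolding f_def lookup_sum by (intro sum.cong) (auto simp: lookup_single when_def)
    moreover have "Poly_Mapping.lookup G (m, s) = 0" if "m \<notin> ?A"
      using that by (metis fst_conv image_eqI in_keys_iff)
    ultimately show ?thesis using AB(1) by (cases "m \<in> ?A") (simp_all add: sum.delta)
  qed
  then have kf: "Poly_Mapping.keys (f s) \<subseteq> ?A" for s by (force simp: in_keys_iff image_iff)
  have slice: "poly_eval (\<lambda>c. c) \<xi> G = (\<Sum>s\<in>?B. poly_eval (\<lambda>c. c) (\<lambda>m. \<xi> (m, s)) (f s))" for \<xi> :: "_ \<Rightarrow> complex"
  proof -
    have "poly_eval (\<lambda>c. c) \<xi> G = (\<Sum>k\<in>?A \<times> ?B. Poly_Mapping.lookup G k * \<xi> k)"
      by (rule poly_eval_superset) (use AB in simp_all)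
    also have "\<dots> = (\<Sum>m\<in>?A. \<Sum>s\<in>?B. Poly_Mapping.lookup G (m, s) * \<xi> (m, s))" by (simp add: sum.cartesian_product)
    also have "\<dots> = (\<Sum>s\<in>?B. \<Sum>m\<in>?A. Poly_Mapping.lookup G (m, s) * \<xi> (m, s))" by (rule sum.swap)
    also have "\<dots> = (\<Sum>s\<in>?B. poly_eval (\<lambda>c. c) (\<lambda>m. \<xi> (m, s)) (f s))"
      by (intro sum.cong refl) (simp add: poly_eval_superset[OF AB(1) kf] lf)
    finally show ?thesis .
  qed
  have fI: "f s \<in> vanishing_ideal X" if "s \<in> ?B" for s
    unfolding vanishing_ideal_def
  proof (intro CollectI ballI)
    fix x assume "x \<in> X"
    have "(\<Sum>s\<in>?B. laurent_eval (f s) x * complex_of_real (t powr s)) = 0" if "0 < t" "t < \<epsilon>" for t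
    proof -
      have "(\<Sum>s\<in>?B. laurent_eval (f s) x * complex_of_real (t powr s)) = curve_eval x t G"
        unfolding curve_eval_def slice
        unfolding laurent_eval_def poly_eval_def sum_distrib_right
        by (intro sum.cong refl) simp
      then show ?thesis using neg \<open>x \<in> X\<close> that by auto
    qed
    from powr_independent[OF AB(2) \<open>\<epsilon> > 0\<close> this \<open>s \<in> ?B\<close>] show "laurent_eval (f s) x = 0" .
  qed
  have "partial_eval w (- s) y (f s) = 0" if "s \<in> ?B" for s
  proof (cases "f s = 0")
    case True
    then show ?thesis by (simp add: partial_eval_def poly_eval_def)
  next
    case False
    have ge: "- s \<le> w m" if "m \<in> Poly_Mapping.keys (f s)" for m
    proof -
      have "(m, s) \<in> Poly_Mapping.keys G" using that by (simp add: in_keys_iff lf)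
      then show ?thesis using G(1) by (force simp: shifted_polys_def)
    qed
    show ?thesis
    \<comment> \<open>Membership in \<open>shifted_polys w\<close> bounds the weight of
      \<open>f s\<close> below by \<open>- s\<close>; in the case of equality the part in question
      is the initial form.\<close>
    proof (cases "weight w (f s) = - s")
      case True
      then show ?thesis using y fI[OF that] False unfolding mem_initial_locus_iff by metis
    next
      case neq: False
      have ne: "w ` Poly_Mapping.keys (f s) \<noteq> {}" using False by simp
      show ?thesis
      proof (rule partial_eval_eq_0)
        fix k assume "k \<in> Poly_Mapping.keys (f s)"
        then have "weight w (f s) \<le> w k" unfolding weight_def by (intro Min_le) auto
        moreover have "- s \<le> weight w (f s)" unfolding weight_def using ne ge by (intro Min.boundedI) auto
        ultimately show "- s < w k" using neq by linarith
      qed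
    qed
  qed
  moreover have "residue_eval w y G = (\<Sum>s\<in>?B. partial_eval w (- s) y (f s))"
    unfolding residue_eval_def slice
    unfolding partial_eval_def
    by (intro sum.cong arg_cong2[where f = "poly_eval (\<lambda>c. c)"] ext refl) (auto simp: add_eq_0_iff)
  ultimately show False using G(2) by simp
qed

text \<open>Residues are multiplicative, so one point with nonvanishing product handles finitely
  many polynomials of nonzero residue at once. At the index \<open>S\<close> this is done for those
  in \<open>S\<close>.\<close>

lemma generic_family:
  fixes w :: "'m::ab_group_add \<Rightarrow> real"
  assumes w: "Modules.additive w" and y: "y \<in> initial_locus w X" and X: "X \<subseteq> T_N"
  shows "\<exists>(x :: ('m \<times> real \<Rightarrow>\<^sub>0 complex) set \<Rightarrow> 'm \<Rightarrow> complex) t. (\<forall>S. x S \<in> X) \<and> (\<forall>S. 0 < t S) \<and> (t \<longlongrightarrow> 0) index_ultrafilter \<and>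
    (\<forall>G\<in>shifted_polys w. residue_eval w y G \<noteq> 0 \<longrightarrow> eventually (\<lambda>S. curve_eval (x S) (t S) G \<noteq> 0) index_ultrafilter)"
proof -
  have yT: "y \<in> T_N" using y by (simp add: mem_initial_locus_iff)
  define good where "good = {G \<in> shifted_polys w. residue_eval w y G \<noteq> 0}"
  have one: "1 \<in> good"
    unfolding good_def shifted_polys_def residue_eval_def using yT
    by (simp add: poly_eval_def additive.zero[OF w] T_N_def)
  have prod: "prod (\<lambda>G. G) A \<in> good" if "A \<subseteq> good" for A
    using that
  proof (induction A rule: infinite_finite_induct)
    case (insert G A)
    then have "G \<in> good" "prod (\<lambda>G. G) A \<in> good" by auto
    then show ?case using insert(1,2) residue_eval_ops(2,4)[OF w yT] by (simp add: good_def)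
  qed (use one in simp_all)
  \<comment> \<open>The bound forces \<open>t\<close> to tend to 0: as soon as a finite
    \<open>S\<close> contains the constant polynomial \<open>1 / \<delta>\<close>, it is below
    \<open>\<delta>\<close>. For infinite \<open>S\<close> the sum has the default value 0, and the
    bound is still positive.\<close>
  define \<epsilon> where "\<epsilon> S = 1 / (1 + (\<Sum>G\<in>S. cmod (Poly_Mapping.lookup G 0)))" for S :: "('m \<times> real \<Rightarrow>\<^sub>0 complex) set"
  have "\<forall>S. \<exists>p. fst p \<in> X \<and> 0 < snd p \<and> snd p < \<epsilon> S \<and> curve_eval (fst p) (snd p) (\<Prod>G\<in>S \<inter> good. G) \<noteq> 0"
  proof
    fix S :: "('m \<times> real \<Rightarrow>\<^sub>0 complex) set"
    have "0 \<le> (\<Sum>G\<in>S. cmod (Poly_Mapping.lookup G 0))" by (intro sum_nonneg) simp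
    then have "\<epsilon> S > 0" unfolding \<epsilon>_def by (intro divide_pos_pos) linarith+
    moreover have "(\<Prod>G\<in>S \<inter> good. G) \<in> shifted_polys w" "residue_eval w y (\<Prod>G\<in>S \<inter> good. G) \<noteq> 0"
      using prod[of "S \<inter> good"] by (simp_all add: good_def)
    ultimately obtain x t where "x \<in> X" "0 < t" "t < \<epsilon> S" "curve_eval x t (\<Prod>G\<in>S \<inter> good. G) \<noteq> 0"
      using nonvanishing_near_zero[OF y] by blast
    then show "\<exists>p. fst p \<in> X \<and> 0 < snd p \<and> snd p < \<epsilon> S \<and> curve_eval (fst p) (snd p) (\<Prod>G\<in>S \<inter> good. G) \<noteq> 0"
      by (intro exI[of _ "(x, t)"]) simp
  qed
  from choice[OF this] obtain p where p: "\<And>S. fst (p S) \<in> X" "\<And>S. 0 < snd (p S)" "\<And>S. snd (p S) < \<epsilon> S"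
    "\<And>S. curve_eval (fst (p S)) (snd (p S)) (\<Prod>G\<in>S \<inter> good. G) \<noteq> 0" by blast
  have fin: "eventually (\<lambda>S. finite S \<and> G \<in> S) index_ultrafilter" for G :: "'m \<times> real \<Rightarrow>\<^sub>0 complex"
    by (intro eventually_conj eventually_finite_index_ultrafilter eventually_mem_index_ultrafilter)
  have "((\<lambda>S. snd (p S)) \<longlongrightarrow> 0) index_ultrafilter"
  proof (rule tendstoI)
    fix \<delta> :: real assume "\<delta> > 0"
    let ?G = "Poly_Mapping.single 0 (complex_of_real (1 / \<delta>)) :: 'm \<times> real \<Rightarrow>\<^sub>0 complex"
    show "eventually (\<lambda>S. dist (snd (p S)) 0 < \<delta>) index_ultrafilter"
      using fin[of ?G]
    proof eventually_elim
      case (elim S)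
      have "cmod (Poly_Mapping.lookup ?G 0) \<le> (\<Sum>G\<in>S. cmod (Poly_Mapping.lookup G 0))"
        by (rule member_le_sum) (use elim in auto)
      then have "1 / \<delta> < 1 + (\<Sum>G\<in>S. cmod (Poly_Mapping.lookup G 0))" using \<open>\<delta> > 0\<close> by (simp add: norm_divide)
      then have "\<epsilon> S < 1 / (1 / \<delta>)" unfolding \<epsilon>_def using \<open>\<delta> > 0\<close> by (intro divide_strict_left_mono mult_pos_pos) (auto intro: less_trans[of 0 "1 / \<delta>"])
      then show ?case using p(2,3)[of S] by (simp add: dist_real_def)
    qed
  qed
  moreover have "eventually (\<lambda>S. curve_eval (fst (p S)) (snd (p S)) G \<noteq> 0) index_ultrafilter"
    if G: "G \<in> shifted_polys w" "residue_eval w y G \<noteq> 0" for G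
    using fin[of G]
  proof eventually_elim
    case (elim S)
    have "finite (S \<inter> good)" "G \<in> S \<inter> good" using elim G by (simp_all add: good_def)
    then have "(\<Prod>G\<in>S \<inter> good. G) = G * (\<Prod>G\<in>S \<inter> good - {G}. G)" by (rule prod.remove)
    then have "curve_eval (fst (p S)) (snd (p S)) G * curve_eval (fst (p S)) (snd (p S)) (\<Prod>G\<in>S \<inter> good - {G}. G) \<noteq> 0"
      using p(4)[of S] curve_eval_ops(2)[of "fst (p S)"] p(1) X by (metis subsetD)
    then show ?case by simp
  qed
  ultimately show ?thesis using p(1,2) by (intro exI[of _ "\<lambda>S. fst (p S)"] exI[of _ "\<lambda>S. snd (p S)"]) simp
qed

text \<open>Chevalley's theorem needs a well-defined residue: if the values of \<open>G\<close> have
  class 0, genericity excludes a nonzero residue.\<close>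

lemma curve_place:
  fixes w :: "'m::ab_group_add \<Rightarrow> real" and x :: "('m \<times> real \<Rightarrow>\<^sub>0 complex) set \<Rightarrow> 'm \<Rightarrow> complex"
  assumes w: "Modules.additive w" and y: "y \<in> T_N" and x: "\<And>S. x S \<in> T_N" and t: "\<And>S. 0 < t S"
    and generic: "\<And>G. G \<in> shifted_polys w \<Longrightarrow> residue_eval w y G \<noteq> 0 \<Longrightarrow>
      eventually (\<lambda>S. curve_eval (x S) (t S) G \<noteq> 0) index_ultrafilter"
  shows "\<exists>\<Phi>. place \<Phi> \<and> (\<forall>G\<in>shifted_polys w. (ultra_class (\<lambda>S. curve_eval (x S) (t S) G), residue_eval w y G) \<in> \<Phi>)"
proof -
  let ?g = "(\<lambda>G. (ultra_class (\<lambda>S. curve_eval (x S) (t S) G), residue_eval w y G)) ` shifted_polys w"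
  have I: "(ultra_class (\<lambda>S. curve_eval (x S) (t S) G), residue_eval w y G) \<in> ?g" if "G \<in> shifted_polys w" for G
    using that by (rule imageI)
  have "hom_graph ?g"
    unfolding hom_graph_def
  proof (intro conjI allI impI)
    have "curve_eval (x S) (t S) 1 = 1" for S
      using x[of S] t[of S] by (simp add: curve_eval_def poly_eval_def T_N_def)
    moreover have "residue_eval w y 1 = 1" "1 \<in> shifted_polys w"
      using y by (simp_all add: residue_eval_def shifted_polys_def poly_eval_def T_N_def additive.zero[OF w])
    ultimately show "(1, 1) \<in> ?g" using I[of 1] by (simp add: ultra_class_1)
  next
    fix a b c d assume "(a, b) \<in> ?g" "(c, d) \<in> ?g"
    then obtain F G where F: "F \<in> shifted_polys w" "a = ultra_class (\<lambda>S. curve_eval (x S) (t S) F)" "b = residue_eval w y F"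
      and G: "G \<in> shifted_polys w" "c = ultra_class (\<lambda>S. curve_eval (x S) (t S) G)" "d = residue_eval w y G" by blast
    show "(a - c, b - d) \<in> ?g" "(a * c, b * d) \<in> ?g"
      using I[of "F - G"] I[of "F * G"] residue_eval_ops[OF w y F(1) G(1)]
      by (simp_all add: F(2,3) G(2,3) ultra_class_ops curve_eval_ops[OF x])
  next
    fix b assume "(0, b) \<in> ?g"
    then obtain G where G: "G \<in> shifted_polys w" "0 = ultra_class (\<lambda>S. curve_eval (x S) (t S) G)" "b = residue_eval w y G" by blast
    have "eventually (\<lambda>S. curve_eval (x S) (t S) G = 0) index_ultrafilter" using G(2) ultra_class_eq_0_iff by metis
    then show "b = 0"
      using generic[OF G(1)] ultrafilter_not_eventually[OF index_ultrafilter(1)] by (auto simp: G(3))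
  qed
  then obtain \<Phi> where "place \<Phi>" "?g \<subseteq> \<Phi>" by (rule hom_graph_extends_to_place)
  then show ?thesis by blast
qed

section \<open>From an initial point to a phase limit\<close>

context free_lattice
begin

lemma initial_point_over_puiseux:
  fixes X :: "('m \<Rightarrow> complex) set"
  assumes X: "X \<subseteq> T_N" and w: "Modules.additive w" and y: "y \<in> initial_locus w X"
  shows "\<exists>(t :: ('m \<times> real \<Rightarrow>\<^sub>0 complex) set \<Rightarrow> real) h. (\<forall>S. 0 < t S) \<and> (t \<longlongrightarrow> 0) index_ultrafilter \<and>
    (\<forall>j<n. (h j \<longlongrightarrow> y (basis j)) index_ultrafilter) \<and> (\<forall>j S. h j S \<noteq> 0) \<and>
    (\<forall>f\<in>vanishing_ideal X. eventually (\<lambda>S. laurent_eval f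
      (\<lambda>m. \<Prod>j<n. (complex_of_real (t S powr w (basis j)) * h j S) powi coord m j) = 0) index_ultrafilter)"
proof -
  let ?U = "index_ultrafilter :: ('m \<times> real \<Rightarrow>\<^sub>0 complex) set filter"
  have ultra: "ultrafilter ?U" by (rule index_ultrafilter)
  have yT: "y \<in> T_N" using y by (simp add: mem_initial_locus_iff)
  then have ynz: "y m \<noteq> 0" and y0: "y 0 = 1" and yadd: "y (a + b) = y a * y b" for m a b by (simp_all add: T_N_def)
  note gen = generic_family[OF w y X]
  obtain x :: "('m \<times> real \<Rightarrow>\<^sub>0 complex) set \<Rightarrow> 'm \<Rightarrow> complex" and t
    where xX: "\<And>S. x S \<in> X" and t: "\<And>S. 0 < t S" "(t \<longlongrightarrow> 0) ?U"
      and g: "\<And>G. G \<in> shifted_polys w \<Longrightarrow> residue_eval w y G \<noteq> 0 \<Longrightarrow> eventually (\<lambda>S. curve_eval (x S) (t S) G \<noteq> 0) ?U"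
    using gen by blast
  have xT: "x S \<in> T_N" for S using xX X by blast
  then have x0: "x S 0 = 1" and xadd: "x S (a + b) = x S a * x S b" and xnz: "x S a \<noteq> 0" for S a b by (simp_all add: T_N_def)
  obtain \<Phi> where \<Phi>: "place \<Phi>"
    and \<Phi>I: "\<And>G. G \<in> shifted_polys w \<Longrightarrow> (ultra_class (\<lambda>S. curve_eval (x S) (t S) G), residue_eval w y G) \<in> \<Phi>"
    using curve_place[OF w yT xT t(1) g] by blast
  note h = place_imp_hom_graph[OF \<Phi>]
  let ?st = "standard_part :: (('m \<times> real \<Rightarrow>\<^sub>0 complex) ultrapower \<times> complex) set"
  have st: "place ?st" by (rule place_standard_part)
  note hst = place_imp_hom_graph[OF st]
  define \<iota> where "\<iota> c = (ultra_class (\<lambda>_. c) :: ('m \<times> real \<Rightarrow>\<^sub>0 complex) ultrapower)" for c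
  define \<tau> where "\<tau> s = ultra_class (\<lambda>S. complex_of_real (t S powr s))" for s
  \<comment> \<open>At \<open>\<Phi>\<close> the rescaled monomial has the residue
    \<open>y m\<close>; its standard part may be another value or fail to exist.\<close>
  define \<beta> where "\<beta> m = ultra_class (\<lambda>S. x S m * complex_of_real (t S powr (- w m)))" for m
  have \<iota>_hom: "\<iota> (a + b) = \<iota> a + \<iota> b" "\<iota> (a * b) = \<iota> a * \<iota> b" "\<iota> 1 = 1" "\<iota> 0 = 0" for a b
    by (simp_all add: \<iota>_def ultra_class_ops ultra_class_1 ultra_class_0)
  have \<tau>_hom: "\<tau> (a + b) = \<tau> a * \<tau> b" for a b by (simp add: \<tau>_def ultra_class_ops powr_add)
  have \<tau>0: "\<tau> 0 = 1" using t(1) by (simp add: \<tau>_def ultra_class_1 less_imp_neq[symmetric])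
  have \<beta>_hom: "\<beta> (a + b) = \<beta> a * \<beta> b" for a b
  proof -
    have "t S powr (- w (a + b)) = t S powr (- w a) * t S powr (- w b)" for S
      by (simp only: additive.add[OF w] minus_add_distrib powr_add)
    then show ?thesis by (simp add: \<beta>_def ultra_class_ops xadd mult_ac)
  qed
  have \<beta>0: "\<beta> 0 = 1" using t(1) by (simp add: \<beta>_def ultra_class_1 x0 additive.zero[OF w] less_imp_neq[symmetric])
  have single: "(ultra_class (\<lambda>S. c * (x S m * complex_of_real (t S powr s))), c * (if s + w m = 0 then y m else 0)) \<in> \<Phi>"
    if s: "0 \<le> s + w m" for c m s
  proof -
    have "Poly_Mapping.single (m, s) c \<in> shifted_polys w" using s by (auto simp: shifted_polys_def split: if_splits)
    from \<Phi>I[OF this] show ?thesis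
      by (cases "s + w m = 0") (simp_all add: curve_eval_def residue_eval_def poly_eval_single)
  qed
  have \<iota>\<Phi>: "(\<iota> c, c) \<in> \<Phi>" for c
  proof -
    have "t S powr 0 = 1" for S using t(1)[of S] by simp
    then show ?thesis using single[of 0 0 c] by (simp add: \<iota>_def x0 y0 additive.zero[OF w])
  qed
  have \<tau>\<Phi>: "(\<tau> s, 0) \<in> \<Phi>" if "s > 0" for s
    using single[of s 0 1] that by (simp add: \<tau>_def x0 additive.zero[OF w])
  have \<beta>\<Phi>: "(\<beta> m, y m) \<in> \<Phi>" for m
    using single[of "- w m" m 1] by (simp add: \<beta>_def)
  have stI: "(ultra_class f, l) \<in> ?st" if "(f \<longlongrightarrow> l) ?U" for f l using that unfolding standard_part_def by blast
  have \<iota>st: "(\<iota> c, c) \<in> ?st" for c unfolding \<iota>_def by (rule stI[OF tendsto_const])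
  have \<tau>st: "(\<tau> s, 0) \<in> ?st" if "s > 0" for s
  proof -
    have "((\<lambda>S. t S powr s) \<longlongrightarrow> 0 powr s) ?U"
      by (rule tendsto_powr'[OF t(2) tendsto_const]) (use that less_imp_le[OF t(1)] in simp)
    then have "((\<lambda>S. complex_of_real (t S powr s)) \<longlongrightarrow> complex_of_real (0 powr s)) ?U" by (rule tendsto_of_real)
    then show ?thesis unfolding \<tau>_def using stI by simp
  qed
  obtain L where L: "subfield_on L" "range \<iota> \<subseteq> L" "range \<tau> \<subseteq> L"
    and agree: "\<And>x y. x \<in> L \<Longrightarrow> (x, y) \<in> \<Phi> \<Longrightarrow> (x, y) \<in> ?st"
    using puiseux_subfield[OF \<Phi> st \<iota>_hom(1,2,3) \<iota>\<Phi> \<iota>st \<tau>_hom \<tau>0 \<tau>\<Phi> \<tau>st] by blast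
  \<comment> \<open>Inverses are included because a homomorphism defined at an element need not be
    defined at its inverse.\<close>
  define C where "C = \<beta> ` (basis ` {..<n} \<union> (\<lambda>j. - basis j) ` {..<n})"
  have fin: "finite C" by (simp add: C_def)
  then obtain bs where bs: "set bs = C" using finite_list by blast
  have tower: "C \<subseteq> tower L bs" using tower_properties[OF L(1), of bs] bs by blast
  have dom: "C \<subseteq> Domain \<Phi>" unfolding C_def using \<beta>\<Phi> by blast
  have \<tau>1: "\<tau> 1 \<in> L" "\<tau> 1 \<noteq> 0" "(\<tau> 1, 0) \<in> \<Phi>"
    using L(3) \<tau>\<Phi>[of 1] \<tau>_hom[of 1 "- 1"] \<tau>0 by auto
  have "\<exists>R. hom_graph R \<and> Id_on L \<subseteq> R \<and> (\<forall>c\<in>C. \<exists>c' z. (c, c') \<in> R \<and> (c, z) \<in> \<Phi> \<and> (c', z) \<in> ?st)"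
    by (rule change_of_place[OF \<Phi> st \<iota>\<Phi> \<iota>st L(1,2) \<tau>1 agree fin tower dom])
  then obtain R where R: "hom_graph R" "Id_on L \<subseteq> R"
    and RC: "\<forall>c\<in>C. \<exists>c' z. (c, c') \<in> R \<and> (c, z) \<in> \<Phi> \<and> (c', z) \<in> ?st"
    by (elim exE conjE)
  define P where "P m \<longleftrightarrow> (\<exists>c. (\<beta> m, c) \<in> R \<and> (c, y m) \<in> ?st)" for m
  have PC: "P m" if mC: "\<beta> m \<in> C" for m
  proof -
    obtain c z where c: "(\<beta> m, c) \<in> R" "(\<beta> m, z) \<in> \<Phi>" "(c, z) \<in> ?st" using bspec[OF RC mC] by blast
    have "z = y m" by (rule hom_graph_unique[OF h c(2) \<beta>\<Phi>])
    then show ?thesis unfolding P_def using c(1,3) by blast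
  qed
  have Padd: "P (a + b)" if "P a" "P b" for a b
    using that hom_graph_mult[OF R(1)] hom_graph_mult[OF hst] unfolding P_def \<beta>_hom yadd by blast
  have P: "P m" for m
  proof -
    have "m \<in> {m. P m \<and> P (- m)}"
    proof (rule subgroup_eq_UNIV)
      have "P 0" unfolding P_def \<beta>0 y0 using hom_graph_one[OF R(1)] hom_graph_one[OF hst] by blast
      then show "0 \<in> {m. P m \<and> P (- m)}" by simp
    next
      fix a b assume "a \<in> {m. P m \<and> P (- m)}" "b \<in> {m. P m \<and> P (- m)}"
      then show "a - b \<in> {m. P m \<and> P (- m)}" using Padd[of a "- b"] Padd[of "- a" b] by (simp add: add.commute)
    next
      fix j assume "j < n"
      then show "basis j \<in> {m. P m \<and> P (- m)}" using PC[of "basis j"] PC[of "- basis j"] by (simp add: C_def)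
    qed
    then show ?thesis by simp
  qed
  from P have "\<forall>m. \<exists>c. (\<beta> m, c) \<in> R \<and> (c, y m) \<in> ?st" unfolding P_def by blast
  from choice[OF this] obtain \<gamma> where \<gamma>R: "\<And>m. (\<beta> m, \<gamma> m) \<in> R" and \<gamma>st: "\<And>m. (\<gamma> m, y m) \<in> ?st" by blast
  have \<gamma>_hom: "\<gamma> (a + b) = \<gamma> a * \<gamma> b" for a b
    by (rule hom_graph_unique[OF R(1) \<gamma>R]) (unfold \<beta>_hom, rule hom_graph_mult[OF R(1) \<gamma>R \<gamma>R])
  have \<gamma>0: "\<gamma> 0 = 1" by (rule hom_graph_unique[OF R(1) \<gamma>R]) (unfold \<beta>0, rule hom_graph_one[OF R(1)])
  have \<gamma>nz: "\<gamma> m \<noteq> 0" for m by (rule hom_graph_nonzero[OF hst \<gamma>st ynz])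
  \<comment> \<open>The moved point: \<open>\<gamma> m\<close> is the image of
    \<open>\<beta> m\<close> and has standard part \<open>y m\<close>, and the power of t restores
    the original scale.\<close>
  define \<Gamma> where "\<Gamma> m = \<tau> (w m) * \<gamma> m" for m
  have \<Gamma>_hom: "\<Gamma> (a + b) = \<Gamma> a * \<Gamma> b" for a b
    by (simp add: \<Gamma>_def \<gamma>_hom \<tau>_hom additive.add[OF w] mult_ac)
  have \<Gamma>0: "\<Gamma> 0 = 1" by (simp add: \<Gamma>_def \<gamma>0 \<tau>0 additive.zero[OF w])
  have \<Gamma>nz: "\<Gamma> m \<noteq> 0" for m using \<Gamma>_hom[of m "- m"] \<Gamma>0 by auto
  \<comment> \<open>The relation holds at the generic point, its coefficients lie in
    \<open>L\<close>, and \<open>R\<close> fixes \<open>L\<close> pointwise, so it passes from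
    \<open>\<beta>\<close> to \<open>\<gamma>\<close>.\<close>
  have zero: "(\<Sum>m\<in>Poly_Mapping.keys f. \<iota> (Poly_Mapping.lookup f m) * \<Gamma> m) = 0" if f: "f \<in> vanishing_ideal X" for f
  proof -
    have "ultra_class (\<lambda>S. laurent_eval f (x S)) = 0"
      using f xX by (simp add: vanishing_ideal_def ultra_class_0)
    moreover have "ultra_class (\<lambda>S. laurent_eval f (x S)) =
      (\<Sum>m\<in>Poly_Mapping.keys f. \<iota> (Poly_Mapping.lookup f m) * \<tau> (w m) * \<beta> m)"
    proof -
      have xt: "complex_of_real (t S powr w m) * (x S m * complex_of_real (t S powr (- w m))) = x S m" for S m
        using t(1)[of S] by (simp add: powr_minus)
      show ?thesis
        unfolding laurent_eval_def ultra_class_sum[symmetric] \<iota>_def \<tau>_def \<beta>_def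
        by (simp only: ultra_class_ops mult.assoc xt)
    qed
    ultimately have eq: "(\<Sum>m\<in>Poly_Mapping.keys f. \<iota> (Poly_Mapping.lookup f m) * \<tau> (w m) * \<beta> m) = 0" by simp
    have LR: "(z, z) \<in> R" if "z \<in> L" for z using R(2) that by blast
    have "\<iota> c * \<tau> s \<in> L" for c s using L(2,3) subfield_ops(4)[OF L(1)] by blast
    then have "(\<iota> (Poly_Mapping.lookup f m) * \<tau> (w m) * \<beta> m, \<iota> (Poly_Mapping.lookup f m) * \<tau> (w m) * \<gamma> m) \<in> R" for m
      by (intro hom_graph_mult[OF R(1) LR \<gamma>R])
    then have "((\<Sum>m\<in>Poly_Mapping.keys f. \<iota> (Poly_Mapping.lookup f m) * \<tau> (w m) * \<beta> m),
      (\<Sum>m\<in>Poly_Mapping.keys f. \<iota> (Poly_Mapping.lookup f m) * \<tau> (w m) * \<gamma> m)) \<in> R"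
      by (rule hom_graph_sum[OF R(1)])
    from hom_graph_zeroD[OF R(1) this[unfolded eq]] show ?thesis by (simp add: \<Gamma>_def mult.assoc)
  qed
  have "\<forall>j. \<exists>f. \<gamma> (basis j) = ultra_class f" using ultra_class_surj by metis
  from choice[OF this] obtain h0 where h0: "\<And>j. \<gamma> (basis j) = ultra_class (h0 j)" by blast
  \<comment> \<open>Replacing exceptional zeros by 1 does not change the class and keeps every
    representative in the torus, not only almost every one.\<close>
  define h where "h j S = (if h0 j S = 0 then 1 else h0 j S)" for j S
  have hnz: "h j S \<noteq> 0" for j S by (simp add: h_def)
  have h: "ultra_class (h j) = \<gamma> (basis j)" for j
  proof -
    have "\<not> eventually (\<lambda>S. h0 j S = 0) index_ultrafilter" using \<gamma>nz[of "basis j"] by (simp add: h0 ultra_class_eq_0_iff)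
    then have "eventually (\<lambda>S. h0 j S \<noteq> 0) index_ultrafilter" using ultrafilter_not_eventually[OF ultra] by blast
    then have "eventually (\<lambda>S. h j S = h0 j S) index_ultrafilter" by eventually_elim (simp add: h_def)
    then show ?thesis by (simp add: h0 ultra_class_eq_iff)
  qed
  have hlim: "(h j \<longlongrightarrow> y (basis j)) index_ultrafilter" for j
    by (rule standard_partD) (simp add: h \<gamma>st)
  define z where "z S m = (\<Prod>j<n. (complex_of_real (t S powr w (basis j)) * h j S) powi coord m j)" for S m
  have nz: "complex_of_real (t S powr w (basis j)) * h j S \<noteq> 0" for S j using hnz[of j S] t(1)[of S] by simp
  have zdiff: "z S (a - b) = z S a * inverse (z S b)" for S a b
    unfolding z_def prod_inversef[symmetric] prod.distrib[symmetric]
    using nz by (intro prod.cong refl) (simp add: power_int_diff divide_inverse)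
  have z\<Gamma>: "ultra_class (\<lambda>S. z S m) = \<Gamma> m" for m
  proof -
    have "m \<in> {m. ultra_class (\<lambda>S. z S m) = \<Gamma> m}"
    proof (rule subgroup_eq_UNIV)
      show "0 \<in> {m. ultra_class (\<lambda>S. z S m) = \<Gamma> m}" by (simp add: z_def \<Gamma>0 ultra_class_1)
    next
      fix a b assume ab: "a \<in> {m. ultra_class (\<lambda>S. z S m) = \<Gamma> m}" "b \<in> {m. ultra_class (\<lambda>S. z S m) = \<Gamma> m}"
      have "ultra_class (\<lambda>S. z S (a - b)) = ultra_class (\<lambda>S. z S a) * inverse (ultra_class (\<lambda>S. z S b))"
        by (simp only: zdiff ultra_class_ops)
      also have "\<dots> = \<Gamma> a * inverse (\<Gamma> b)" using ab by simp
      also have "\<dots> = \<Gamma> (a - b)" using \<Gamma>_hom[of "a - b" b] \<Gamma>nz[of b] by (simp add: divide_inverse[symmetric])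
      finally show "a - b \<in> {m. ultra_class (\<lambda>S. z S m) = \<Gamma> m}" by simp
    next
      fix i assume i: "i < n"
      have "z S (basis i) = (\<Prod>j<n. if j = i then complex_of_real (t S powr w (basis i)) * h i S else 1)" for S
        unfolding z_def by (intro prod.cong) (auto simp: coord_basis[OF i])
      then have "z S (basis i) = complex_of_real (t S powr w (basis i)) * h i S" for S using i by simp
      then show "basis i \<in> {m. ultra_class (\<lambda>S. z S m) = \<Gamma> m}"
        by (simp add: \<Gamma>_def \<tau>_def ultra_class_ops flip: h)
    qed
    then show ?thesis by simp
  qed
  have "eventually (\<lambda>S. laurent_eval f (z S) = 0) index_ultrafilter" if "f \<in> vanishing_ideal X" for f
  proof -
    have "ultra_class (\<lambda>S. laurent_eval f (z S)) = (\<Sum>m\<in>Poly_Mapping.keys f. \<iota> (Poly_Mapping.lookup f m) * \<Gamma> m)"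
      unfolding laurent_eval_def ultra_class_sum[symmetric] \<iota>_def z\<Gamma>[symmetric] by (simp add: ultra_class_ops)
    then show ?thesis using zero[OF that] by (simp add: ultra_class_eq_0_iff)
  qed
  then show ?thesis
    unfolding z_def using t hlim hnz by (intro exI[of _ t] exI[of _ h]) simp
qed

lemma coamoeba_initial_locus_subset:
  fixes X :: "('m \<Rightarrow> complex) set"
  assumes X: "closed_subvariety X" and \<nu>: "norm_on_R_N \<nu>" and w: "w \<in> R_N" "w \<noteq> (\<lambda>_. 0)"
  shows "coamoeba (initial_locus w X) \<subseteq> phase_limit_set \<nu> X"
proof
  fix u assume "u \<in> coamoeba (initial_locus w X)"
  then obtain y where y: "y \<in> initial_locus w X" and u: "u = arg_map y" by (auto simp: coamoeba_def)
  have yT: "y \<in> T_N" using y by (simp add: mem_initial_locus_iff)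
  have ynz: "y m \<noteq> 0" for m using yT by (simp add: T_N_def)
  have XT: "X \<subseteq> T_N" using X by (auto simp: closed_subvariety_def zero_locus_def)
  have wa: "Modules.additive w" using w(1) by (simp add: R_N_def)
  let ?U = "index_ultrafilter :: ('m \<times> real \<Rightarrow>\<^sub>0 complex) set filter"
  have ultra: "ultrafilter ?U" by (rule index_ultrafilter)
  then have U0: "?U \<noteq> bot" by (simp add: ultrafilter_def)
  note point = initial_point_over_puiseux[OF XT wa y]
  obtain t :: "('m \<times> real \<Rightarrow>\<^sub>0 complex) set \<Rightarrow> real" and h
    where t: "\<And>S. 0 < t S" "(t \<longlongrightarrow> 0) ?U" and h: "\<And>j. j < n \<Longrightarrow> (h j \<longlongrightarrow> y (basis j)) ?U"
      and hnz: "\<And>j S. h j S \<noteq> 0"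
      and ev: "\<And>f. f \<in> vanishing_ideal X \<Longrightarrow> eventually (\<lambda>S. laurent_eval f
        (\<lambda>m. \<Prod>j<n. (complex_of_real (t S powr w (basis j)) * h j S) powi coord m j) = 0) ?U"
    using point by blast
  define z where "z S m = (\<Prod>j<n. (complex_of_real (t S powr w (basis j)) * h j S) powi coord m j)" for S m
  have nz: "complex_of_real (t S powr w (basis j)) * h j S \<noteq> 0" for S j using hnz[of j S] t(1)[of S] by simp
  have zT: "z S \<in> T_N" for S
    unfolding T_N_def z_def using nz by (simp add: power_int_add prod.distrib)
  have zb: "z S (basis i) = complex_of_real (t S powr w (basis i)) * h i S" if i: "i < n" for S i
  proof -
    have "z S (basis i) = (\<Prod>j<n. if j = i then complex_of_real (t S powr w (basis i)) * h i S else 1)"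
      unfolding z_def by (intro prod.cong) (auto simp: coord_basis[OF i])
    then show ?thesis using i by simp
  qed
  \<comment> \<open>The exceptional indices depend on the equation; a finite system makes almost all
    representatives satisfy every equation of \<open>X\<close> at once.\<close>
  obtain E where E: "finite E" "X = zero_locus E" by (rule finitely_many_equations[OF X])
  have "eventually (\<lambda>S. \<forall>f\<in>E. laurent_eval f (z S) = 0) ?U"
  proof (intro eventually_ball_finite ballI E(1))
    fix f assume "f \<in> E"
    then have "f \<in> vanishing_ideal X" by (auto simp: E(2) vanishing_ideal_def zero_locus_def)
    from ev[OF this] show "eventually (\<lambda>S. laurent_eval f (z S) = 0) ?U" unfolding z_def .
  qed
  then have zX: "eventually (\<lambda>S. z S \<in> X) ?U" unfolding E(2) zero_locus_def by eventually_elim (simp add: zT)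
  have arg: "((\<lambda>S. arg_map (z S) (basis j)) \<longlongrightarrow> u (basis j)) ?U" if "j < n" for j
  proof -
    have "arg_map (z S) (basis j) = h j S / complex_of_real (cmod (h j S))" for S
      using t(1)[of S] by (simp add: arg_map_def zb[OF that] norm_mult)
    moreover have "((\<lambda>S. h j S / complex_of_real (cmod (h j S))) \<longlongrightarrow> y (basis j) / complex_of_real (cmod (y (basis j)))) ?U"
      by (intro tendsto_divide tendsto_of_real tendsto_norm h that) (simp add: ynz)
    ultimately show ?thesis by (simp add: u arg_map_def)
  qed
  \<comment> \<open>The logarithm of \<open>z S\<close> is \<open>ln (t S)\<close> times
    \<open>w\<close>, up to this error, which stays bounded because the \<open>h j\<close> have
    nonzero limits.\<close>
  define v where "v S m = Log_map (z S) m - ln (t S) * w m" for S m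
  have v: "Modules.additive (v S)" for S
    unfolding v_def by (intro additive_diff additive_scale wa Log_map_additive zT)
  have vb: "v S (basis j) = ln (cmod (h j S))" if "j < n" for S j
    using t(1)[of S] hnz[of j S] by (simp add: v_def Log_map_def zb[OF that] norm_mult ln_mult ln_powr)
  obtain C where C: "\<And>w. Modules.additive w \<Longrightarrow> \<nu> w \<le> (\<Sum>j<n. \<bar>w (basis j)\<bar> * C j)"
    using norm_le_coordinates[OF \<nu>] by blast
  define K where "K = (\<Sum>j<n. \<bar>ln (cmod (y (basis j)))\<bar> * C j)"
  have "((\<lambda>S. \<Sum>j<n. \<bar>v S (basis j)\<bar> * C j) \<longlongrightarrow> K) ?U"
    unfolding K_def
  proof (intro tendsto_sum tendsto_mult tendsto_rabs tendsto_const)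
    fix j assume "j \<in> {..<n}"
    then show "((\<lambda>S. v S (basis j)) \<longlongrightarrow> ln (cmod (y (basis j)))) ?U"
      using tendsto_ln[OF tendsto_norm[OF h[of j]]] ynz by (simp add: vb)
  qed
  then have "eventually (\<lambda>S. (\<Sum>j<n. \<bar>v S (basis j)\<bar> * C j) < K + 1) ?U" by (rule order_tendstoD(2)) simp
  then have vK: "eventually (\<lambda>S. \<nu> (v S) \<le> K + 1) ?U" by eventually_elim (use C[OF v] order_trans less_imp_le in blast)
  have \<nu>w: "\<nu> w > 0" using norm_on_R_N_props(2,3)[OF \<nu> wa] w(2) by (simp add: less_le)
  have unb: "eventually (\<lambda>S. \<nu> (Log_map (z S)) > B) ?U" for B
  proof -
    \<comment> \<open>Then \<open>t S < exp (- ?r)\<close> makes the norm of \<open>ln (t S)\<close>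
      times \<open>w\<close> exceed \<open>\<bar>B + K + 1\<bar>\<close>, which leaves more than
      \<open>B\<close> after subtracting an error of norm at most \<open>K + 1\<close>.\<close>
    let ?r = "\<bar>B + K + 1\<bar> / \<nu> w"
    have "eventually (\<lambda>S. t S < exp (- ?r)) ?U" by (rule order_tendstoD(2)[OF t(2)]) simp
    with vK show ?thesis
    proof eventually_elim
      case (elim S)
      have "ln (t S) < ln (exp (- ?r))" using elim(2) t(1)[of S] by (subst ln_less_cancel_iff) simp_all
      then have "ln (t S) < - ?r" by (simp only: ln_exp)
      then have "?r < \<bar>ln (t S)\<bar>" by linarith
      then have "\<bar>B + K + 1\<bar> < \<bar>ln (t S)\<bar> * \<nu> w" using \<nu>w by (simp add: pos_divide_less_eq)
      also have "\<dots> = \<nu> (\<lambda>m. ln (t S) * w m)" by (simp add: norm_on_R_N_props(4)[OF \<nu> wa])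
      also have "\<dots> = \<nu> (\<lambda>m. Log_map (z S) m + (- 1) * v S m)" by (simp add: v_def)
      also have "\<dots> \<le> \<nu> (Log_map (z S)) + \<nu> (\<lambda>m. (- 1) * v S m)"
        by (rule norm_on_R_N_props(5)[OF \<nu> Log_map_additive[OF zT] additive_scale[OF v]])
      also have "\<nu> (\<lambda>m. (- 1) * v S m) = \<nu> (v S)" unfolding norm_on_R_N_props(4)[OF \<nu> v] by simp
      finally show ?case using elim(1) by linarith
    qed
  qed
  show "u \<in> phase_limit_set \<nu> X"
    using phase_limit_setI[OF U0 XT zX _ arg unb] arg_map_mem[OF yT] by (simp add: u)
qed

end

theorem theorem1:
  fixes X :: "('m::ab_group_add \<Rightarrow> complex) set"
    and \<nu> :: "('m \<Rightarrow> real) \<Rightarrow> real"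
  assumes "free_of_finite_rank TYPE('m)"
    and "norm_on_R_N \<nu>"
    and "closed_subvariety X"
  shows "top_of_set U_N closure_of coamoeba X = coamoeba X \<union> phase_limit_set \<nu> X \<and>
         phase_limit_set \<nu> X = (\<Union>w\<in>R_N - {\<lambda>_. 0}. coamoeba (initial_locus w X))"
proof -
  obtain n and \<phi> :: "'m \<Rightarrow> (nat \<Rightarrow>\<^sub>0 int)" where \<phi>: "Modules.additive \<phi>" "bij_betw \<phi> UNIV {c. Poly_Mapping.keys c \<subseteq> {..<n}}"
    using assms(1) unfolding free_of_finite_rank_def by blast
  interpret free_lattice \<phi> n by (rule free_lattice.intro[OF \<phi>])
  have "phase_limit_set \<nu> X \<subseteq> (\<Union>w\<in>R_N - {\<lambda>_. 0}. coamoeba (initial_locus w X))"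
  proof
    fix u assume "u \<in> phase_limit_set \<nu> X"
    from phase_limit_set_subset[OF assms(3,2) this] show "u \<in> (\<Union>w\<in>R_N - {\<lambda>_. 0}. coamoeba (initial_locus w X))" by blast
  qed
  moreover have "(\<Union>w\<in>R_N - {\<lambda>_. 0}. coamoeba (initial_locus w X)) \<subseteq> phase_limit_set \<nu> X"
    using coamoeba_initial_locus_subset[OF assms(3,2)] by blast
  ultimately show ?thesis using closure_coamoeba[OF assms(3,2)] by blast
qed

end
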